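(* Let $n\in\mathbb{N}$ with $n\geq 2$, let $\nu>0$, and let $u_0\in C^\infty(\mathbb{T}^n)^n$ with $\mathrm{div}\, u_0=0$. There exists \[T^*\geq\begin{cases}\infty & \text{if }\|u_0\|_{\mathsf{A},0}\leq\nu,\\[2pt] \dfrac{2\nu}{\|u_0\|_{\mathsf{A},0}^2} & \text{if }\|u_0\|_{\mathsf{A},0}>\nu,\end{cases}\] such that the $n$-dimensional periodic Navier--Stokes equation with viscosity $\nu$ and initial data $u_0$ has a unique smooth solution $u\in C^\infty([0,T^* ),C^\infty(\mathbb{T}^n)^n)$. If the a priori bound $\|u(\cdot,t)\|_{\mathsf{A},0}\leq C<\infty$ holds for all $t\in[0,T]$, then $T^*>T$. (Here $T^*$ is the maximal time of existence of the smooth solution, and an a priori bound on $[0,T]$ means that there is a constant $C<\infty$ with $\|u(\cdot,t)\|_{\mathsf{A},0}\leq C$ for all those $t\in[0,T]$ for which the solution exists, i.e. all $t\in[0,T]\cap[0,T^* )$.)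
   Context: $\mathbb{T}:=\mathbb{R}/(2\pi\mathbb{Z})$. $C^\infty(\mathbb{T}^n)^n=C^\infty(\mathbb{T}^n,\mathbb{R}^n)$ is the space of smooth $\mathbb{R}^n$-valued functions on $\mathbb{T}^n$. $C^\infty([0,T^* ),C^\infty(\mathbb{T}^n)^n)$ denotes the set of functions $f:\mathbb{T}^n\times[0,T^* )\to\mathbb{R}^n$ which are $C^\infty$ in $t\in[0,T^* )$ and $C^\infty$ in $x\in\mathbb{T}^n$; $T^*\in(0,\infty]$. $f\in C^\infty(\mathbb{T}^n)^n$ is expanded into its Fourier series $f(x)=\sum_{k\in\mathbb{Z}^n}f_ke^{ik\cdot x}$ with $f_k\in\mathbb{C}^n$. The Leray projector $\mathbb{P}$ acts by $\mathbb{P}f(x)=\sum_{k\in\mathbb{Z}^n}\mathbb{P}_kf_k\,e^{ik\cdot x}$, where $\mathbb{P}_0:=\mathrm{id}$ and, for $k\neq 0$, $\mathbb{P}_k$ is the orthogonal projection of $\mathbb{C}^n$ onto the orthogonal complement of $k$, i.e. $\mathbb{P}_k=\mathrm{id}-\frac{1}{|k|^2}kk^T$. The $n$-dimensional periodic Navier--Stokes equation (without external force) is, on $\mathbb{T}^n$, \[\partial_tu=\nu\Delta u-u\cdot\nabla u-\nabla p,\qquad \mathrm{div}\, u=0,\qquad u(x,0)=u_0(x),\] understood in the equivalent projected form $\partial_tu=\nu\Delta u-\mathbb{P}[u\cdot\nabla u]$, $u(x,0)=u_0(x)$, with $\mathrm{div}\, u=0$, where $u\cdot\nabla u=\sum_{j=1}^nu_j\,\partial_ju$.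 For $f\in C^\infty(\mathbb{T}^n)^n$ set $\|f\|_{\mathsf{A},0}:=\sum_{k\in\mathbb{Z}^n\setminus\{0\}}|f_k|$, where $|\cdot|$ is the $l^2$-norm (Euclidean norm) on $\mathbb{C}^n$. For time-dependent functions it is taken in $x$ at fixed time. *)

theory Defs
  imports "HOL-Analysis.Analysis"
begin

text \<open>
  Smoothness on a set \<open>S\<close> that is convex with nonempty interior but not necessarily open, so that
  derivatives within \<open>S\<close> are unique. On a slab \<open>UNIV \<times> {0..<T}\<close> this means that all mixed partial
  derivatives exist and are continuous, with one-sided time derivatives at time \<open>0\<close>.
\<close>

primrec Ck_on :: "nat \<Rightarrow> 'a::euclidean_space set \<Rightarrow> ('a \<Rightarrow> 'b::real_normed_vector) \<Rightarrow> bool" where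
  "Ck_on 0 S = (\<lambda>f. continuous_on S f)"
| "Ck_on (Suc k) S = (\<lambda>f. \<exists>f'. (\<forall>x\<in>S. (f has_derivative f' x) (at x within S)) \<and>
                               (\<forall>v. Ck_on k S (\<lambda>x. f' x v)))"

definition smooth_on :: "'a::euclidean_space set \<Rightarrow> ('a \<Rightarrow> 'b::real_normed_vector) \<Rightarrow> bool" where
  "smooth_on S f \<longleftrightarrow> (\<forall>k. Ck_on k S f)"

text \<open>Functions on the torus are represented by functions that are \<open>2 * pi\<close>-periodic in each
  coordinate.\<close>

definition torus_periodic :: "(real^'n \<Rightarrow> 'b) \<Rightarrow> bool" where
  "torus_periodic f \<longleftrightarrow> (\<forall>x i. f (x + axis i (2 * pi)) = f x)"

definition smooth_torus :: "(real^'n \<Rightarrow> real^'n) \<Rightarrow> bool" where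
  "smooth_torus f \<longleftrightarrow> torus_periodic f \<and> smooth_on UNIV f"

definition time_interval :: "ereal \<Rightarrow> real set" where
  "time_interval T = {t. 0 \<le> t \<and> ereal t < T}"

definition smooth_torus_time :: "ereal \<Rightarrow> (real^'n \<Rightarrow> real \<Rightarrow> real^'n) \<Rightarrow> bool" where
  "smooth_torus_time T u \<longleftrightarrow>
     (\<forall>t\<in>time_interval T. torus_periodic (\<lambda>x. u x t)) \<and>
     smooth_on (UNIV \<times> time_interval T) (\<lambda>(x, t). u x t)"

definition partial :: "'n \<Rightarrow> (real^'n \<Rightarrow> real^'n) \<Rightarrow> real^'n \<Rightarrow> real^'n" where
  "partial i f x = frechet_derivative f (at x) (axis i 1)"

definition div_field :: "(real^'n \<Rightarrow> real^'n) \<Rightarrow> real^'n \<Rightarrow> real" where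
  "div_field f x = (\<Sum>i\<in>UNIV. partial i f x $ i)"

definition laplacian :: "(real^'n \<Rightarrow> real^'n) \<Rightarrow> real^'n \<Rightarrow> real^'n" where
  "laplacian f x = (\<Sum>i\<in>UNIV. partial i (partial i f) x)"

definition advection :: "(real^'n \<Rightarrow> real^'n) \<Rightarrow> real^'n \<Rightarrow> real^'n" where
  "advection u x = (\<Sum>j\<in>UNIV. u x $ j *\<^sub>R partial j u x)"

definition complex_vec :: "real^'n \<Rightarrow> complex^'n" where
  "complex_vec v = (\<chi> j. complex_of_real (v $ j))"

definition wave :: "int^'n \<Rightarrow> real^'n \<Rightarrow> complex" where
  "wave k x = exp (\<i> * complex_of_real (\<Sum>j\<in>UNIV. of_int (k $ j) * x $ j))"

definition fourier_coeff :: "(real^'n \<Rightarrow> real^'n) \<Rightarrow> int^'n \<Rightarrow> complex^'n" where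
  "fourier_coeff f k =
     (1 / (2 * pi) ^ CARD('n)) *\<^sub>R
       integral (cbox 0 (\<chi> j. 2 * pi)) (\<lambda>x. wave (- k) x *s complex_vec (f x))"

text \<open>\<open>infsum\<close> is \<open>0\<close> on non-summable families; for smooth periodic \<open>f\<close> the families below are
  absolutely summable.\<close>

definition A0_norm :: "(real^'n \<Rightarrow> real^'n) \<Rightarrow> real" where
  "A0_norm f = (\<Sum>\<^sub>\<infinity>k\<in>UNIV - {0}. norm (fourier_coeff f k))"

definition leray_symbol :: "int^'n \<Rightarrow> complex^'n^'n" where
  "leray_symbol k =
     (if k = 0 then mat 1
      else mat 1 - (\<chi> i j. of_int (k $ i * k $ j) / of_int (\<Sum>l\<in>UNIV. (k $ l)\<^sup>2)))"

text \<open>The Fourier series of \<open>\<P> f\<close> is kept as a \<open>complex^'n\<close>-valued function (its values are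
  real for real \<open>f\<close>), so the equation below is an identity in \<open>complex^'n\<close>.\<close>

definition leray :: "(real^'n \<Rightarrow> real^'n) \<Rightarrow> real^'n \<Rightarrow> complex^'n" where
  "leray f x = (\<Sum>\<^sub>\<infinity>k\<in>UNIV. wave k x *s (leray_symbol k *v fourier_coeff f k))"

definition nse_solution ::
    "real \<Rightarrow> (real^'n \<Rightarrow> real^'n) \<Rightarrow> ereal \<Rightarrow> (real^'n \<Rightarrow> real \<Rightarrow> real^'n) \<Rightarrow> bool" where
  "nse_solution \<nu> u\<^sub>0 T u \<longleftrightarrow>
     smooth_torus_time T u \<and>
     (\<forall>t\<in>time_interval T. \<forall>x.
        ((\<lambda>s. complex_vec (u x s)) has_vector_derivative
           (\<nu> *\<^sub>R complex_vec (laplacian (\<lambda>y. u y t) x) - leray (advection (\<lambda>y. u y t)) x))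
         (at t within time_interval T)) \<and>
     (\<forall>t\<in>time_interval T. \<forall>x. div_field (\<lambda>y. u y t) x = 0) \<and>
     (\<forall>x. u x 0 = u\<^sub>0 x)"

end

theory Submission
  imports Defs
begin

text \<open>
  A smooth periodic field is determined by its Fourier modes, and a divergence-free field \<open>u\<close>
  satisfies the projected Navier--Stokes equation exactly when its modes \<open>c\<^sub>k\<close> satisfy
  \<open>c\<^sub>k' = - \<nu> \<bar>k\<bar>\<^sup>2 c\<^sub>k - i P\<^sub>k (\<Sum>\<^sub>l (k \<bullet> c\<^sub>k\<^sub>-\<^sub>l) c\<^sub>l)\<close>, where \<open>P\<^sub>k\<close> is the symbol of the Leray projector;
  the factor \<open>k\<close> stands outside the convolution because \<open>u \<bullet> \<nabla>u\<close> is the divergence of \<open>u \<otimes> u\<close>.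
  Smoothness becomes decay in \<open>k\<close> faster than every power, reality becomes conjugation symmetry, and
  incompressibility becomes \<open>k \<bullet> c\<^sub>k = 0\<close>. The proof solves this system of ordinary differential
  equations (\<open>mode_sol\<close>) and transfers the result in both directions: \<open>nse_solution_modes\<close> uses
  integration by parts, Fourier inversion and differentiation under the integral, while
  \<open>modes_nse_solution\<close> sums the series and bootstraps its regularity in time.

  Local theory. The nonlinearity loses one derivative. Duhamel's formula regains it: the heat factor
  turns a forcing of size \<open>\<bar>k\<bar> exp (\<gamma> t)\<close> into a response of size
  \<open>\<bar>k\<bar> / (\<nu> \<bar>k\<bar>\<^sup>2 + \<gamma>) exp (\<gamma> t) \<le> exp (\<gamma> t) / (2 \<surd>(\<nu> \<gamma>))\<close>, uniformly in \<open>k\<close> (\<open>duhamel_bound_freq\<close>). In norms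
  weighted by \<open>exp (- \<gamma> t)\<close> with \<open>\<gamma>\<close> large the map that sends a curve of modes to the solution of the
  linear equations forced by its nonlinearity is therefore a contraction. Together with the
  convolution estimate \<open>conv_bounds\<close> this gives existence on a time that depends on a single
  weighted norm of the data (\<open>local_existence\<close>), uniqueness (\<open>mode_sol_unique\<close>), and the
  fact that a bound on \<open>\<Sum>\<^sub>k \<bar>c\<^sub>k\<bar>\<close> alone propagates every rate of decay (\<open>mode_sol_persistence\<close>).

  The Wiener norm. The mean \<open>c\<^sub>0\<close> is constant in time, and its interaction with the mode \<open>k\<close> only
  rotates the phase of that mode. In the remaining interactions \<open>k \<bullet> c\<^sub>k\<^sub>-\<^sub>l = l \<bullet> c\<^sub>k\<^sub>-\<^sub>l\<close>. Hence the moduli are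
  dominated by scalar functions \<open>b\<^sub>k\<close> whose moments \<open>B = \<Sum>\<^sub>k b\<^sub>k\<close>, \<open>B\<^sub>1 = \<Sum>\<^sub>k \<bar>k\<bar> b\<^sub>k\<close>, \<open>B\<^sub>2 = \<Sum>\<^sub>k \<bar>k\<bar>\<^sup>2 b\<^sub>k\<close> satisfy
  \<open>B' \<le> B B\<^sub>1 - \<nu> B\<^sub>2\<close> (\<open>amplitude_majorant\<close>). Since \<open>B\<^sub>1 \<le> B\<^sub>2\<close>, this gives \<open>B' \<le> (B - \<nu>) B\<^sub>1\<close>, so that
  the bound \<open>B \<le> \<nu>\<close> persists (\<open>amplitude_le_viscosity\<close>). Completing the square gives
  \<open>B' \<le> B\<^sup>3 / (4 \<nu>)\<close>, so that \<open>1 / B\<^sup>2\<close> decreases at a rate of at most \<open>1 / (2 \<nu>)\<close> and \<open>B\<close> stays finite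
  before the time \<open>2 \<nu> / (B 0)\<^sup>2\<close> (\<open>amplitude_bernoulli\<close>).

  Conclusion. Let \<open>T\<close> be the supremum of the existence times (\<open>maximal_modes\<close>). If the Wiener norm
  is bounded up to a finite time \<open>s\<close>, then so is the weighted norm that governs the local
  existence time, and a solution restarted shortly before \<open>s\<close> passes \<open>s\<close> (\<open>mode_sol_restart\<close>). This is
  the continuation criterion; the two bounds on \<open>B\<close> turn it into the lower bound on \<open>T\<close>
  (\<open>lifespan_lower_bound\<close>).
\<close>

section \<open>Sums over countable index sets\<close>

lemma continuous_on_infsum:
  fixes f :: "'i \<Rightarrow> 'a::topological_space \<Rightarrow> 'b::banach"
  assumes "\<And>i. continuous_on S (f i)" "\<And>i x. x \<in> S \<Longrightarrow> norm (f i x) \<le> M i" "M summable_on UNIV"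
  shows "continuous_on S (\<lambda>x. \<Sum>\<^sub>\<infinity>i. f i x)"
proof (rule uniform_limit_theorem)
  show "uniform_limit S (\<lambda>X y. \<Sum>x\<in>X. f x y) (\<lambda>y. \<Sum>\<^sub>\<infinity>x\<in>UNIV. f x y) (finite_subsets_at_top UNIV)"
    by (rule Weierstrass_m_test_general) (use assms in auto)
qed (auto intro!: continuous_intros always_eventually assms)

lemma summable_on_norm_bound:
  fixes f :: "'i \<Rightarrow> 'b::banach"
  assumes "\<And>i. norm (f i) \<le> M i" "M summable_on A"
  shows "f summable_on A" "(\<lambda>i. norm (f i)) summable_on A"
proof -
  show "(\<lambda>i. norm (f i)) summable_on A"
    by (rule summable_on_comparison_test[OF assms(2)]) (use assms in auto)
  then show "f summable_on A" by (rule abs_summable_summable)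
qed

lemma norm_infsum_le_infsum:
  fixes f :: "'i \<Rightarrow> 'b::banach"
  assumes "\<And>i. i \<in> A \<Longrightarrow> norm (f i) \<le> M i" "M summable_on A"
  shows "norm (\<Sum>\<^sub>\<infinity>i\<in>A. f i) \<le> (\<Sum>\<^sub>\<infinity>i\<in>A. M i)"
proof -
  have s: "(\<lambda>i. norm (f i)) summable_on A"
    by (rule summable_on_comparison_test[OF assms(2)]) (use assms in auto)
  have "norm (\<Sum>\<^sub>\<infinity>i\<in>A. f i) \<le> (\<Sum>\<^sub>\<infinity>i\<in>A. norm (f i))" by (rule norm_infsum_bound[OF s])
  also have "\<dots> \<le> (\<Sum>\<^sub>\<infinity>i\<in>A. M i)" by (rule infsum_mono) (use assms s in auto)
  finally show ?thesis .
qed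

lemma le_infsum:
  fixes f :: "'i \<Rightarrow> real"
  assumes "f summable_on UNIV" "\<And>i. 0 \<le> f i"
  shows "f k \<le> infsum f UNIV"
  using finite_sum_le_infsum[OF assms(1), of "{k}"] assms(2) by simp

lemma summable_on_sum:
  fixes f :: "'j \<Rightarrow> 'i \<Rightarrow> 'b::real_normed_vector"
  assumes "\<And>j. j \<in> F \<Longrightarrow> f j summable_on A"
  shows "(\<lambda>i. \<Sum>j\<in>F. f j i) summable_on A"
  using assms by (induction F rule: infinite_finite_induct) (auto intro!: summable_on_add)

lemma has_sum_sum:
  fixes f :: "'j \<Rightarrow> 'i \<Rightarrow> 'b::real_normed_vector"
  assumes "\<And>j. j \<in> J \<Longrightarrow> (f j has_sum s j) A"
  shows "((\<lambda>i. \<Sum>j\<in>J. f j i) has_sum (\<Sum>j\<in>J. s j)) A"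
  using assms by (induction J rule: infinite_finite_induct) (auto intro!: has_sum_add)

lemma summable_on_diff:
  fixes f g :: "'i \<Rightarrow> 'b::real_normed_vector"
  assumes "f summable_on A" "g summable_on A"
  shows "(\<lambda>i. f i - g i) summable_on A"
  using summable_on_add[OF assms(1) summable_on_uminus[THEN iffD2, OF assms(2)]] by simp

lemma infsum_diff:
  fixes f g :: "'i \<Rightarrow> 'b::real_normed_vector"
  assumes "f summable_on A" "g summable_on A"
  shows "(\<Sum>\<^sub>\<infinity>i\<in>A. f i - g i) = infsum f A - infsum g A"
  using infsum_add[OF assms(1) summable_on_uminus[THEN iffD2, OF assms(2)]] by (simp add: infsum_uminus)

lemma infsum_bounded_linear_banach:
  fixes h :: "'a::real_normed_vector \<Rightarrow> 'b::real_normed_vector"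
  assumes "bounded_linear h" "f summable_on A"
  shows "(\<Sum>\<^sub>\<infinity>i\<in>A. h (f i)) = h (infsum f A)"
  by (rule infsumI[OF has_sum_bounded_linear[OF assms(1) has_sum_infsum[OF assms(2)]]])

text \<open>Termwise differentiation: the tail of the series outside a finite set is Lipschitz with a
  small constant, by the mean value inequality, and the finite part is differentiable.\<close>

lemma has_derivative_infsum:
  fixes f :: "'i \<Rightarrow> 'a::real_normed_vector \<Rightarrow> 'b::banach"
  assumes S: "convex S" "x \<in> S"
    and f': "\<And>i x. x \<in> S \<Longrightarrow> (f i has_derivative f' i x) (at x within S)"
    and bd: "\<And>i x h. x \<in> S \<Longrightarrow> norm (f' i x h) \<le> M i * norm h"
    and M0: "\<And>i. 0 \<le> M i" and M: "M summable_on UNIV"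
    and sm: "\<And>x. x \<in> S \<Longrightarrow> (\<lambda>i. f i x) summable_on UNIV"
  shows "((\<lambda>x. \<Sum>\<^sub>\<infinity>i. f i x) has_derivative (\<lambda>h. \<Sum>\<^sub>\<infinity>i. f' i x h)) (at x within S)"
proof -
  have lin: "bounded_linear (f' i x)" for i using f'[OF S(2)] by (rule has_derivative_bounded_linear)
  have Mh: "(\<lambda>i. M i * norm h) summable_on UNIV" for h :: 'a by (rule summable_on_cmult_left[OF M])
  have s': "(\<lambda>i. f' i x h) summable_on UNIV" for h
    by (rule summable_on_norm_bound[OF _ Mh]) (use bd S in auto)
  have bl: "bounded_linear (\<lambda>h. \<Sum>\<^sub>\<infinity>i. f' i x h)"
  proof (rule bounded_linear_intro)
    show "(\<Sum>\<^sub>\<infinity>i. f' i x (a + b)) = (\<Sum>\<^sub>\<infinity>i. f' i x a) + (\<Sum>\<^sub>\<infinity>i. f' i x b)" for a b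
      by (simp add: linear_add[OF bounded_linear.linear[OF lin]] infsum_add[OF s' s'])
    show "(\<Sum>\<^sub>\<infinity>i. f' i x (r *\<^sub>R a)) = r *\<^sub>R (\<Sum>\<^sub>\<infinity>i. f' i x a)" for a r
      by (simp add: linear_cmul[OF bounded_linear.linear[OF lin]] infsum_scaleR_right)
    show "norm (\<Sum>\<^sub>\<infinity>i. f' i x a) \<le> norm a * (\<Sum>\<^sub>\<infinity>i. M i)" for a
    proof -
      have "norm (\<Sum>\<^sub>\<infinity>i. f' i x a) \<le> (\<Sum>\<^sub>\<infinity>i. M i * norm a)"
        by (rule norm_infsum_le_infsum[OF bd[OF S(2)] Mh])
      then show ?thesis by (simp add: infsum_cmult_left' mult.commute)
    qed
  qed
  have lip: "norm (f i y - f i x) \<le> M i * norm (y - x)" if "y \<in> S" for i y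
  proof (rule differentiable_bound[OF S(1) f'])
    show "onorm (f' i z) \<le> M i" if "z \<in> S" for z
      by (rule onorm_bound[OF M0 bd[OF that]])
  qed (use that S in auto)
  show ?thesis
    unfolding has_derivative_within_alt
  proof (intro conjI allI impI bl)
    fix e :: real assume e: "e > 0"
    obtain F where F: "finite F" "dist (sum M F) (infsum M UNIV) \<le> e / 4"
      using infsum_finite_approximation[OF M, of "e/4"] e by auto
    have MF: "M summable_on (UNIV - F)" using M by (rule summable_on_subset) auto
    have tail: "infsum M (UNIV - F) \<le> e / 4"
    proof -
      have "infsum M UNIV = infsum M (UNIV - F) + infsum M F"
        using infsum_Un_disjoint[OF MF, of F] F(1) by auto
      then show ?thesis using F by (auto simp: dist_real_def)
    qed
    define e' where "e' = e / (2 * (real (card F) + 1))"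
    have e': "e' > 0" using e by (simp add: e'_def)
    have "\<exists>d>0. \<forall>y\<in>S. norm (y - x) < d \<longrightarrow> norm (f i y - f i x - f' i x (y - x)) \<le> e' * norm (y - x)" for i
      using f'[OF S(2), of i] e' unfolding has_derivative_within_alt by blast
    then obtain d where d: "\<And>i. d i > 0" "\<And>i y. y \<in> S \<Longrightarrow> norm (y - x) < d i \<Longrightarrow>
        norm (f i y - f i x - f' i x (y - x)) \<le> e' * norm (y - x)" by metis
    define d0 where "d0 = Min (insert 1 (d ` F))"
    have d0: "d0 > 0" "\<And>i. i \<in> F \<Longrightarrow> d0 \<le> d i" using d(1) F(1) by (auto simp: d0_def)
    show "\<exists>d>0. \<forall>y\<in>S. norm (y - x) < d \<longrightarrow>
        norm ((\<Sum>\<^sub>\<infinity>i. f i y) - (\<Sum>\<^sub>\<infinity>i. f i x) - (\<Sum>\<^sub>\<infinity>i. f' i x (y - x))) \<le> e * norm (y - x)"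
    proof (intro exI[of _ d0] conjI ballI impI d0)
      fix y assume y: "y \<in> S" "norm (y - x) < d0"
      define r where "r i = f i y - f i x - f' i x (y - x)" for i
      have rs: "r summable_on A" for A
        using summable_on_diff[OF summable_on_diff[OF sm[OF y(1)] sm[OF S(2)]] s'[of "y - x"]]
        unfolding r_def by (rule summable_on_subset_banach) auto
      have "(\<Sum>\<^sub>\<infinity>i. f i y) - (\<Sum>\<^sub>\<infinity>i. f i x) - (\<Sum>\<^sub>\<infinity>i. f' i x (y - x)) = infsum r UNIV"
        unfolding r_def using summable_on_diff[OF sm[OF y(1)] sm[OF S(2)]]
        by (simp add: infsum_diff sm y S s')
      also have "\<dots> = infsum r (UNIV - F) + sum r F"
        using infsum_Un_disjoint[OF rs[of "UNIV - F"] rs[of F]] F(1) by auto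
      finally have eq: "(\<Sum>\<^sub>\<infinity>i. f i y) - (\<Sum>\<^sub>\<infinity>i. f i x) - (\<Sum>\<^sub>\<infinity>i. f' i x (y - x)) = infsum r (UNIV - F) + sum r F" .
      have "norm (r i) \<le> M i * (2 * norm (y - x))" for i
        using norm_triangle_ineq4[of "f i y - f i x" "f' i x (y - x)"] lip[OF y(1), of i] bd[OF S(2), of i "y - x"]
        by (simp add: r_def)
      then have "norm (infsum r (UNIV - F)) \<le> (\<Sum>\<^sub>\<infinity>i\<in>UNIV - F. M i * (2 * norm (y - x)))"
        by (intro norm_infsum_le_infsum summable_on_cmult_left MF)
      also have "\<dots> = infsum M (UNIV - F) * (2 * norm (y - x))" by (rule infsum_cmult_left')
      also have "\<dots> \<le> (e / 4) * (2 * norm (y - x))" by (rule mult_right_mono[OF tail]) auto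
      finally have 1: "norm (infsum r (UNIV - F)) \<le> e / 2 * norm (y - x)" by simp
      have "norm (sum r F) \<le> (\<Sum>i\<in>F. e' * norm (y - x))"
        by (rule sum_norm_le) (use d d0 y in \<open>force simp: r_def\<close>)
      also have "\<dots> = (real (card F) * e') * norm (y - x)" by simp
      also have "\<dots> \<le> (e / 2) * norm (y - x)"
        by (rule mult_right_mono) (use e in \<open>auto simp: e'_def field_simps\<close>)
      finally have 2: "norm (sum r F) \<le> e / 2 * norm (y - x)" .
      show "norm ((\<Sum>\<^sub>\<infinity>i. f i y) - (\<Sum>\<^sub>\<infinity>i. f i x) - (\<Sum>\<^sub>\<infinity>i. f' i x (y - x))) \<le> e * norm (y - x)"
        unfolding eq using norm_triangle_ineq[of "infsum r (UNIV - F)" "sum r F"] 1 2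
        by (simp add: field_simps)
    qed
  qed
qed

lemma has_vector_derivative_infsum:
  fixes f :: "'i \<Rightarrow> real \<Rightarrow> 'b::banach"
  assumes S: "convex S" "x \<in> S"
    and f': "\<And>i x. x \<in> S \<Longrightarrow> (f i has_vector_derivative f' i x) (at x within S)"
    and bd: "\<And>i x. x \<in> S \<Longrightarrow> norm (f' i x) \<le> M i"
    and M: "M summable_on UNIV"
    and sm: "\<And>x. x \<in> S \<Longrightarrow> (\<lambda>i. f i x) summable_on UNIV"
  shows "((\<lambda>x. \<Sum>\<^sub>\<infinity>i. f i x) has_vector_derivative (\<Sum>\<^sub>\<infinity>i. f' i x)) (at x within S)"
proof -
  have "((\<lambda>x. \<Sum>\<^sub>\<infinity>i. f i x) has_derivative (\<lambda>h. \<Sum>\<^sub>\<infinity>i. h *\<^sub>R f' i x)) (at x within S)"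
    by (rule has_derivative_infsum[OF S _ _ order_trans[OF norm_ge_zero bd[OF S(2)]] M sm, where f'="\<lambda>i x h. h *\<^sub>R f' i x"])
      (use f' bd in \<open>auto simp: has_vector_derivative_def mult.commute[of "M _"] intro!: mult_left_mono\<close>)
  then show ?thesis by (simp add: has_vector_derivative_def infsum_scaleR_right)
qed

lemma infsum_integral_cbox:
  fixes f :: "'i \<Rightarrow> 'a::euclidean_space \<Rightarrow> 'b::banach"
  assumes "\<And>i. continuous_on (cbox a b) (f i)" "\<And>i x. x \<in> cbox a b \<Longrightarrow> norm (f i x) \<le> M i" "M summable_on UNIV"
  shows "((\<lambda>i. integral (cbox a b) (f i)) has_sum integral (cbox a b) (\<lambda>x. \<Sum>\<^sub>\<infinity>i. f i x)) UNIV"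
proof -
  have u: "uniform_limit (cbox a b) (\<lambda>X y. \<Sum>x\<in>X. f x y) (\<lambda>y. \<Sum>\<^sub>\<infinity>x\<in>UNIV. f x y) (finite_subsets_at_top UNIV)"
    by (rule Weierstrass_m_test_general) (use assms in auto)
  have c: "continuous_on (cbox a b) (\<lambda>y. \<Sum>x\<in>X. f x y)" for X by (intro continuous_intros assms)
  obtain I J where IJ: "\<And>X. ((\<lambda>y. \<Sum>x\<in>X. f x y) has_integral I X) (cbox a b)"
    "((\<lambda>y. \<Sum>\<^sub>\<infinity>x\<in>UNIV. f x y) has_integral J) (cbox a b)" "(I \<longlongrightarrow> J) (finite_subsets_at_top UNIV)"
    using uniform_limit_integral_cbox[OF u c] by auto
  have "\<forall>\<^sub>F X in finite_subsets_at_top UNIV. I X = (\<Sum>i\<in>X. integral (cbox a b) (f i))"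
    unfolding eventually_finite_subsets_at_top
    by (rule exI[of _ "{}"]) (auto simp: IJ(1)[THEN integral_unique, symmetric] integral_sum integrable_continuous assms)
  then have "((\<lambda>X. \<Sum>i\<in>X. integral (cbox a b) (f i)) \<longlongrightarrow> J) (finite_subsets_at_top UNIV)"
    using IJ(3) tendsto_cong by fastforce
  then show ?thesis using IJ(2) by (simp add: has_sum_def integral_unique)
qed

section \<open>Weights on the frequency lattice\<close>

definition freq :: "int^'n \<Rightarrow> real^'n" where
  "freq k = (\<chi> j. real_of_int (k $ j))"

text \<open>Decay is measured with \<open>1 + \<bar>k\<bar>\<close> rather than
  \<open>\<bar>k\<bar>\<close> so that the zero mode is controlled as well.\<close>

definition bracket :: "int^'n \<Rightarrow> real" where
  "bracket k = 1 + norm (freq k)"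

text \<open>The exponent \<open>2 n\<close> exceeds the dimension by enough for the sum to be
  compared with a product of one-dimensional sums. The constant converts weighted suprema into
  \<open>\<ell>\<^sup>1\<close> norms.\<close>

definition lattice_sum :: "'n::finite itself \<Rightarrow> real" where
  "lattice_sum _ = (\<Sum>\<^sub>\<infinity>k::int^'n. 1 / bracket k ^ (2 * CARD('n)))"

lemma freq_simps [simp]: "freq 0 = 0" "freq (k + l) = freq k + freq l" "freq (k - l) = freq k - freq l"
  "freq (- k) = - freq k" "freq k $ j = real_of_int (k $ j)"
  by (simp_all add: freq_def vec_eq_iff)

lemma freq_eq_0_iff [simp]: "freq k = 0 \<longleftrightarrow> k = 0"
  by (simp add: freq_def vec_eq_iff)

lemma norm_freq_ge_1: "k \<noteq> 0 \<Longrightarrow> norm (freq k) \<ge> 1"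
proof -
  assume "k \<noteq> 0"
  then obtain j where "k $ j \<noteq> 0" by (auto simp: vec_eq_iff)
  then have "1 \<le> \<bar>freq k $ j\<bar>" by (simp add: freq_def)
  also have "\<dots> \<le> norm (freq k)" by (rule component_le_norm_cart)
  finally show ?thesis .
qed

lemma bracket_ge_1 [simp]: "1 \<le> bracket k" and bracket_pos [simp]: "0 < bracket k"
  and bracket_nonneg [simp]: "0 \<le> bracket k" and bracket_nz [simp]: "bracket k \<noteq> 0"
  and bracket_minus [simp]: "bracket (- k) = bracket k"
  and freq_le_bracket: "norm (freq k) \<le> bracket k"
  by (simp_all add: bracket_def add_pos_nonneg add_nonneg_eq_0_iff)

lemma bracket_power_ge_1 [simp]: "1 \<le> bracket k ^ p" by simp

lemma bracket_power_pos [simp]: "0 < bracket k ^ p" by simp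

text \<open>Since \<open>k = (k - l) + l\<close>, a weight on a convolution can be passed to one of
  the two factors.\<close>

lemma bracket_power_le: "bracket k ^ p \<le> 2 ^ p * (bracket (k - l) ^ p + bracket l ^ p)"
proof -
  have "bracket k \<le> bracket (k - l) + bracket l"
    using norm_triangle_ineq[of "freq (k - l)" "freq l"] by (simp add: bracket_def)
  also have "\<dots> \<le> 2 * max (bracket (k - l)) (bracket l)" by linarith
  finally have "bracket k ^ p \<le> (2 * max (bracket (k - l)) (bracket l)) ^ p" by (rule power_mono) simp
  also have "\<dots> \<le> 2 ^ p * (bracket (k - l) ^ p + bracket l ^ p)"
    by (simp add: power_mult_distrib max_def)
  finally show ?thesis .
qed

text \<open>The correction \<open>2 / (N + 1)\<close> makes the induction telescope.\<close>

lemma sum_inverse_squares_bound: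
  "(\<Sum>i\<in>{- int N..int N}. 1 / (1 + \<bar>real_of_int i\<bar>)\<^sup>2) \<le> 3 - 2 / (real N + 1)"
proof (induction N)
  case (Suc N)
  have "{- int (Suc N)..int (Suc N)} = insert (int (Suc N)) (insert (- int (Suc N)) {- int N..int N})" by auto
  then have "(\<Sum>i\<in>{- int (Suc N)..int (Suc N)}. 1 / (1 + \<bar>real_of_int i\<bar>)\<^sup>2) =
      2 / (2 + real N)\<^sup>2 + (\<Sum>i\<in>{- int N..int N}. 1 / (1 + \<bar>real_of_int i\<bar>)\<^sup>2)"
    by (simp add: algebra_simps)
  also have "\<dots> \<le> 2 / (2 + real N)\<^sup>2 + (3 - 2 / (real N + 1))" using Suc by simp
  also have "2 / (2 + real N)\<^sup>2 \<le> 2 / ((real N + 1) * (real N + 2))"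
  proof (rule divide_left_mono)
    show "(real N + 1) * (real N + 2) \<le> (2 + real N)\<^sup>2" by (simp add: power2_eq_square algebra_simps)
  qed auto
  also have "2 / ((real N + 1) * (real N + 2)) = 2 / (real N + 1) - 2 / (real N + 2)"
    by (simp add: diff_frac_eq add_pos_nonneg add_nonneg_eq_0_iff)
  also have "2 / (real N + 1) - 2 / (real N + 2) + (3 - 2 / (real N + 1)) = 3 - 2 / (real (Suc N) + 1)"
    by simp
  finally show ?case by simp
qed simp

text \<open>The weight dominates a product of one-dimensional weights, so that sums over boxes factor.\<close>

lemma summable_bracket: "(\<lambda>k::int^'n. 1 / bracket k ^ (2 * CARD('n))) summable_on UNIV"
proof (rule nonneg_bdd_above_summable_on)
  define h where "h i = 1 / (1 + \<bar>real_of_int i\<bar>)\<^sup>2" for i :: int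
  have h0: "0 \<le> h i" for i by (simp add: h_def)
  have le: "1 / bracket k ^ (2 * CARD('n)) \<le> (\<Prod>j\<in>UNIV. h (k $ j))" for k :: "int^'n"
  proof -
    have "(\<Prod>j\<in>UNIV. (1 + \<bar>real_of_int (k $ j)\<bar>)\<^sup>2) \<le> (\<Prod>j\<in>(UNIV::'n set). (bracket k)\<^sup>2)"
    proof (rule prod_mono, intro conjI power_mono)
      show "1 + \<bar>real_of_int (k $ j)\<bar> \<le> bracket k" for j
        using component_le_norm_cart[of "freq k" j] by (simp add: bracket_def)
    qed auto
    then have "(\<Prod>j\<in>UNIV. (1 + \<bar>real_of_int (k $ j)\<bar>)\<^sup>2) \<le> bracket k ^ (2 * CARD('n))"
      by (simp add: power_mult)
    moreover have "0 < (\<Prod>j\<in>UNIV. (1 + \<bar>real_of_int (k $ j)\<bar>)\<^sup>2)"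
      by (intro prod_pos zero_less_power) (simp add: add_pos_nonneg)
    ultimately have "1 / bracket k ^ (2 * CARD('n)) \<le> 1 / (\<Prod>j\<in>UNIV. (1 + \<bar>real_of_int (k $ j)\<bar>)\<^sup>2)"
      by (intro divide_left_mono) auto
    then show ?thesis by (simp add: h_def prod_dividef)
  qed
  show "bdd_above (sum (\<lambda>k::int^'n. 1 / bracket k ^ (2 * CARD('n))) ` {F. F \<subseteq> UNIV \<and> finite F})"
  proof (rule bdd_aboveI2)
    fix F :: "(int^'n) set" assume F: "F \<in> {F. F \<subseteq> UNIV \<and> finite F}"
    define N where "N = nat (Max (insert 0 ((\<lambda>(k, j). \<bar>k $ j\<bar>) ` (F \<times> UNIV))))"
    have N: "\<bar>k $ j\<bar> \<le> int N" if "k \<in> F" for k j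
    proof -
      have "\<bar>k $ j\<bar> \<le> Max (insert 0 ((\<lambda>(k, j). \<bar>k $ j\<bar>) ` (F \<times> UNIV)))"
        by (rule Max_ge) (use that F in auto)
      moreover have "0 \<le> Max (insert 0 ((\<lambda>(k, j). \<bar>k $ j\<bar>) ` (F \<times> UNIV)))"
        by (rule Max_ge) (use F in auto)
      ultimately show ?thesis by (simp add: N_def)
    qed
    define P where "P = PiE (UNIV::'n set) (\<lambda>_. {- int N..int N})"
    have "(\<Sum>k\<in>F. 1 / bracket k ^ (2 * CARD('n))) \<le> (\<Sum>k\<in>F. (\<Prod>j\<in>UNIV. h (k $ j)))"
      by (rule sum_mono) (rule le)
    also have "\<dots> = (\<Sum>g\<in>vec_nth ` F. (\<Prod>j\<in>UNIV. h (g j)))"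
      by (subst sum.reindex) (auto simp: inj_on_def vec_nth_inject)
    also have "\<dots> \<le> (\<Sum>g\<in>P. (\<Prod>j\<in>UNIV. h (g j)))"
    proof (rule sum_mono2)
      show "finite P" by (simp add: P_def finite_PiE)
      show "vec_nth ` F \<subseteq> P" unfolding P_def using N by (auto simp: PiE_def abs_le_iff minus_le_iff)
    qed (auto intro!: prod_nonneg h0)
    also have "\<dots> = (\<Prod>j\<in>(UNIV::'n set). \<Sum>i\<in>{- int N..int N}. h i)"
      unfolding P_def by (rule prod_sum_PiE[symmetric]) auto
    also have "\<dots> \<le> (\<Prod>j\<in>(UNIV::'n set). 3)"
    proof (rule prod_mono, intro conjI)
      have "0 \<le> 2 / (real N + 1)" by simp
      then show "(\<Sum>i\<in>{- int N..int N}. h i) \<le> 3"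
        unfolding h_def using sum_inverse_squares_bound[of N] by linarith
    qed (auto intro!: sum_nonneg h0)
    finally show "(\<Sum>k\<in>F. 1 / bracket k ^ (2 * CARD('n))) \<le> (\<Prod>j\<in>(UNIV::'n set). 3)" .
  qed
qed auto

lemma lattice_sum_pos: "0 < lattice_sum TYPE('n::finite)"
proof -
  have "(\<Sum>k\<in>{0::int^'n}. 1 / bracket k ^ (2 * CARD('n))) \<le> lattice_sum TYPE('n)"
    unfolding lattice_sum_def by (rule finite_sum_le_infsum[OF summable_bracket]) auto
  then show ?thesis by (simp add: bracket_def)
qed

lemma decay_summable:
  fixes a :: "int^'n \<Rightarrow> 'b::banach"
  assumes "\<And>k. norm (a k) * bracket k ^ (2 * CARD('n)) \<le> C"
  shows "(\<lambda>k. norm (a k)) summable_on A" "a summable_on A" "(\<Sum>\<^sub>\<infinity>k. norm (a k)) \<le> C * lattice_sum TYPE('n)"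
proof -
  have le: "norm (a k) \<le> C * (1 / bracket k ^ (2 * CARD('n)))" for k
    using assms[of k] by (simp add: field_simps)
  have s: "(\<lambda>k::int^'n. C * (1 / bracket k ^ (2 * CARD('n)))) summable_on UNIV"
    by (rule summable_on_cmult_right[OF summable_bracket])
  have U: "a summable_on UNIV" "(\<lambda>k. norm (a k)) summable_on UNIV"
    using summable_on_norm_bound[OF le s] by auto
  show "(\<lambda>k. norm (a k)) summable_on A" "a summable_on A"
    using summable_on_subset_banach[OF U(1), of A] summable_on_subset_banach[OF U(2), of A] by auto
  show "(\<Sum>\<^sub>\<infinity>k. norm (a k)) \<le> C * lattice_sum TYPE('n)"
    unfolding lattice_sum_def infsum_cmult_right'[symmetric] by (rule infsum_mono[OF U(2) s le])
qed

section \<open>Convolutions and the nonlinearity\<close>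

definition conv :: "(int^'n \<Rightarrow> real) \<Rightarrow> (int^'n \<Rightarrow> real) \<Rightarrow> int^'n \<Rightarrow> real" where
  "conv a b k = (\<Sum>\<^sub>\<infinity>l. a (k - l) * b l)"

lemma bij_diff_vec: "bij (\<lambda>l. k - l)" for k :: "'a::ab_group_add"
  by (rule o_bij[of "\<lambda>l. k - l"]) auto

text \<open>The estimate is tame: the high weight falls on one factor at a time, and the other
  factor enters through its \<open>\<ell>\<^sup>1\<close> norm only. Being linear in the high
  weight, the bound lets an \<open>\<ell>\<^sup>1\<close> bound on a solution propagate decay of
  every order.\<close>

lemma conv_bounds:
  fixes a b :: "int^'n \<Rightarrow> real"
  assumes pos: "\<And>k. 0 \<le> a k" "\<And>k. 0 \<le> b k"
    and sm: "a summable_on UNIV" "b summable_on UNIV"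
    and le: "infsum a UNIV \<le> \<alpha>" "infsum b UNIV \<le> \<beta>"
    and Q: "\<And>k. a k * bracket k ^ p \<le> Qa" "\<And>k. b k * bracket k ^ p \<le> Qb"
  shows "(\<lambda>l. a (k - l) * b l) summable_on UNIV"
    and "0 \<le> conv a b k"
    and "conv a b k * bracket k ^ p \<le> 2 ^ p * (Qa * \<beta> + \<alpha> * Qb)"
proof -
  have sa: "(\<lambda>l. a (k - l)) summable_on UNIV"
    using sm(1) summable_on_reindex_bij_betw[OF bij_diff_vec[of k], of a] by simp
  have ia: "(\<Sum>\<^sub>\<infinity>l. a (k - l)) = infsum a UNIV"
    by (rule infsum_reindex_bij_betw[OF bij_diff_vec[of k], of a])
  have Q0: "0 \<le> Qa" "0 \<le> Qb"
    using Q[of 0] pos[of 0] by (simp_all add: bracket_def)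
  have "a m \<le> infsum a UNIV" for m
    using finite_sum_le_infsum[OF sm(1), of "{m}"] pos by auto
  then have ab: "a (k - l) * b l \<le> infsum a UNIV * b l" for l by (simp add: mult_right_mono pos)
  show s: "(\<lambda>l. a (k - l) * b l) summable_on UNIV"
    by (rule summable_on_comparison_test[OF summable_on_cmult_right[OF sm(2), of "infsum a UNIV"]])
       (auto intro!: mult_nonneg_nonneg pos ab)
  show "0 \<le> conv a b k" unfolding conv_def by (intro infsum_nonneg mult_nonneg_nonneg pos)
  have t: "a (k - l) * b l * bracket k ^ p \<le> 2 ^ p * (Qa * b l + a (k - l) * Qb)" for l
  proof -
    have "a (k - l) * b l * bracket k ^ p \<le> a (k - l) * b l * (2 ^ p * (bracket (k - l) ^ p + bracket l ^ p))"
      by (intro mult_left_mono bracket_power_le mult_nonneg_nonneg pos)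
    also have "\<dots> = 2 ^ p * ((a (k - l) * bracket (k - l) ^ p) * b l + a (k - l) * (b l * bracket l ^ p))"
      by (simp add: algebra_simps)
    also have "\<dots> \<le> 2 ^ p * (Qa * b l + a (k - l) * Qb)"
      by (intro mult_left_mono add_mono mult_right_mono Q pos) auto
    finally show ?thesis .
  qed
  have s2: "(\<lambda>l. 2 ^ p * (Qa * b l + a (k - l) * Qb)) summable_on UNIV"
    by (intro summable_on_cmult_right summable_on_add summable_on_cmult_left sa sm)
  have "conv a b k * bracket k ^ p = (\<Sum>\<^sub>\<infinity>l. a (k - l) * b l * bracket k ^ p)"
    unfolding conv_def by (rule infsum_cmult_left'[symmetric])
  also have "\<dots> \<le> (\<Sum>\<^sub>\<infinity>l. 2 ^ p * (Qa * b l + a (k - l) * Qb))"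
    by (rule infsum_mono[OF summable_on_cmult_left[OF s] s2 t])
  also have "\<dots> = 2 ^ p * (Qa * infsum b UNIV + infsum a UNIV * Qb)"
    unfolding infsum_cmult_right'
    by (subst infsum_add) (auto intro!: summable_on_cmult_right summable_on_cmult_left sa sm
        simp: infsum_cmult_right' infsum_cmult_left' ia)
  also have "\<dots> \<le> 2 ^ p * (Qa * \<beta> + \<alpha> * Qb)"
    by (intro mult_left_mono add_mono mult_right_mono le Q0) auto
  finally show "conv a b k * bracket k ^ p \<le> 2 ^ p * (Qa * \<beta> + \<alpha> * Qb)" .
qed

lemma conv_summable:
  fixes a b :: "int^'n \<Rightarrow> real"
  assumes "\<And>k. 0 \<le> a k" "\<And>k. 0 \<le> b k" "a summable_on UNIV" "b summable_on UNIV"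
  shows "(\<lambda>l. a (k - l) * b l) summable_on UNIV"
  by (rule conv_bounds(1)[OF assms order.refl order.refl, where p=0 and Qa="infsum a UNIV" and Qb="infsum b UNIV"])
     (simp_all add: le_infsum assms)

text \<open>Young's convolution inequality in \<open>\<ell>\<^sup>1\<close>, by exchanging a finite
  outer sum with the inner series.\<close>

lemma infsum_conv_le:
  fixes a b :: "int^'n \<Rightarrow> real"
  assumes pos: "\<And>k. 0 \<le> a k" "\<And>k. 0 \<le> b k" and sm: "a summable_on UNIV" "b summable_on UNIV"
  shows "conv a b summable_on UNIV" "infsum (conv a b) UNIV \<le> infsum a UNIV * infsum b UNIV"
proof -
  have s: "(\<lambda>l. a (k - l) * b l) summable_on UNIV" for k
    by (rule conv_summable[OF pos sm])
  have c0: "0 \<le> conv a b k" for k unfolding conv_def by (intro infsum_nonneg mult_nonneg_nonneg pos)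
  have fin: "sum (conv a b) F \<le> infsum a UNIV * infsum b UNIV" if F: "finite F" for F
  proof -
    have "sum (conv a b) F = (\<Sum>\<^sub>\<infinity>l. \<Sum>k\<in>F. a (k - l) * b l)"
      unfolding conv_def using F
    proof (induction F)
      case (insert x F)
      have "(\<lambda>l. \<Sum>k\<in>F. a (k - l) * b l) summable_on UNIV" using insert by (intro summable_on_sum s)
      then show ?case using insert by (simp add: infsum_add[OF s])
    qed simp
    also have "\<dots> \<le> (\<Sum>\<^sub>\<infinity>l. infsum a UNIV * b l)"
    proof (rule infsum_mono)
      show "(\<lambda>l. \<Sum>k\<in>F. a (k - l) * b l) summable_on UNIV" by (intro summable_on_sum s)
      show "(\<lambda>l. infsum a UNIV * b l) summable_on UNIV" by (rule summable_on_cmult_right[OF sm(2)])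
      fix l
      have "(\<Sum>k\<in>F. a (k - l)) = sum a ((\<lambda>k. k - l) ` F)" by (simp add: sum.reindex)
      also have "\<dots> \<le> infsum a UNIV" by (rule finite_sum_le_infsum[OF sm(1)]) (use F pos in auto)
      finally have "(\<Sum>k\<in>F. a (k - l)) * b l \<le> infsum a UNIV * b l" by (rule mult_right_mono) (rule pos)
      then show "(\<Sum>k\<in>F. a (k - l) * b l) \<le> infsum a UNIV * b l" by (simp add: sum_distrib_right)
    qed
    also have "\<dots> = infsum a UNIV * infsum b UNIV" by (rule infsum_cmult_right')
    finally show ?thesis .
  qed
  show "conv a b summable_on UNIV"
    by (rule nonneg_bdd_above_summable_on[OF c0]) (use fin in \<open>auto intro!: bdd_aboveI2\<close>)
  then show "infsum (conv a b) UNIV \<le> infsum a UNIV * infsum b UNIV"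
    by (rule infsum_le_finite_sums) (use fin in auto)
qed

definition cdot :: "int^'n \<Rightarrow> complex^'n \<Rightarrow> complex" where
  "cdot k v = (\<Sum>j\<in>UNIV. of_int (k $ j) * v $ j)"

definition vcnj :: "complex^'n \<Rightarrow> complex^'n" where
  "vcnj v = (\<chi> j. cnj (v $ j))"

definition real_modes :: "(int^'n \<Rightarrow> complex^'n) \<Rightarrow> bool" where
  "real_modes a \<longleftrightarrow> (\<forall>k. a (- k) = vcnj (a k))"

definition solenoidal :: "(int^'n \<Rightarrow> complex^'n) \<Rightarrow> bool" where
  "solenoidal a \<longleftrightarrow> (\<forall>k. cdot k (a k) = 0)"

text \<open>The contribution of the modes \<open>v\<close> at \<open>k - l\<close> and
  \<open>w\<close> at \<open>l\<close> to the mode \<open>k\<close> of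
  \<open>- \<P> (u \<bullet> \<nabla>u)\<close>. The derivative appears as the outer frequency
  \<open>k\<close> because \<open>u \<bullet> \<nabla>u = div (u \<otimes> u)\<close> for
  divergence-free \<open>u\<close>.\<close>

definition interaction :: "int^'n \<Rightarrow> complex^'n \<Rightarrow> complex^'n \<Rightarrow> complex^'n" where
  "interaction k v w = - (leray_symbol k *v ((\<i> * cdot k v) *s w))"

definition nonlin :: "(int^'n \<Rightarrow> complex^'n) \<Rightarrow> (int^'n \<Rightarrow> complex^'n) \<Rightarrow> int^'n \<Rightarrow> complex^'n" where
  "nonlin a b k = (\<Sum>\<^sub>\<infinity>l. interaction k (a (k - l)) (b l))"

lemma norm_vector_smult: "norm (z *s v) = norm z * norm v" for v :: "complex^'n"
  by (simp add: norm_vec_def norm_mult L2_set_right_distrib)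

lemma scaleR_eq_smult: "r *\<^sub>R v = complex_of_real r *s v" for v :: "complex^'n"
  by (simp add: vec_eq_iff scaleR_conv_of_real[symmetric])

lemma bounded_bilinear_smult: "bounded_bilinear (\<lambda>z (v::complex^'n). z *s v)"
  by (rule bounded_bilinear.intro)
     (auto simp: vec_eq_iff algebra_simps norm_vector_smult intro!: exI[of _ 1])

lemma bounded_linear_cdot: "bounded_linear (cdot k)"
  by (rule bounded_linear_intro[where K="\<Sum>j\<in>UNIV. \<bar>real_of_int (k $ j)\<bar>"])
     (auto simp: cdot_def algebra_simps sum.distrib scaleR_sum_right sum_distrib_left norm_mult
       intro!: order_trans[OF norm_sum] sum_mono mult_right_mono Finite_Cartesian_Product.norm_nth_le)

lemma bounded_linear_vcnj: "bounded_linear (vcnj :: complex^'n \<Rightarrow> complex^'n)"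
  by (rule bounded_linear_intro[where K=1]) (auto simp: vcnj_def vec_eq_iff norm_vec_def)

lemma bounded_linear_leray_symbol: "bounded_linear (\<lambda>v. leray_symbol k *v v)"
proof -
  have "linear (\<lambda>v. leray_symbol k *v v)"
    by (rule linearI) (auto simp: matrix_vector_right_distrib scaleR_eq_smult vector_scalar_commute)
  then show ?thesis by (simp add: linear_conv_bounded_linear)
qed

lemma norm_cdot: "norm (cdot k v) \<le> norm (freq k) * norm v"
proof -
  have "norm (cdot k v) \<le> (\<Sum>j\<in>UNIV. \<bar>freq k $ j\<bar> * \<bar>norm (v $ j)\<bar>)"
    unfolding cdot_def by (rule order_trans[OF norm_sum]) (simp add: norm_mult)
  also have "\<dots> \<le> L2_set (($) (freq k)) UNIV * L2_set (\<lambda>j. norm (v $ j)) UNIV" by (rule L2_set_mult_ineq)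
  finally show ?thesis by (simp add: norm_vec_def L2_set_def)
qed

lemma norm_freq_sq: "complex_of_real ((norm (freq k))\<^sup>2) = of_int (\<Sum>l\<in>UNIV. (k $ l)\<^sup>2)"
proof -
  have "(norm (freq k))\<^sup>2 = (\<Sum>l\<in>UNIV. (real_of_int (k $ l))\<^sup>2)"
    by (simp add: norm_vec_def L2_set_def sum_nonneg)
  then show ?thesis by simp
qed

lemma leray_symbol_mult:
  assumes "k \<noteq> 0"
  shows "leray_symbol k *v v = v - (cdot k v / of_real ((norm (freq k))\<^sup>2)) *s (\<chi> j. of_int (k $ j))"
proof -
  have "leray_symbol k *v v = v - (\<chi> i j. of_int (k $ i * k $ j) / of_int (\<Sum>l\<in>UNIV. (k $ l)\<^sup>2)) *v v"
    using assms by (simp add: leray_symbol_def matrix_vector_mult_diff_rdistrib)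
  also have "(\<chi> i j. of_int (k $ i * k $ j) / of_int (\<Sum>l\<in>UNIV. (k $ l)\<^sup>2)) *v v =
      (cdot k v / of_real ((norm (freq k))\<^sup>2)) *s (\<chi> j. of_int (k $ j))"
    unfolding norm_freq_sq
    by (simp add: vec_eq_iff matrix_vector_mult_def cdot_def sum_distrib_left sum_distrib_right sum_divide_distrib algebra_simps)
  finally show ?thesis .
qed

lemma leray_symbol_zero [simp]: "leray_symbol 0 *v v = v"
  by (simp add: leray_symbol_def)

lemma cdot_leray_symbol: "k \<noteq> 0 \<Longrightarrow> cdot k (leray_symbol k *v v) = 0"
proof -
  assume k: "k \<noteq> 0"
  have "cdot k (\<chi> j. of_int (k $ j)) = of_real ((norm (freq k))\<^sup>2)"
    unfolding norm_freq_sq by (simp add: cdot_def power2_eq_square)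
  moreover have "cdot k (v - z *s w) = cdot k v - z * cdot k w" for v w :: "complex^'a" and z
    by (simp add: cdot_def algebra_simps sum_subtractf sum_distrib_left)
  ultimately show ?thesis using k by (simp add: leray_symbol_mult)
qed

text \<open>The symbol of the projector is an orthogonal projection, hence a contraction.\<close>

lemma norm_leray_symbol: "norm (leray_symbol k *v v) \<le> norm v"
proof (cases "k = 0")
  case False
  define w where "w = leray_symbol k *v v"
  define z where "z = cdot k v / of_real ((norm (freq k))\<^sup>2)"
  define q :: "complex^'a" where "q = z *s (\<chi> j. of_int (k $ j))"
  have v: "v = w + q" using leray_symbol_mult[OF False, of v] by (simp add: w_def q_def z_def)
  have "w \<bullet> q = Re (cnj z * cdot k w)"
    by (simp add: inner_vec_def q_def cdot_def sum_distrib_left inner_complex_def algebra_simps)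
  also have "\<dots> = 0" using cdot_leray_symbol[OF False] by (simp add: w_def)
  finally have "(norm v)\<^sup>2 = (norm w)\<^sup>2 + (norm q)\<^sup>2"
    unfolding v by (simp add: power2_norm_eq_inner inner_add inner_commute)
  then have "(norm w)\<^sup>2 \<le> (norm v)\<^sup>2" by simp
  then show ?thesis unfolding w_def by (rule power2_le_imp_le) simp
qed simp

lemma norm_interaction: "norm (interaction k v w) \<le> norm (freq k) * (norm v * norm w)"
proof -
  have "norm (interaction k v w) \<le> norm ((\<i> * cdot k v) *s w)" by (simp add: interaction_def norm_leray_symbol)
  also have "\<dots> = norm (cdot k v) * norm w" by (simp add: norm_vector_smult norm_mult)
  also have "\<dots> \<le> norm (freq k) * norm v * norm w" by (intro mult_right_mono norm_cdot) auto
  finally show ?thesis by simp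
qed

lemma bounded_bilinear_interaction: "bounded_bilinear (interaction k)"
proof (rule bounded_bilinear.intro)
  note c = bounded_linear.linear[OF bounded_linear_cdot, of k]
    and l = bounded_linear.linear[OF bounded_linear_leray_symbol, of k]
  note s = bounded_bilinear.add_left[OF bounded_bilinear_smult] bounded_bilinear.add_right[OF bounded_bilinear_smult]
     bounded_bilinear.scaleR_left[OF bounded_bilinear_smult] bounded_bilinear.scaleR_right[OF bounded_bilinear_smult]
  show "interaction k (a + a') b = interaction k a b + interaction k a' b" for a a' b
    by (simp add: interaction_def linear_add[OF c] ring_distribs s linear_add[OF l])
  show "interaction k a (b + b') = interaction k a b + interaction k a b'" for a b b'
    by (simp add: interaction_def s linear_add[OF l])
  show "interaction k (r *\<^sub>R a) b = r *\<^sub>R interaction k a b" for r a b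
    by (simp add: interaction_def linear_cmul[OF c] s linear_cmul[OF l])
  show "interaction k a (r *\<^sub>R b) = r *\<^sub>R interaction k a b" for r a b
    by (simp add: interaction_def s linear_cmul[OF l])
  show "\<exists>K. \<forall>a b. norm (interaction k a b) \<le> norm a * norm b * K"
    by (rule exI[of _ "norm (freq k)"]) (metis norm_interaction mult.commute mult.left_commute)
qed

lemma nonlin_0 [simp]: "nonlin a b 0 = 0"
  by (simp add: nonlin_def interaction_def cdot_def)

context
  fixes a b :: "int^'n \<Rightarrow> complex^'n" and \<alpha> \<beta> :: real
  assumes sm: "(\<lambda>k. norm (a k)) summable_on UNIV" "(\<lambda>k. norm (b k)) summable_on UNIV"
    and le: "(\<Sum>\<^sub>\<infinity>k. norm (a k)) \<le> \<alpha>" "(\<Sum>\<^sub>\<infinity>k. norm (b k)) \<le> \<beta>"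
begin

lemma nonlin_summable:
  "(\<lambda>l. norm (a (k - l)) * norm (b l)) summable_on UNIV"
  "(\<lambda>l. interaction k (a (k - l)) (b l)) summable_on UNIV"
proof -
  have m: "norm (x::complex^'n) \<le> (\<Sum>\<^sub>\<infinity>k. norm (c k))" if "(\<lambda>k. norm (c k)) summable_on UNIV" "x = c k"
    for x c and k :: "int^'n" using finite_sum_le_infsum[OF that(1), of "{k}"] that by simp
  show 1: "(\<lambda>l. norm (a (k - l)) * norm (b l)) summable_on UNIV"
    by (rule conv_bounds(1)[OF _ _ sm order.refl order.refl, where p=0])
       (use m[OF sm(1) refl] m[OF sm(2) refl] in auto)
  show "(\<lambda>l. interaction k (a (k - l)) (b l)) summable_on UNIV"
    by (rule summable_on_norm_bound[OF norm_interaction]) (rule summable_on_cmult_right[OF 1])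
qed

lemma norm_nonlin_le_conv: "norm (nonlin a b k) \<le> norm (freq k) * conv (\<lambda>k. norm (a k)) (\<lambda>k. norm (b k)) k"
  unfolding nonlin_def conv_def infsum_cmult_right'[symmetric]
  by (rule norm_infsum_le_infsum[OF norm_interaction summable_on_cmult_right[OF nonlin_summable(1)]])

lemma nonlin_bound:
  assumes Q: "\<And>k. norm (a k) * bracket k ^ p \<le> Qa" "\<And>k. norm (b k) * bracket k ^ p \<le> Qb"
  shows "norm (nonlin a b k) * bracket k ^ p \<le> norm (freq k) * (2 ^ p * (Qa * \<beta> + \<alpha> * Qb))"
proof -
  have "norm (nonlin a b k) * bracket k ^ p \<le> norm (freq k) * conv (\<lambda>k. norm (a k)) (\<lambda>k. norm (b k)) k * bracket k ^ p"
    by (rule mult_right_mono[OF norm_nonlin_le_conv]) simp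
  also have "\<dots> \<le> norm (freq k) * (2 ^ p * (Qa * \<beta> + \<alpha> * Qb))"
    unfolding mult.assoc by (rule mult_left_mono[OF conv_bounds(3)]) (use sm le Q in auto)
  finally show ?thesis .
qed

lemma cdot_nonlin: "cdot k (nonlin a b k) = 0"
proof (cases "k = 0")
  case False
  have "cdot k (nonlin a b k) = (\<Sum>\<^sub>\<infinity>l. cdot k (interaction k (a (k - l)) (b l)))"
    unfolding nonlin_def
    by (rule infsum_bounded_linear_banach[OF bounded_linear_cdot nonlin_summable(2), symmetric])
  also have "\<dots> = 0"
    using cdot_leray_symbol[OF False] linear_neg[OF bounded_linear.linear[OF bounded_linear_cdot[of k]]]
    by (simp add: interaction_def)
  finally show ?thesis .
qed (simp add: cdot_def)

end

lemma vcnj_interaction: "vcnj (interaction k v w) = interaction (- k) (vcnj v) (vcnj w)"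
proof -
  have 1: "vcnj (z *s w) = cnj z *s vcnj w" for z and w :: "complex^'a" by (simp add: vcnj_def vec_eq_iff)
  have 2: "leray_symbol (- k) = (leray_symbol k :: complex^'a^'a)" by (simp add: leray_symbol_def vec_eq_iff)
  have 3: "vcnj (leray_symbol k *v w) = leray_symbol k *v vcnj w" for w :: "complex^'a"
  proof -
    have "cnj (leray_symbol k $ i $ j) = leray_symbol k $ i $ j" for i j :: 'a
      by (simp add: leray_symbol_def mat_def)
    then show ?thesis by (simp add: vcnj_def vec_eq_iff matrix_vector_mult_def)
  qed
  have 4: "cnj (\<i> * cdot k v) = \<i> * cdot (- k) (vcnj v)"
    by (simp add: cdot_def vcnj_def sum_negf)
  have 5: "vcnj (- w) = - vcnj w" for w :: "complex^'a" by (simp add: vcnj_def vec_eq_iff)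
  show ?thesis unfolding interaction_def by (simp only: 1 2 3 4 5)
qed

lemma real_modes_nonlin:
  assumes "real_modes a" "real_modes b" "(\<lambda>k. norm (a k)) summable_on UNIV" "(\<lambda>k. norm (b k)) summable_on UNIV"
  shows "nonlin a b (- k) = vcnj (nonlin a b k)"
proof -
  have "vcnj (nonlin a b k) = (\<Sum>\<^sub>\<infinity>l. vcnj (interaction k (a (k - l)) (b l)))"
    unfolding nonlin_def
    by (rule infsum_bounded_linear_banach[OF bounded_linear_vcnj nonlin_summable(2)[OF assms(3,4) order.refl order.refl],
       symmetric])
  also have "\<dots> = (\<Sum>\<^sub>\<infinity>l. interaction (- k) (a (- k - (- l))) (b (- l)))"
  proof (rule infsum_cong)
    fix l
    have "vcnj (a (k - l)) = a (- (k - l))" "vcnj (b l) = b (- l)"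
      using assms(1,2) unfolding real_modes_def by metis+
    then show "vcnj (interaction k (a (k - l)) (b l)) = interaction (- k) (a (- k - (- l))) (b (- l))"
      unfolding vcnj_interaction by simp
  qed
  also have "\<dots> = nonlin a b (- k)"
    unfolding nonlin_def
    by (rule infsum_reindex_bij_betw[of uminus UNIV UNIV "\<lambda>l. interaction (- k) (a (- k - l)) (b l)"]) (simp add: bij_uminus)
  finally show ?thesis by simp
qed

lemma nonlin_diff:
  assumes "(\<lambda>k. norm (a k)) summable_on UNIV" "(\<lambda>k. norm (b k)) summable_on UNIV"
  shows "nonlin a a k - nonlin b b k = nonlin a (\<lambda>k. a k - b k) k + nonlin (\<lambda>k. a k - b k) b k"
proof -
  have d: "(\<lambda>k. norm (a k - b k)) summable_on UNIV"
    by (rule summable_on_comparison_test[OF summable_on_add[OF assms]]) (auto intro: norm_triangle_ineq4)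
  note s = nonlin_summable(2)[OF _ _ order.refl order.refl, where k=k]
  have "nonlin a a k - nonlin b b k = (\<Sum>\<^sub>\<infinity>l. interaction k (a (k - l)) (a l) - interaction k (b (k - l)) (b l))"
    unfolding nonlin_def by (rule infsum_diff[symmetric]) (intro s assms)+
  also have "\<dots> = (\<Sum>\<^sub>\<infinity>l. interaction k (a (k - l)) (a l - b l) + interaction k (a (k - l) - b (k - l)) (b l))"
    by (simp add: bounded_bilinear.diff_left[OF bounded_bilinear_interaction] bounded_bilinear.diff_right[OF bounded_bilinear_interaction])
  also have "\<dots> = nonlin a (\<lambda>k. a k - b k) k + nonlin (\<lambda>k. a k - b k) b k"
    unfolding nonlin_def by (rule infsum_add) (rule s[of a "\<lambda>k. a k - b k"] s[of "\<lambda>k. a k - b k" b], intro assms d, intro assms d)+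
  finally show ?thesis .
qed

section \<open>Duhamel estimates\<close>

text \<open>Multiplication by the integrating factor \<open>exp (\<mu> t)\<close> removes the linear
  terms, after which the mean value inequality compares the increments of the two functions.\<close>

lemma duhamel_compare:
  fixes f :: "real \<Rightarrow> 'b::real_normed_vector"
  assumes f: "\<And>t. t \<in> {0..T} \<Longrightarrow> (f has_vector_derivative (- \<mu> *\<^sub>R f t + G t)) (at t within {0..T})"
    and b: "\<And>t. t \<in> {0..T} \<Longrightarrow> (b has_vector_derivative (- \<mu> *\<^sub>R b t + g t)) (at t within {0..T})"
    and G: "\<And>t. t \<in> {0..T} \<Longrightarrow> norm (G t) \<le> g t"
    and 0: "norm (f 0) \<le> b 0" and t: "t \<in> {0..T}"
  shows "norm (f t) \<le> b t"
proof (cases "t = 0")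
  case False
  define h where "h s = exp (\<mu> * s) *\<^sub>R f s" for s
  define \<phi> where "\<phi> s = exp (\<mu> * s) *\<^sub>R b s" for s
  have *: "((\<lambda>s. exp (\<mu> * s) *\<^sub>R u s) has_vector_derivative exp (\<mu> * s) *\<^sub>R v s) (at s within {0..T})"
    if "\<And>t. t \<in> {0..T} \<Longrightarrow> (u has_vector_derivative (- \<mu> *\<^sub>R u t + v t)) (at t within {0..T})" "s \<in> {0..T}"
    for s and u v :: "real \<Rightarrow> 'c::real_normed_vector"
  proof -
    have "((\<lambda>s. exp (\<mu> * s) *\<^sub>R u s) has_vector_derivative (exp (\<mu> * s) *\<^sub>R (- \<mu> *\<^sub>R u s + v s) + (\<mu> * exp (\<mu> * s)) *\<^sub>R u s)) (at s within {0..T})"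
      by (rule has_vector_derivative_scaleR[OF _ that(1)[OF that(2)]]) (auto intro!: derivative_eq_intros)
    then show ?thesis by (simp add: scaleR_diff_right mult.commute)
  qed
  note h' = *[OF f] and \<phi>' = *[OF b]
  have cont: "continuous_on {0..t} (\<lambda>s. exp (\<mu> * s) *\<^sub>R u s)"
    if "\<And>s. s \<in> {0..T} \<Longrightarrow> ((\<lambda>s. exp (\<mu> * s) *\<^sub>R u s) has_vector_derivative v s) (at s within {0..T})"
    for u v :: "real \<Rightarrow> 'c::real_normed_vector"
  proof -
    have "continuous_on {0..T} (\<lambda>s. exp (\<mu> * s) *\<^sub>R u s)"
      using that by (meson continuous_on_eq_continuous_within has_vector_derivative_continuous)
    then show ?thesis by (rule continuous_on_subset) (use t in auto)
  qed
  have "norm (h t - h 0) \<le> \<phi> t - \<phi> 0"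
    unfolding h_def \<phi>_def
  proof (rule differentiable_bound_general[where f'="\<lambda>s. exp (\<mu> * s) *\<^sub>R G s" and \<phi>'="\<lambda>s. exp (\<mu> * s) *\<^sub>R g s"])
    show "0 < t" using False t by auto
    show "continuous_on {0..t} (\<lambda>s. exp (\<mu> * s) *\<^sub>R f s)" by (rule cont[OF h'])
    show "continuous_on {0..t} (\<lambda>s. exp (\<mu> * s) *\<^sub>R b s)" by (rule cont[OF \<phi>'])
    fix s assume s: "0 < s" "s < t"
    show "((\<lambda>s. exp (\<mu> * s) *\<^sub>R f s) has_vector_derivative exp (\<mu> * s) *\<^sub>R G s) (at s)"
      using h'[of s] s t by (simp add: at_within_Icc_at)
    show "((\<lambda>s. exp (\<mu> * s) *\<^sub>R b s) has_vector_derivative exp (\<mu> * s) *\<^sub>R g s) (at s)"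
      using \<phi>'[of s] s t by (simp add: at_within_Icc_at)
    show "norm (exp (\<mu> * s) *\<^sub>R G s) \<le> exp (\<mu> * s) *\<^sub>R g s"
      using G[of s] s t by simp
  qed
  then have "norm (h t) \<le> \<phi> t"
    using norm_triangle_ineq2[of "h t" "h 0"] 0 by (simp add: h_def[of 0] \<phi>_def[of 0])
  then show ?thesis by (simp add: h_def \<phi>_def)
qed (use 0 in auto)

text \<open>Comparison with the explicit solution of the scalar equation with forcing
  \<open>G exp (\<gamma> t)\<close>.\<close>

lemma duhamel_bound:
  fixes f :: "real \<Rightarrow> 'b::real_normed_vector"
  assumes f: "\<And>t. t \<in> {0..T} \<Longrightarrow> (f has_vector_derivative (- \<mu> *\<^sub>R f t + g t)) (at t within {0..T})"
    and g: "\<And>t. t \<in> {0..T} \<Longrightarrow> norm (g t) \<le> G * exp (\<gamma> * t)"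
    and p: "\<mu> \<ge> 0" "\<gamma> > 0" and t: "t \<in> {0..T}"
  shows "norm (f t) \<le> exp (- \<mu> * t) * norm (f 0) + G * exp (\<gamma> * t) / (\<mu> + \<gamma>)"
proof -
  define q where "q = G / (\<mu> + \<gamma>)"
  have G: "G = q * (\<mu> + \<gamma>)" using p by (simp add: q_def)
  have "0 \<le> G" using order_trans[OF norm_ge_zero g[of 0]] t by simp
  then have q: "0 \<le> q" using p by (simp add: q_def)
  define b where "b s = exp (- \<mu> * s) * norm (f 0) + q * (exp (\<gamma> * s) - exp (- \<mu> * s))" for s
  have b': "(b has_vector_derivative (- \<mu> *\<^sub>R b s + G * exp (\<gamma> * s))) (at s within {0..T})" for s
  proof -
    have "(b has_real_derivative (- \<mu> * exp (- \<mu> * s) * norm (f 0) + q * (\<gamma> * exp (\<gamma> * s) + \<mu> * exp (- \<mu> * s)))) (at s within {0..T})"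
      unfolding b_def by (auto intro!: derivative_eq_intros simp: algebra_simps)
    also have "- \<mu> * exp (- \<mu> * s) * norm (f 0) + q * (\<gamma> * exp (\<gamma> * s) + \<mu> * exp (- \<mu> * s)) = - \<mu> *\<^sub>R b s + G * exp (\<gamma> * s)"
      by (simp add: b_def G algebra_simps)
    finally show ?thesis by (simp add: has_real_derivative_iff_has_vector_derivative)
  qed
  have "norm (f t) \<le> b t"
    by (rule duhamel_compare[OF f b' g _ t]) (simp_all add: b_def)
  also have "\<dots> \<le> exp (- \<mu> * t) * norm (f 0) + q * exp (\<gamma> * t)"
    using q by (simp add: b_def algebra_simps)
  finally show ?thesis by (simp add: q_def)
qed

lemma linear_ode_unique:
  fixes f :: "real \<Rightarrow> 'b::real_normed_vector"
  assumes f: "\<And>t. t \<in> {0..T} \<Longrightarrow> (f has_vector_derivative (- \<mu> *\<^sub>R f t)) (at t within {0..T})"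
    and "f 0 = 0" "\<mu> \<ge> 0" and t: "t \<in> {0..T}"
  shows "f t = 0"
  using duhamel_bound[of T f \<mu> "\<lambda>_. 0" 0 1 t] assms by simp

text \<open>Young's inequality \<open>2 \<kappa> \<surd>(\<nu> \<gamma>) \<le> \<nu> \<kappa>\<^sup>2 + \<gamma>\<close> absorbs the derivative in the nonlinearity, uniformly
  in the frequency; the gain is small when \<open>\<gamma>\<close> is large.\<close>

lemma duhamel_bound_freq:
  fixes f :: "real \<Rightarrow> 'b::real_normed_vector"
  assumes f: "\<And>t. t \<in> {0..T} \<Longrightarrow> (f has_vector_derivative (- (\<nu> * \<kappa>\<^sup>2) *\<^sub>R f t + g t)) (at t within {0..T})"
    and g: "\<And>t. t \<in> {0..T} \<Longrightarrow> norm (g t) * w \<le> \<kappa> * (G * exp (\<gamma> * t))"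
    and p: "\<nu> > 0" "\<gamma> > 0" "\<kappa> \<ge> 0" "w > 0" and G: "G \<ge> 0" and t: "t \<in> {0..T}"
  shows "norm (f t) * w \<le> norm (f 0) * w + G * exp (\<gamma> * t) / (2 * sqrt (\<nu> * \<gamma>))"
proof -
  have y: "\<kappa> / (\<nu> * \<kappa>\<^sup>2 + \<gamma>) \<le> 1 / (2 * sqrt (\<nu> * \<gamma>))"
  proof -
    have "0 \<le> (sqrt \<nu> * \<kappa> - sqrt \<gamma>)\<^sup>2" by simp
    then have "2 * sqrt (\<nu> * \<gamma>) * \<kappa> \<le> \<nu> * \<kappa>\<^sup>2 + \<gamma>"
      using p by (simp add: power2_diff power_mult_distrib real_sqrt_mult algebra_simps)
    moreover have "0 < \<nu> * \<kappa>\<^sup>2 + \<gamma>" "0 < sqrt (\<nu> * \<gamma>)" using p by (auto intro: add_nonneg_pos)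
    ultimately show ?thesis by (simp add: divide_simps mult.commute)
  qed
  have "norm (f t) \<le> exp (- (\<nu> * \<kappa>\<^sup>2) * t) * norm (f 0) + (\<kappa> * G / w) * exp (\<gamma> * t) / (\<nu> * \<kappa>\<^sup>2 + \<gamma>)"
    by (rule duhamel_bound[OF f]) (use g p t in \<open>auto simp: pos_le_divide_eq mult.assoc\<close>)
  also have "exp (- (\<nu> * \<kappa>\<^sup>2) * t) * norm (f 0) \<le> 1 * norm (f 0)"
    by (rule mult_right_mono) (use p t in auto)
  also have "(\<kappa> * G / w) * exp (\<gamma> * t) / (\<nu> * \<kappa>\<^sup>2 + \<gamma>) = (G * exp (\<gamma> * t) / w) * (\<kappa> / (\<nu> * \<kappa>\<^sup>2 + \<gamma>))" by simp
  also have "\<dots> \<le> (G * exp (\<gamma> * t) / w) * (1 / (2 * sqrt (\<nu> * \<gamma>)))"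
    by (rule mult_left_mono[OF y]) (use G p in auto)
  finally have "norm (f t) * w \<le> (norm (f 0) + (G * exp (\<gamma> * t) / w) * (1 / (2 * sqrt (\<nu> * \<gamma>)))) * w"
    using p by (intro mult_right_mono) auto
  then show ?thesis using p by (simp add: distrib_right)
qed

lemma linear_ode_exists:
  fixes g :: "real \<Rightarrow> 'b::banach"
  assumes g: "continuous_on {0..T} g"
  shows "\<exists>f. f 0 = f0 \<and> (\<forall>t\<in>{0..T}. (f has_vector_derivative (- \<mu> *\<^sub>R f t + g t)) (at t within {0..T}))"
proof -
  define I where "I t = integral {0..t} (\<lambda>s. exp (\<mu> * s) *\<^sub>R g s)" for t
  define f where "f t = exp (- \<mu> * t) *\<^sub>R (f0 + I t)" for t
  have "(f has_vector_derivative (- \<mu> *\<^sub>R f t + g t)) (at t within {0..T})" if t: "t \<in> {0..T}" for t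
  proof -
  have "(I has_vector_derivative exp (\<mu> * t) *\<^sub>R g t) (at t within {0..T})"
    unfolding I_def by (rule integral_has_vector_derivative[OF _ t]) (intro continuous_intros g)
  then have "(f has_vector_derivative
      (exp (- \<mu> * t) *\<^sub>R (0 + exp (\<mu> * t) *\<^sub>R g t) + (- \<mu> * exp (- \<mu> * t)) *\<^sub>R (f0 + I t))) (at t within {0..T})"
    unfolding f_def
    by (intro has_vector_derivative_scaleR has_vector_derivative_add has_vector_derivative_const)
       (auto intro!: derivative_eq_intros)
  moreover have "exp (- \<mu> * t) *\<^sub>R (0 + exp (\<mu> * t) *\<^sub>R g t) = g t"
    by (simp add: exp_minus)
  ultimately show ?thesis
    by (simp add: f_def add.commute)
  qed
  moreover have "f 0 = f0" by (simp add: f_def I_def)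
  ultimately show ?thesis by blast
qed

section \<open>Evolution of the Fourier modes\<close>

text \<open>The modes \<open>f\<close> solve the linear heat equations forced by the nonlinearity of
  \<open>c\<close>. A solution of the nonlinear system is the case \<open>f = c\<close>, so that the
  estimates for the linear equations serve the iteration, uniqueness and the a priori bounds alike.\<close>

definition driven :: "real \<Rightarrow> real \<Rightarrow> (int^'n \<Rightarrow> real \<Rightarrow> complex^'n) \<Rightarrow> (int^'n \<Rightarrow> real \<Rightarrow> complex^'n) \<Rightarrow> bool" where
  "driven \<nu> T c f \<longleftrightarrow> (\<forall>k. \<forall>t\<in>{0..T}. (f k has_vector_derivative
     (- (\<nu> * (norm (freq k))\<^sup>2) *\<^sub>R f k t + nonlin (\<lambda>k. c k t) (\<lambda>k. c k t) k)) (at t within {0..T}))"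

abbreviation mode_rhs :: "real \<Rightarrow> (int^'n \<Rightarrow> complex^'n) \<Rightarrow> int^'n \<Rightarrow> complex^'n" where
  "mode_rhs \<nu> a k \<equiv> - (\<nu> * (norm (freq k))\<^sup>2) *\<^sub>R a k + nonlin a a k"

text \<open>Decay of every order, uniform on the closed interval, is smoothness in space.\<close>

definition mode_sol :: "real \<Rightarrow> real \<Rightarrow> (int^'n \<Rightarrow> real \<Rightarrow> complex^'n) \<Rightarrow> bool" where
  "mode_sol \<nu> T c \<longleftrightarrow> driven \<nu> T c c \<and>
     (\<forall>p. \<exists>C. \<forall>k. \<forall>t\<in>{0..T}. norm (c k t) * bracket k ^ p \<le> C) \<and>
     (\<forall>t\<in>{0..T}. real_modes (\<lambda>k. c k t) \<and> solenoidal (\<lambda>k. c k t))"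

lemma driven_continuous: "driven \<nu> T c f \<Longrightarrow> continuous_on {0..T} (f k)"
  unfolding driven_def by (meson continuous_on_eq_continuous_within has_vector_derivative_continuous)

text \<open>The time weight \<open>exp (\<gamma> t)\<close> yields the factor
  \<open>1 / \<surd>(\<nu> \<gamma>)\<close>, which a large \<open>\<gamma>\<close> makes as small
  as needed. The weight of order \<open>p\<close> enters linearly, with a coefficient that depends
  on the forcing modes through their \<open>\<ell>\<^sup>1\<close> norm only.\<close>

lemma driven_growth:
  fixes c f :: "int^'n \<Rightarrow> real \<Rightarrow> complex^'n"
  assumes d: "driven \<nu> T c f" and p: "\<nu> > 0" "\<gamma> > 0"
    and sm: "\<And>t. t \<in> {0..T} \<Longrightarrow> (\<lambda>k. norm (c k t)) summable_on UNIV"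
    and le: "\<And>t. t \<in> {0..T} \<Longrightarrow> (\<Sum>\<^sub>\<infinity>k. norm (c k t)) \<le> \<alpha>"
    and X: "\<And>k t. t \<in> {0..T} \<Longrightarrow> norm (c k t) * bracket k ^ p \<le> X * exp (\<gamma> * t)"
    and Q: "norm (f k 0) * bracket k ^ p \<le> Q" and t: "t \<in> {0..T}"
  shows "norm (f k t) * bracket k ^ p \<le> Q + X * exp (\<gamma> * t) * (2 ^ p * \<alpha> / sqrt (\<nu> * \<gamma>))"
proof -
  have \<alpha>: "0 \<le> \<alpha>" using order_trans[OF infsum_nonneg le[OF t]] by simp
  have "0 \<le> X * exp (\<gamma> * t)" using order_trans[OF _ X[OF t, of 0]] by simp
  then have X0: "0 \<le> X" by (simp add: zero_le_mult_iff)
  have "norm (f k t) * bracket k ^ p \<le> norm (f k 0) * bracket k ^ p + (2 ^ p * (2 * \<alpha> * X)) * exp (\<gamma> * t) / (2 * sqrt (\<nu> * \<gamma>))"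
  proof (rule duhamel_bound_freq[where \<kappa>="norm (freq k)" and g="\<lambda>t. nonlin (\<lambda>k. c k t) (\<lambda>k. c k t) k"])
    fix s assume s: "s \<in> {0..T}"
    show "(f k has_vector_derivative - (\<nu> * (norm (freq k))\<^sup>2) *\<^sub>R f k s + nonlin (\<lambda>k. c k s) (\<lambda>k. c k s) k) (at s within {0..T})"
      using d s unfolding driven_def by blast
    have "norm (nonlin (\<lambda>k. c k s) (\<lambda>k. c k s) k) * bracket k ^ p
        \<le> norm (freq k) * (2 ^ p * (X * exp (\<gamma> * s) * \<alpha> + \<alpha> * (X * exp (\<gamma> * s))))"
      by (rule nonlin_bound[OF sm[OF s] sm[OF s] le[OF s] le[OF s] X[OF s] X[OF s]])
    then show "norm (nonlin (\<lambda>k. c k s) (\<lambda>k. c k s) k) * bracket k ^ p \<le> norm (freq k) * (2 ^ p * (2 * \<alpha> * X) * exp (\<gamma> * s))"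
      by (simp add: algebra_simps)
  qed (use p t \<alpha> X0 in auto)
  also have "(2 ^ p * (2 * \<alpha> * X)) * exp (\<gamma> * t) / (2 * sqrt (\<nu> * \<gamma>)) = X * exp (\<gamma> * t) * (2 ^ p * \<alpha> / sqrt (\<nu> * \<gamma>))"
    by simp
  finally show ?thesis using Q by linarith
qed

text \<open>The difference of two quadratic terms is a sum of two products with one factor
  \<open>c - d\<close> each; the order \<open>2 n\<close> of the weight is chosen so that it also
  bounds the \<open>\<ell>\<^sup>1\<close> norms.\<close>

lemma driven_contraction:
  fixes c d f g :: "int^'n \<Rightarrow> real \<Rightarrow> complex^'n"
  assumes f: "driven \<nu> T c f" "driven \<nu> T d g" "\<And>k. f k 0 = g k 0" and p: "\<nu> > 0" "\<gamma> > 0"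
    and M: "\<And>k t. t \<in> {0..T} \<Longrightarrow> norm (c k t) * bracket k ^ (2 * CARD('n)) \<le> M"
           "\<And>k t. t \<in> {0..T} \<Longrightarrow> norm (d k t) * bracket k ^ (2 * CARD('n)) \<le> M"
    and D: "\<And>k t. t \<in> {0..T} \<Longrightarrow> norm (c k t - d k t) * bracket k ^ (2 * CARD('n)) \<le> D * exp (\<gamma> * t)"
    and t: "t \<in> {0..T}"
  shows "norm (f k t - g k t) * bracket k ^ (2 * CARD('n))
    \<le> D * exp (\<gamma> * t) * (2 ^ (2 * CARD('n) + 1) * M * lattice_sum TYPE('n) / sqrt (\<nu> * \<gamma>))"
proof -
  define P where "P = 2 * CARD('n)"
  define Z where "Z = lattice_sum TYPE('n)"
  note M = M[folded P_def] and D = D[folded P_def]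
  have Z: "0 < Z" by (simp add: Z_def lattice_sum_pos)
  have M0: "0 \<le> M" using order_trans[OF _ M(1)[OF t, of 0]] by simp
  have "0 \<le> D * exp (\<gamma> * t)" using order_trans[OF _ D[OF t, of 0]] by simp
  then have D0: "0 \<le> D" by (simp add: zero_le_mult_iff)
  have "norm (f k t - g k t) * bracket k ^ P \<le> norm (f k 0 - g k 0) * bracket k ^ P + (2 ^ P * (4 * M * Z * D)) * exp (\<gamma> * t) / (2 * sqrt (\<nu> * \<gamma>))"
  proof (rule duhamel_bound_freq[where \<kappa>="norm (freq k)" and f="\<lambda>t. f k t - g k t"
        and g="\<lambda>t. nonlin (\<lambda>k. c k t) (\<lambda>k. c k t) k - nonlin (\<lambda>k. d k t) (\<lambda>k. d k t) k"])
    fix s assume s: "s \<in> {0..T}"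
    have "((\<lambda>t. f k t - g k t) has_vector_derivative
        (- (\<nu> * (norm (freq k))\<^sup>2) *\<^sub>R f k s + nonlin (\<lambda>k. c k s) (\<lambda>k. c k s) k) -
        (- (\<nu> * (norm (freq k))\<^sup>2) *\<^sub>R g k s + nonlin (\<lambda>k. d k s) (\<lambda>k. d k s) k)) (at s within {0..T})"
      using f(1,2) s unfolding driven_def by (intro has_vector_derivative_diff) blast+
    then show "((\<lambda>t. f k t - g k t) has_vector_derivative
        - (\<nu> * (norm (freq k))\<^sup>2) *\<^sub>R (f k s - g k s) + (nonlin (\<lambda>k. c k s) (\<lambda>k. c k s) k - nonlin (\<lambda>k. d k s) (\<lambda>k. d k s) k)) (at s within {0..T})"
      by (simp add: algebra_simps)
    note sc = decay_summable[OF M(1)[OF s, unfolded P_def]] and sd = decay_summable[OF M(2)[OF s, unfolded P_def]]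
      and se = decay_summable[OF D[OF s, unfolded P_def], folded Z_def]
    have 1: "norm (nonlin (\<lambda>k. c k s) (\<lambda>k. c k s - d k s) k) * bracket k ^ P
        \<le> norm (freq k) * (2 ^ P * (M * (D * exp (\<gamma> * s) * Z) + M * Z * (D * exp (\<gamma> * s))))"
      by (rule nonlin_bound[OF sc(1) se(1) sc(3)[folded Z_def] se(3) M(1)[OF s] D[OF s]])
    have 2: "norm (nonlin (\<lambda>k. c k s - d k s) (\<lambda>k. d k s) k) * bracket k ^ P
        \<le> norm (freq k) * (2 ^ P * (D * exp (\<gamma> * s) * (M * Z) + (D * exp (\<gamma> * s) * Z) * M))"
      by (rule nonlin_bound[OF se(1) sd(1) se(3) sd(3)[folded Z_def] D[OF s] M(2)[OF s]])
    have "norm (nonlin (\<lambda>k. c k s) (\<lambda>k. c k s) k - nonlin (\<lambda>k. d k s) (\<lambda>k. d k s) k) * bracket k ^ P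
        \<le> (norm (nonlin (\<lambda>k. c k s) (\<lambda>k. c k s - d k s) k) + norm (nonlin (\<lambda>k. c k s - d k s) (\<lambda>k. d k s) k)) * bracket k ^ P"
      unfolding nonlin_diff[OF sc(1) sd(1)] by (intro mult_right_mono norm_triangle_ineq) simp
    then show "norm (nonlin (\<lambda>k. c k s) (\<lambda>k. c k s) k - nonlin (\<lambda>k. d k s) (\<lambda>k. d k s) k) * bracket k ^ P
        \<le> norm (freq k) * (2 ^ P * (4 * M * Z * D) * exp (\<gamma> * s))"
      using 1 2 by (simp add: algebra_simps)
  qed (use p t M0 D0 Z in auto)
  also have "\<dots> = D * exp (\<gamma> * t) * (2 ^ (P + 1) * M * Z / sqrt (\<nu> * \<gamma>))" using f(3) by simp
  finally show ?thesis unfolding P_def Z_def .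
qed

lemma nonlin_continuous:
  fixes a b :: "int^'n \<Rightarrow> real \<Rightarrow> complex^'n"
  assumes c: "\<And>k. continuous_on S (a k)" "\<And>k. continuous_on S (b k)"
    and M: "\<And>k t. t \<in> S \<Longrightarrow> norm (a k t) \<le> M"
      "\<And>k t. t \<in> S \<Longrightarrow> norm (b k t) * bracket k ^ (2 * CARD('n)) \<le> M"
  shows "continuous_on S (\<lambda>t. nonlin (\<lambda>k. a k t) (\<lambda>k. b k t) k)"
  unfolding nonlin_def
proof (rule continuous_on_infsum[where M="\<lambda>l. norm (freq k) * (M * (M * (1 / bracket l ^ (2 * CARD('n)))))"])
  show "continuous_on S (\<lambda>t. interaction k (a (k - l) t) (b l t))" for l
    by (rule bounded_bilinear.continuous_on[OF bounded_bilinear_interaction c])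
  fix l t assume t: "t \<in> S"
  have 2: "norm (b l t) \<le> M * (1 / bracket l ^ (2 * CARD('n)))"
    using M(2)[OF t, of l] by (simp add: pos_le_divide_eq)
  have "norm (interaction k (a (k - l) t) (b l t)) \<le> norm (freq k) * (norm (a (k - l) t) * norm (b l t))" by (rule norm_interaction)
  also have "\<dots> \<le> norm (freq k) * (M * (M * (1 / bracket l ^ (2 * CARD('n)))))"
    by (intro mult_left_mono mult_mono M(1)[OF t] 2 order_trans[OF norm_ge_zero M(1)[OF t]]) auto
  finally show "norm (interaction k (a (k - l) t) (b l t)) \<le> norm (freq k) * (M * (M * (1 / bracket l ^ (2 * CARD('n)))))" .
qed (intro summable_on_cmult_right summable_bracket)

lemma norm_le_of_decay: "norm v * bracket k ^ p \<le> M \<Longrightarrow> norm v \<le> M"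
  using mult_left_mono[OF bracket_power_ge_1[of k p] norm_ge_zero[of v]] by simp

lemma driven_exists:
  fixes c :: "int^'n \<Rightarrow> real \<Rightarrow> complex^'n"
  assumes c: "\<And>k. continuous_on {0..T} (c k)"
    and M: "\<And>k t. t \<in> {0..T} \<Longrightarrow> norm (c k t) * bracket k ^ (2 * CARD('n)) \<le> M"
  shows "\<exists>f. driven \<nu> T c f \<and> (\<forall>k. f k 0 = a k)"
proof -
  have cont: "continuous_on {0..T} (\<lambda>t. nonlin (\<lambda>k. c k t) (\<lambda>k. c k t) k)" for k
    by (rule nonlin_continuous[OF c c norm_le_of_decay[OF M] M])
  have "\<forall>k. \<exists>f. f 0 = a k \<and> (\<forall>t\<in>{0..T}. (f has_vector_derivative
      (- (\<nu> * (norm (freq k))\<^sup>2) *\<^sub>R f t + nonlin (\<lambda>k. c k t) (\<lambda>k. c k t) k)) (at t within {0..T}))"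
    using linear_ode_exists[OF cont] by blast
  then show ?thesis unfolding driven_def by metis
qed

text \<open>The conjugate of the equation for \<open>k\<close> is the equation for
  \<open>- k\<close>, so the two sides solve the same linear equation with the same initial value.\<close>

lemma driven_real_modes:
  fixes c f :: "int^'n \<Rightarrow> real \<Rightarrow> complex^'n"
  assumes d: "driven \<nu> T c f" and \<nu>: "\<nu> \<ge> 0"
    and sm: "\<And>t. t \<in> {0..T} \<Longrightarrow> (\<lambda>k. norm (c k t)) summable_on UNIV"
    and r: "\<And>t. t \<in> {0..T} \<Longrightarrow> real_modes (\<lambda>k. c k t)" "real_modes (\<lambda>k. f k 0)" and t: "t \<in> {0..T}"
  shows "real_modes (\<lambda>k. f k t)"
  unfolding real_modes_def
proof
  fix k
  have "f (- k) t - vcnj (f k t) = 0"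
  proof (rule linear_ode_unique[where \<mu>="\<nu> * (norm (freq k))\<^sup>2" and T=T])
    fix s assume s: "s \<in> {0..T}"
    have 1: "(f (- k) has_vector_derivative
        (- (\<nu> * (norm (freq (- k)))\<^sup>2) *\<^sub>R f (- k) s + nonlin (\<lambda>k. c k s) (\<lambda>k. c k s) (- k))) (at s within {0..T})"
      using d s unfolding driven_def by blast
    have 2: "((\<lambda>s. vcnj (f k s)) has_vector_derivative
        vcnj (- (\<nu> * (norm (freq k))\<^sup>2) *\<^sub>R f k s + nonlin (\<lambda>k. c k s) (\<lambda>k. c k s) k)) (at s within {0..T})"
      using d s unfolding driven_def by (intro bounded_linear.has_vector_derivative[OF bounded_linear_vcnj]) blast
    have 3: "nonlin (\<lambda>k. c k s) (\<lambda>k. c k s) (- k) = vcnj (nonlin (\<lambda>k. c k s) (\<lambda>k. c k s) k)"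
      by (rule real_modes_nonlin) (use r s sm in auto)
    have "((\<lambda>s. f (- k) s - vcnj (f k s)) has_vector_derivative
       (- (\<nu> * (norm (freq (- k)))\<^sup>2) *\<^sub>R f (- k) s + nonlin (\<lambda>k. c k s) (\<lambda>k. c k s) (- k)) -
        vcnj (- (\<nu> * (norm (freq k))\<^sup>2) *\<^sub>R f k s + nonlin (\<lambda>k. c k s) (\<lambda>k. c k s) k)) (at s within {0..T})"
      by (rule has_vector_derivative_diff[OF 1 2])
    also have "(- (\<nu> * (norm (freq (- k)))\<^sup>2) *\<^sub>R f (- k) s + nonlin (\<lambda>k. c k s) (\<lambda>k. c k s) (- k)) -
        vcnj (- (\<nu> * (norm (freq k))\<^sup>2) *\<^sub>R f k s + nonlin (\<lambda>k. c k s) (\<lambda>k. c k s) k) =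
        - (\<nu> * (norm (freq k))\<^sup>2) *\<^sub>R (f (- k) s - vcnj (f k s))"
      unfolding 3 linear_add[OF bounded_linear.linear[OF bounded_linear_vcnj]]
        linear_cmul[OF bounded_linear.linear[OF bounded_linear_vcnj]]
      by (simp add: algebra_simps)
    finally show "((\<lambda>s. f (- k) s - vcnj (f k s)) has_vector_derivative
       - (\<nu> * (norm (freq k))\<^sup>2) *\<^sub>R (f (- k) s - vcnj (f k s))) (at s within {0..T})" .
  qed (use t \<nu> r(2) in \<open>auto simp: real_modes_def\<close>)
  then show "f (- k) t = vcnj (f k t)" by simp
qed

text \<open>The forcing is divergence-free, so \<open>k \<bullet> f\<^sub>k\<close> solves a
  homogeneous linear equation with zero data.\<close>

lemma driven_solenoidal:
  fixes c f :: "int^'n \<Rightarrow> real \<Rightarrow> complex^'n"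
  assumes d: "driven \<nu> T c f" and \<nu>: "\<nu> \<ge> 0"
    and sm: "\<And>t. t \<in> {0..T} \<Longrightarrow> (\<lambda>k. norm (c k t)) summable_on UNIV"
    and r: "solenoidal (\<lambda>k. f k 0)" and t: "t \<in> {0..T}"
  shows "solenoidal (\<lambda>k. f k t)"
  unfolding solenoidal_def
proof
  fix k
  show "cdot k (f k t) = 0"
  proof (rule linear_ode_unique[where \<mu>="\<nu> * (norm (freq k))\<^sup>2" and T=T])
    fix s assume s: "s \<in> {0..T}"
    have "((\<lambda>s. cdot k (f k s)) has_vector_derivative
        cdot k (- (\<nu> * (norm (freq k))\<^sup>2) *\<^sub>R f k s + nonlin (\<lambda>k. c k s) (\<lambda>k. c k s) k)) (at s within {0..T})"
      using d s unfolding driven_def by (intro bounded_linear.has_vector_derivative[OF bounded_linear_cdot]) blast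
    then show "((\<lambda>s. cdot k (f k s)) has_vector_derivative - (\<nu> * (norm (freq k))\<^sup>2) *\<^sub>R cdot k (f k s)) (at s within {0..T})"
      unfolding linear_add[OF bounded_linear.linear[OF bounded_linear_cdot]]
        linear_cmul[OF bounded_linear.linear[OF bounded_linear_cdot]]
        cdot_nonlin[OF sm[OF s] sm[OF s] order.refl order.refl] by simp
  qed (use t \<nu> r in \<open>auto simp: solenoidal_def\<close>)
qed

text \<open>Picard iteration in a set of curves that is closed under pointwise limits. The length
  \<open>\<nu> / K\<^sup>2\<close> of the interval depends on the norm \<open>R\<close> of order
  \<open>2 n\<close> only; the weights of higher order survive on the same interval because their
  growth rates may depend on the order.\<close>

lemma picard_fixed_point:
  fixes a :: "int^'n \<Rightarrow> complex^'n" and Q :: "nat \<Rightarrow> real"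
  defines "P \<equiv> 2 * CARD('n)" and "Z \<equiv> lattice_sum TYPE('n)"
  defines "K \<equiv> \<lambda>R. 3 * 2 ^ (P + 3) * R * Z"
  assumes p: "\<nu> > 0" "R > 0" and a: "real_modes a" "solenoidal a"
    and R: "\<And>k. norm (a k) * bracket k ^ P \<le> R" and Q: "\<And>p k. norm (a k) * bracket k ^ p \<le> Q p"
  shows "\<exists>c. mode_sol \<nu> (\<nu> / (K R)\<^sup>2) c \<and> (\<forall>k. c k 0 = a k)"
proof -
  have Z: "0 < Z" by (simp add: Z_def lattice_sum_pos)
  have K: "0 < K R" using p Z by (simp add: K_def)
  \<comment> \<open>On an interval of length \<open>\<tau> = 1 / \<gamma>\<close> the weight
    \<open>exp (\<gamma> t)\<close> is at most \<open>e \<le> 3\<close>, and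
    \<open>\<surd>(\<nu> \<gamma>) = K\<close>. The factor \<open>3\<close> in \<open>K\<close>
    compensates for the weight, the power of \<open>2\<close> makes the map a contraction.\<close>
  define \<tau> where "\<tau> = \<nu> / (K R)\<^sup>2"
  define \<gamma> where "\<gamma> = (K R)\<^sup>2 / \<nu>"
  have \<gamma>: "\<gamma> > 0" "sqrt (\<nu> * \<gamma>) = K R" using K p by (simp_all add: \<gamma>_def)
  have \<tau>: "0 \<le> \<tau>" using p by (simp add: \<tau>_def)
  have e: "1 \<le> exp (\<gamma> * t)" "exp (\<gamma> * t) \<le> 3" if "t \<in> {0..\<tau>}" for t
  proof -
    show "1 \<le> exp (\<gamma> * t)" using \<gamma> that by simp
    have "\<gamma> * t \<le> \<gamma> * \<tau>" using that \<gamma> by (intro mult_left_mono) auto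
    also have "\<dots> = 1" using K p by (simp add: \<gamma>_def \<tau>_def)
    finally have "exp (\<gamma> * t) \<le> exp 1" by simp
    then show "exp (\<gamma> * t) \<le> 3" using exp_le by linarith
  qed
  define \<alpha> where "\<alpha> = 2 * R * Z"
  have \<alpha>: "0 < \<alpha>" using p Z by (simp add: \<alpha>_def)
  \<comment> \<open>The rate at which the growth estimate for the weight of order \<open>p\<close>
    has gain \<open>1 / 2\<close>.\<close>
  define \<Lambda> where "\<Lambda> p = (2 ^ (p + 1) * \<alpha>)\<^sup>2 / \<nu>" for p
  have \<Lambda>: "\<Lambda> q > 0" "sqrt (\<nu> * \<Lambda> q) = 2 ^ (q + 1) * \<alpha>" for q using \<alpha> p by (simp_all add: \<Lambda>_def)
  have Q0: "0 \<le> Q q" for q using order_trans[OF _ Q[of 0 q]] by simp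
  define adm where "adm c \<longleftrightarrow> (\<forall>k. continuous_on {0..\<tau>} (c k)) \<and>
     (\<forall>k. \<forall>t\<in>{0..\<tau>}. norm (c k t) * bracket k ^ P \<le> 2 * R) \<and>
     (\<forall>q k. \<forall>t\<in>{0..\<tau>}. norm (c k t) * bracket k ^ q \<le> 2 * Q q * exp (\<Lambda> q * t)) \<and>
     (\<forall>t\<in>{0..\<tau>}. real_modes (\<lambda>k. c k t) \<and> solenoidal (\<lambda>k. c k t))" for c :: "int^'n \<Rightarrow> real \<Rightarrow> complex^'n"
  \<comment> \<open>The bounds reproduce themselves because the gains are \<open>1 / 12\<close>
    (times a weight of at most \<open>3\<close>) and \<open>1 / 2\<close>.\<close>
  have step: "\<exists>f. driven \<nu> \<tau> c f \<and> (\<forall>k. f k 0 = a k) \<and> adm f" if c: "adm c" for c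
  proof -
    have M: "\<And>k t. t \<in> {0..\<tau>} \<Longrightarrow> norm (c k t) * bracket k ^ (2 * CARD('n)) \<le> 2 * R"
      using c unfolding adm_def P_def by blast
    obtain f where f: "driven \<nu> \<tau> c f" "\<And>k. f k 0 = a k"
      using driven_exists[of \<tau> c, OF _ M] c unfolding adm_def by metis
    have sm: "(\<lambda>k. norm (c k t)) summable_on UNIV" "(\<Sum>\<^sub>\<infinity>k. norm (c k t)) \<le> \<alpha>" if "t \<in> {0..\<tau>}" for t
      using decay_summable(1,3)[OF M[OF that]] by (simp_all add: \<alpha>_def Z_def)
    have "adm f"
      unfolding adm_def
    proof (intro conjI allI ballI)
      show "continuous_on {0..\<tau>} (f k)" for k by (rule driven_continuous[OF f(1)])
      fix t assume t: "t \<in> {0..\<tau>}"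
      show "real_modes (\<lambda>k. f k t)"
        by (rule driven_real_modes[OF f(1) _ sm(1)]) (use p a f c t in \<open>auto simp: adm_def\<close>)
      show "solenoidal (\<lambda>k. f k t)"
        by (rule driven_solenoidal[OF f(1) _ sm(1)]) (use p a f t in auto)
      fix k
      have "norm (f k t) * bracket k ^ P \<le> R + 2 * R * exp (\<gamma> * t) * (2 ^ P * \<alpha> / sqrt (\<nu> * \<gamma>))"
      proof (rule driven_growth[OF f(1) p(1) \<gamma>(1) sm])
        fix k t assume t: "t \<in> {0..\<tau>}"
        have "2 * R * 1 \<le> 2 * R * exp (\<gamma> * t)" by (rule mult_left_mono[OF e(1)[OF t]]) (use p in auto)
        then show "norm (c k t) * bracket k ^ P \<le> 2 * R * exp (\<gamma> * t)"
          using M[OF t, of k] by (simp add: P_def)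
      qed (use R f t in auto)
      also have "2 ^ P * \<alpha> / sqrt (\<nu> * \<gamma>) = 1 / 12" unfolding \<gamma>(2) K_def \<alpha>_def using p Z by (simp add: power_add)
      also have "R + 2 * R * exp (\<gamma> * t) * (1 / 12) \<le> R + 2 * R * 3 * (1 / 12)"
        by (intro add_left_mono mult_right_mono mult_left_mono e t) (use p in auto)
      also have "\<dots> \<le> 2 * R" using p by simp
      finally show "norm (f k t) * bracket k ^ P \<le> 2 * R" .
      fix q
      have "norm (f k t) * bracket k ^ q \<le> Q q + 2 * Q q * exp (\<Lambda> q * t) * (2 ^ q * \<alpha> / sqrt (\<nu> * \<Lambda> q))"
        by (rule driven_growth[OF f(1) p(1) \<Lambda>(1) sm]) (use Q f t c in \<open>auto simp: adm_def\<close>)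
      also have "2 ^ q * \<alpha> / sqrt (\<nu> * \<Lambda> q) = 1 / 2" unfolding \<Lambda>(2) using \<alpha> by simp
      also have "Q q + 2 * Q q * exp (\<Lambda> q * t) * (1 / 2) \<le> 2 * Q q * exp (\<Lambda> q * t)"
        using mult_left_mono[OF _ Q0[of q], of 1 "exp (\<Lambda> q * t)"] t \<Lambda>(1)[of q] by simp
      finally show "norm (f k t) * bracket k ^ q \<le> 2 * Q q * exp (\<Lambda> q * t)" .
    qed
    then show ?thesis using f by blast
  qed
  then obtain \<Phi> where \<Phi>: "\<And>c. adm c \<Longrightarrow> driven \<nu> \<tau> c (\<Phi> c)" "\<And>c k. adm c \<Longrightarrow> \<Phi> c k 0 = a k" "\<And>c. adm c \<Longrightarrow> adm (\<Phi> c)"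
    by metis
  define u where "u n = (\<Phi> ^^ n) (\<lambda>k t. a k)" for n
  have adm0: "adm (\<lambda>k t. a k)"
    unfolding adm_def
  proof (intro conjI allI ballI)
    fix k t assume t: "t \<in> {0..\<tau>}"
    show "norm (a k) * bracket k ^ P \<le> 2 * R" using R[of k] p by simp
    show "norm (a k) * bracket k ^ q \<le> 2 * Q q * exp (\<Lambda> q * t)" for q
      using mult_left_mono[OF _ Q0[of q], of 1 "exp (\<Lambda> q * t)"] t \<Lambda>(1)[of q] Q[of k q] Q0[of q] by simp
  qed (use a in auto)
  have admu: "adm (u n)" for n by (induction n) (auto simp: u_def adm0 intro: \<Phi>)
  have uS: "u (Suc n) = \<Phi> (u n)" for n by (simp add: u_def)
  have bnd: "norm (c k t) * bracket k ^ (2 * CARD('n)) \<le> 2 * R" if "adm c" "t \<in> {0..\<tau>}" for c k t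
    using that unfolding adm_def P_def by blast
  have contr: "norm (\<Phi> c k t - \<Phi> d k t) * bracket k ^ P \<le> D / 2 * exp (\<gamma> * t)"
    if "adm c" "adm d" "\<And>k t. t \<in> {0..\<tau>} \<Longrightarrow> norm (c k t - d k t) * bracket k ^ P \<le> D * exp (\<gamma> * t)" "t \<in> {0..\<tau>}" for c d D k t
  proof -
    have "0 \<le> D * exp (\<gamma> * t)" using order_trans[OF _ that(3)[OF that(4), of 0]] by simp
    moreover have "norm (\<Phi> c k t - \<Phi> d k t) * bracket k ^ P
      \<le> D * exp (\<gamma> * t) * (2 ^ (P + 1) * (2 * R) * Z / sqrt (\<nu> * \<gamma>))"
      unfolding P_def Z_def
      by (rule driven_contraction[OF \<Phi>(1)[OF that(1)] \<Phi>(1)[OF that(2)] _ p(1) \<gamma>(1) bnd[OF that(1)] bnd[OF that(2)] that(3)[unfolded P_def] that(4)])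
         (use \<Phi> that in auto)
    moreover have e6: "2 ^ (P + 1) * (2 * R) * Z / sqrt (\<nu> * \<gamma>) = 1 / 6" unfolding \<gamma>(2) K_def using p Z by (simp add: power_add)
    ultimately show ?thesis unfolding e6 by linarith
  qed
  have diff: "norm (u (Suc n) k t - u n k t) * bracket k ^ P \<le> (4 * R / 2 ^ n) * exp (\<gamma> * t)" if "t \<in> {0..\<tau>}" for n k t
    using that
  proof (induction n arbitrary: k t)
    case 0
    have "norm (u (Suc 0) k t - u 0 k t) * bracket k ^ P \<le> (norm (u (Suc 0) k t) + norm (u 0 k t)) * bracket k ^ P"
      by (intro mult_right_mono norm_triangle_ineq4) simp
    also have "\<dots> \<le> 2 * R + 2 * R"
      using bnd[OF admu 0, folded P_def, of "Suc 0" k] bnd[OF admu 0, folded P_def, of 0 k] by (simp add: distrib_right)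
    also have "\<dots> = 4 * R * 1" by simp
    also have "\<dots> \<le> 4 * R * exp (\<gamma> * t)" by (rule mult_left_mono[OF e(1)[OF 0]]) (use p in auto)
    finally show ?case by simp
  next
    case (Suc n)
    show ?case using contr[OF admu[of "Suc n"] admu[of n] Suc.IH Suc.prems] by (simp add: uS[symmetric])
  qed
  have tail: "norm (u (n + i) k t - u n k t) * bracket k ^ P \<le> 24 * R / 2 ^ n * (1 - 1 / 2 ^ i)" if t: "t \<in> {0..\<tau>}" for n i k t
  proof (induction i)
    case (Suc i)
    have "norm (u (n + Suc i) k t - u n k t) * bracket k ^ P \<le>
        (norm (u (Suc (n + i)) k t - u (n + i) k t) + norm (u (n + i) k t - u n k t)) * bracket k ^ P"
      by (intro mult_right_mono) (use norm_triangle_ineq[of "u (Suc (n + i)) k t - u (n + i) k t" "u (n + i) k t - u n k t"] in auto)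
    also have "\<dots> \<le> (4 * R / 2 ^ (n + i)) * exp (\<gamma> * t) + 24 * R / 2 ^ n * (1 - 1 / 2 ^ i)"
      using diff[OF t, of "n + i" k] Suc by (simp add: distrib_right)
    also have "\<dots> \<le> (4 * R / 2 ^ (n + i)) * 3 + 24 * R / 2 ^ n * (1 - 1 / 2 ^ i)"
      by (intro add_right_mono mult_left_mono e t) (use p in auto)
    also have "(4 * R / 2 ^ (n + i)) * 3 = 24 * R / 2 ^ n * (1 / 2 ^ Suc i)" by (simp add: power_add)
    also have "24 * R / 2 ^ n * (1 / 2 ^ Suc i) + 24 * R / 2 ^ n * (1 - 1 / 2 ^ i) = 24 * R / 2 ^ n * (1 - 1 / 2 ^ Suc i)"
      unfolding distrib_left[symmetric] by (simp add: field_simps)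
    finally show ?case .
  qed simp
  have tail': "norm (u m k t - u n k t) \<le> 24 * R / 2 ^ n" "norm (u m k t - u n k t) * bracket k ^ P \<le> 24 * R / 2 ^ n"
    if "t \<in> {0..\<tau>}" "m \<ge> n" for m n k t
  proof -
    have "24 * R / 2 ^ n * (1 - 1 / 2 ^ (m - n)) \<le> 24 * R / 2 ^ n * 1"
      by (rule mult_left_mono) (use p in auto)
    then show 1: "norm (u m k t - u n k t) * bracket k ^ P \<le> 24 * R / 2 ^ n"
      using tail[OF that(1), of n "m - n" k] that(2) by simp
    have "norm (u m k t - u n k t) * 1 \<le> norm (u m k t - u n k t) * bracket k ^ P" by (rule mult_left_mono) auto
    then show "norm (u m k t - u n k t) \<le> 24 * R / 2 ^ n" using 1 by simp
  qed
  have to0: "(\<lambda>n. 24 * R / 2 ^ n) \<longlonglongrightarrow> 0"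
    by (rule LIMSEQ_divide_realpow_zero) simp
  have "uniformly_Cauchy_on {0..\<tau>} (\<lambda>n. u n k)" for k
  proof (rule uniformly_Cauchy_onI')
    fix e :: real assume "e > 0"
    then have "\<forall>\<^sub>F n in sequentially. 24 * R / 2 ^ n < e" using to0 by (rule order_tendstoD(2)[rotated])
    then obtain N where N: "\<And>n. n \<ge> N \<Longrightarrow> 24 * R / 2 ^ n < e" by (auto simp: eventually_sequentially)
    show "\<exists>M. \<forall>x\<in>{0..\<tau>}. \<forall>m\<ge>M. \<forall>n>m. dist (u m k x) (u n k x) < e"
    proof (intro exI ballI allI impI)
      fix x m n assume *: "x \<in> {0..\<tau>}" "m \<ge> N" "n > m"
      then show "dist (u m k x) (u n k x) < e"
        using tail'(1)[OF *(1), of m n k] N[of m] by (simp add: dist_norm norm_minus_commute)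
    qed
  qed
  then have "\<exists>L. uniform_limit {0..\<tau>} (\<lambda>n. u n k) L sequentially" for k
    using Cauchy_uniformly_convergent uniformly_convergent_on_def by blast
  then obtain L where L: "\<And>k. uniform_limit {0..\<tau>} (\<lambda>n. u n k) (L k) sequentially" by metis
  have lim: "(\<lambda>n. u n k t) \<longlonglongrightarrow> L k t" if "t \<in> {0..\<tau>}" for k t by (rule tendsto_uniform_limitI[OF L that])
  have admL: "adm L"
    unfolding adm_def
  proof (intro conjI allI ballI)
    show "continuous_on {0..\<tau>} (L k)" for k
      by (rule uniform_limit_theorem[OF _ L]) (use admu in \<open>auto simp: adm_def\<close>)
    fix t assume t: "t \<in> {0..\<tau>}"
    note l = lim[OF t]
    show "norm (L k t) * bracket k ^ P \<le> 2 * R" for k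
      by (rule LIMSEQ_le_const2[OF tendsto_mult[OF tendsto_norm[OF l] tendsto_const]]) (use admu t in \<open>auto simp: adm_def\<close>)
    show "norm (L k t) * bracket k ^ q \<le> 2 * Q q * exp (\<Lambda> q * t)" for k q
      by (rule LIMSEQ_le_const2[OF tendsto_mult[OF tendsto_norm[OF l] tendsto_const]]) (use admu t in \<open>auto simp: adm_def\<close>)
    show "real_modes (\<lambda>k. L k t)"
      unfolding real_modes_def
    proof
      fix k
      have "(\<lambda>n. vcnj (u n k t)) \<longlonglongrightarrow> vcnj (L k t)" by (rule bounded_linear.tendsto[OF bounded_linear_vcnj l])
      moreover have "(\<lambda>n. vcnj (u n k t)) = (\<lambda>n. u n (- k) t)" using admu t by (auto simp: adm_def real_modes_def)
      ultimately show "L (- k) t = vcnj (L k t)" using l[of "- k"] LIMSEQ_unique by metis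
    qed
    show "solenoidal (\<lambda>k. L k t)"
      unfolding solenoidal_def
    proof
      fix k
      have "(\<lambda>n. cdot k (u n k t)) \<longlonglongrightarrow> cdot k (L k t)" by (rule bounded_linear.tendsto[OF bounded_linear_cdot l])
      moreover have "(\<lambda>n. cdot k (u n k t)) = (\<lambda>n. 0)" using admu t by (auto simp: adm_def solenoidal_def)
      ultimately show "cdot k (L k t) = 0" using LIMSEQ_unique tendsto_const by metis
    qed
  qed
  have tailL: "norm (L k t - u n k t) * bracket k ^ P \<le> 24 * R / 2 ^ n" if "t \<in> {0..\<tau>}" for k t n
    by (rule LIMSEQ_le_const2[OF tendsto_mult[OF tendsto_norm[OF tendsto_diff[OF lim[OF that] tendsto_const]] tendsto_const]])
       (use tail'(2)[OF that] in auto)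
  define f where "f = \<Phi> L"
  \<comment> \<open>The limit is a fixed point: its image is close to the next iterate, hence to
    the limit.\<close>
  have fL: "f k t = L k t" if t: "t \<in> {0..\<tau>}" for k t
  proof -
    have "norm (f k t - u (Suc n) k t) \<le> 24 * R / 2 ^ n * 3" for n
    proof -
      have "norm (f k t - u (Suc n) k t) * 1 \<le> norm (f k t - u (Suc n) k t) * bracket k ^ P" by (rule mult_left_mono) auto
      also have "\<dots> \<le> (24 * R / 2 ^ n) / 2 * exp (\<gamma> * t)"
        unfolding uS f_def
      proof (rule contr[OF admL admu _ t])
        fix k t assume t: "t \<in> {0..\<tau>}"
        have "24 * R / 2 ^ n * 1 \<le> 24 * R / 2 ^ n * exp (\<gamma> * t)" by (rule mult_left_mono[OF e(1)[OF t]]) (use p in auto)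
        then show "norm (L k t - u n k t) * bracket k ^ P \<le> 24 * R / 2 ^ n * exp (\<gamma> * t)" using tailL[OF t, of k n] by simp
      qed
      also have "\<dots> \<le> (24 * R / 2 ^ n) * 3" by (rule mult_mono[OF _ e(2)[OF t]]) (use p in \<open>auto intro!: divide_right_mono\<close>)
      finally show ?thesis by simp
    qed
    then have ev: "\<forall>\<^sub>F n in sequentially. norm (f k t - u (Suc n) k t) \<le> 24 * R / 2 ^ n * 3" by simp
    have "(\<lambda>n. 24 * R / 2 ^ n * 3) \<longlonglongrightarrow> 0" using tendsto_mult[OF to0 tendsto_const[of 3]] by simp
    then have "(\<lambda>n. f k t - u (Suc n) k t) \<longlonglongrightarrow> 0" by (rule Lim_null_comparison[OF ev])
    then have "(\<lambda>n. f k t - (f k t - u (Suc n) k t)) \<longlonglongrightarrow> f k t - 0" by (intro tendsto_intros)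
    then have "(\<lambda>n. u (Suc n) k t) \<longlonglongrightarrow> f k t" by simp
    then show ?thesis using LIMSEQ_Suc[OF lim[OF t]] LIMSEQ_unique by blast
  qed
  have "adm f" unfolding f_def by (rule \<Phi>(3)[OF admL])
  have "driven \<nu> \<tau> f f"
    unfolding driven_def
  proof (intro allI ballI)
    fix k t assume t: "t \<in> {0..\<tau>}"
    have "(\<lambda>k. L k t) = (\<lambda>k. f k t)" using fL[OF t] by simp
    then show "(f k has_vector_derivative mode_rhs \<nu> (\<lambda>k. f k t) k) (at t within {0..\<tau>})"
      using \<Phi>(1)[OF admL] t unfolding driven_def f_def by metis
  qed
  moreover have "\<exists>C. \<forall>k. \<forall>t\<in>{0..\<tau>}. norm (f k t) * bracket k ^ q \<le> C" for q
  proof (intro exI allI ballI)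
    fix k t assume t: "t \<in> {0..\<tau>}"
    have "norm (f k t) * bracket k ^ q \<le> 2 * Q q * exp (\<Lambda> q * t)" using \<open>adm f\<close> t by (auto simp: adm_def)
    also have "\<dots> \<le> 2 * Q q * exp (\<Lambda> q * \<tau>)" by (intro mult_left_mono) (use Q0 t \<Lambda>(1)[of q] in auto)
    finally show "norm (f k t) * bracket k ^ q \<le> 2 * Q q * exp (\<Lambda> q * \<tau>)" .
  qed
  ultimately have "mode_sol \<nu> \<tau> f" using \<open>adm f\<close> unfolding mode_sol_def adm_def by blast
  moreover have "f k 0 = a k" for k unfolding f_def by (rule \<Phi>(2)[OF admL])
  ultimately show ?thesis unfolding \<tau>_def by blast
qed

text \<open>The time is chosen before the data. This uniformity is what allows a restart close to
  the end of the interval of existence.\<close>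

lemma local_existence:
  assumes "\<nu> > 0" "R > 0"
  shows "\<exists>\<tau>>0. \<forall>a :: int^'n \<Rightarrow> complex^'n. real_modes a \<longrightarrow> solenoidal a \<longrightarrow>
      (\<forall>p. \<exists>Q. \<forall>k. norm (a k) * bracket k ^ p \<le> Q) \<longrightarrow>
      (\<forall>k. norm (a k) * bracket k ^ (2 * CARD('n)) \<le> R) \<longrightarrow> (\<exists>c. mode_sol \<nu> \<tau> c \<and> (\<forall>k. c k 0 = a k))"
proof (rule exI[of _ "\<nu> / (3 * 2 ^ (2 * CARD('n) + 3) * R * lattice_sum TYPE('n))\<^sup>2"], safe)
  let ?\<tau> = "\<nu> / (3 * 2 ^ (2 * CARD('n) + 3) * R * lattice_sum TYPE('n))\<^sup>2"
  show "?\<tau> > 0" using assms lattice_sum_pos[where 'n='n] by simp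
  fix a :: "int^'n \<Rightarrow> complex^'n"
  assume a: "real_modes a" "solenoidal a" "\<forall>p. \<exists>Q. \<forall>k. norm (a k) * bracket k ^ p \<le> Q"
    "\<forall>k. norm (a k) * bracket k ^ (2 * CARD('n)) \<le> R"
  obtain Q where "\<And>p k. norm (a k) * bracket k ^ p \<le> Q p" using a(3) by metis
  then show "\<exists>c. mode_sol \<nu> ?\<tau> c \<and> (\<forall>k. c k 0 = a k)"
    by (rule picard_fixed_point[OF assms a(1,2) a(4)[rule_format]])
qed

lemma mode_sol_summable:
  fixes c :: "int^'n \<Rightarrow> real \<Rightarrow> complex^'n"
  assumes "mode_sol \<nu> T c" "t \<in> {0..T}"
  shows "(\<lambda>k. norm (c k t)) summable_on A"
proof -
  obtain C where "\<forall>k. \<forall>t\<in>{0..T}. norm (c k t) * bracket k ^ (2 * CARD('n)) \<le> C"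
    using assms unfolding mode_sol_def by blast
  then show ?thesis using decay_summable(1)[of "\<lambda>k. c k t" C] assms(2) by blast
qed

text \<open>The contraction estimate applied to two solutions halves any bound on their difference
  in a norm with a suitable exponential weight in time.\<close>

lemma mode_sol_unique:
  fixes c d :: "int^'n \<Rightarrow> real \<Rightarrow> complex^'n"
  assumes \<nu>: "\<nu> > 0" and c: "mode_sol \<nu> T c" and d: "mode_sol \<nu> T d" and eq: "\<And>k. c k 0 = d k 0" and t: "t \<in> {0..T}"
  shows "c k t = d k t"
proof -
  define P where "P = 2 * CARD('n)"
  define Z where "Z = lattice_sum TYPE('n)"
  have Z: "0 < Z" by (simp add: Z_def lattice_sum_pos)
  obtain Mc where Mc: "\<forall>k. \<forall>t\<in>{0..T}. norm (c k t) * bracket k ^ P \<le> Mc" using c unfolding mode_sol_def by blast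
  obtain Md where Md: "\<forall>k. \<forall>t\<in>{0..T}. norm (d k t) * bracket k ^ P \<le> Md" using d unfolding mode_sol_def by blast
  define M where "M = max 1 (max Mc Md)"
  have M: "norm (c k t) * bracket k ^ P \<le> M" "norm (d k t) * bracket k ^ P \<le> M" if "t \<in> {0..T}" for k t
    using Mc Md that unfolding M_def by (meson max.coboundedI1 max.coboundedI2)+
  have M0: "M > 0" by (simp add: M_def)
  define K where "K = 2 ^ (P + 2) * M * Z"
  define \<gamma> where "\<gamma> = K\<^sup>2 / \<nu>"
  have K: "K > 0" using M0 Z by (simp add: K_def)
  have \<gamma>: "\<gamma> > 0" "sqrt (\<nu> * \<gamma>) = K" using K \<nu> by (simp_all add: \<gamma>_def)
  have main: "norm (c k t - d k t) * bracket k ^ P \<le> (2 * M / 2 ^ n) * exp (\<gamma> * t)" if "t \<in> {0..T}" for n k t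
    using that
  proof (induction n arbitrary: k t)
    case 0
    have "norm (c k t - d k t) * bracket k ^ P \<le> (norm (c k t) + norm (d k t)) * bracket k ^ P"
      by (intro mult_right_mono norm_triangle_ineq4) simp
    also have "\<dots> \<le> 2 * M * 1" using M[OF 0, of k] by (simp add: distrib_right)
    also have "\<dots> \<le> 2 * M * exp (\<gamma> * t)" by (rule mult_left_mono) (use M0 \<gamma> 0 in auto)
    finally show ?case by simp
  next
    case (Suc n)
    have "norm (c k t - d k t) * bracket k ^ P \<le> (2 * M / 2 ^ n) * exp (\<gamma> * t) * (2 ^ (P + 1) * M * Z / sqrt (\<nu> * \<gamma>))"
      unfolding P_def Z_def
      by (rule driven_contraction[where c=c and d=d and f=c and g=d, OF _ _ eq \<nu> \<gamma>(1) M[unfolded P_def] Suc.IH[unfolded P_def] Suc.prems])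
         (use c d in \<open>auto simp: mode_sol_def\<close>)
    also have "2 ^ (P + 1) * M * Z / sqrt (\<nu> * \<gamma>) = 1 / 2" unfolding \<gamma>(2) K_def using M0 Z by simp
    finally show ?case by simp
  qed
  have "(\<lambda>n. (2 * M / 2 ^ n) * exp (\<gamma> * t)) \<longlonglongrightarrow> 0"
    by (rule tendsto_mult_left_zero[OF LIMSEQ_divide_realpow_zero]) simp
  then have "norm (c k t - d k t) * bracket k ^ P \<le> 0"
    by (rule LIMSEQ_le_const) (use main[OF t] in auto)
  then show ?thesis using bracket_power_pos[of k P] by (auto simp: mult_le_0_iff)
qed

text \<open>Applied to the solution itself, the growth estimate replaces a bound \<open>C\<close> of
  the weighted modes by \<open>Q + C / 2\<close>. Iteration removes the dependence on the unknown
  \<open>C\<close>, which is finite by the definition of a solution.\<close>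

lemma mode_sol_persistence:
  fixes c :: "int^'n \<Rightarrow> real \<Rightarrow> complex^'n"
  assumes \<nu>: "\<nu> > 0" and c: "mode_sol \<nu> T c" and \<alpha>: "\<alpha> > 0"
    and le: "\<And>t. t \<in> {0..T} \<Longrightarrow> (\<Sum>\<^sub>\<infinity>k. norm (c k t)) \<le> \<alpha>"
    and Q: "\<And>k. norm (c k 0) * bracket k ^ p \<le> Q" and t: "t \<in> {0..T}"
  shows "norm (c k t) * bracket k ^ p \<le> 2 * Q * exp ((2 ^ (p + 1) * \<alpha>)\<^sup>2 / \<nu> * t)"
proof -
  define \<gamma> where "\<gamma> = (2 ^ (p + 1) * \<alpha>)\<^sup>2 / \<nu>"
  have \<gamma>: "\<gamma> > 0" "sqrt (\<nu> * \<gamma>) = 2 ^ (p + 1) * \<alpha>" using \<alpha> \<nu> by (simp_all add: \<gamma>_def)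
  obtain C where C: "\<And>k t. t \<in> {0..T} \<Longrightarrow> norm (c k t) * bracket k ^ p \<le> C" using c unfolding mode_sol_def by blast
  have Q0: "0 \<le> Q" using order_trans[OF _ Q[of 0]] by simp
  have C0: "0 \<le> C" using order_trans[OF _ C[OF t, of 0]] by simp
  have e1: "1 \<le> exp (\<gamma> * t)" if "t \<in> {0..T}" for t using \<gamma> that by simp
  have main: "norm (c k t) * bracket k ^ p \<le> (2 * Q + C / 2 ^ n) * exp (\<gamma> * t)" if "t \<in> {0..T}" for n k t
    using that
  proof (induction n arbitrary: k t)
    case 0
    have "norm (c k t) * bracket k ^ p \<le> (2 * Q + C) * 1" using C[OF 0, of k] Q0 by simp
    also have "\<dots> \<le> (2 * Q + C) * exp (\<gamma> * t)" by (rule mult_left_mono[OF e1[OF 0]]) (use Q0 C0 in auto)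
    finally show ?case by simp
  next
    case (Suc n)
    have "norm (c k t) * bracket k ^ p \<le> Q + (2 * Q + C / 2 ^ n) * exp (\<gamma> * t) * (2 ^ p * \<alpha> / sqrt (\<nu> * \<gamma>))"
      by (rule driven_growth[where c=c and f=c, OF _ \<nu> \<gamma>(1) mode_sol_summable[OF c] le Suc.IH Q Suc.prems]) (use c in \<open>auto simp: mode_sol_def\<close>)
    also have "2 ^ p * \<alpha> / sqrt (\<nu> * \<gamma>) = 1 / 2" unfolding \<gamma>(2) using \<alpha> by simp
    also have "Q + (2 * Q + C / 2 ^ n) * exp (\<gamma> * t) * (1 / 2) \<le> (2 * Q + C / 2 ^ Suc n) * exp (\<gamma> * t)"
      using mult_left_mono[OF e1[OF Suc.prems] Q0] by (simp add: algebra_simps)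
    finally show ?case .
  qed
  have "(\<lambda>n. C / 2 ^ n) \<longlonglongrightarrow> 0"
    by (rule LIMSEQ_divide_realpow_zero) simp
  then have "(\<lambda>n. (2 * Q + C / 2 ^ n) * exp (\<gamma> * t)) \<longlonglongrightarrow> (2 * Q + 0) * exp (\<gamma> * t)"
    by (intro tendsto_intros)
  then have "norm (c k t) * bracket k ^ p \<le> (2 * Q + 0) * exp (\<gamma> * t)"
    by (rule LIMSEQ_le_const) (use main[OF t] in auto)
  then show ?thesis by (simp add: \<gamma>_def)
qed

lemma driven_subinterval:
  assumes "driven \<nu> T c f" "S \<le> T"
  shows "driven \<nu> S c f"
  unfolding driven_def
proof (intro allI ballI)
  fix k t assume t: "t \<in> {0..S}"
  then have "t \<in> {0..T}" "{0..S} \<subseteq> {0..T}" using assms(2) by auto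
  moreover from this have "(f k has_vector_derivative - (\<nu> * (norm (freq k))\<^sup>2) *\<^sub>R f k t + nonlin (\<lambda>k. c k t) (\<lambda>k. c k t) k) (at t within {0..T})"
    using assms(1) unfolding driven_def by blast
  ultimately show "(f k has_vector_derivative - (\<nu> * (norm (freq k))\<^sup>2) *\<^sub>R f k t + nonlin (\<lambda>k. c k t) (\<lambda>k. c k t) k) (at t within {0..S})"
    using has_vector_derivative_within_subset by blast
qed

lemma mode_sol_subinterval: "mode_sol \<nu> T c \<Longrightarrow> S \<le> T \<Longrightarrow> mode_sol \<nu> S c"
  unfolding mode_sol_def using driven_subinterval[of \<nu> T c c S] by (meson atLeastAtMost_iff order_trans)

lemma mode_sol_cong:
  assumes "mode_sol \<nu> T c" "\<And>k t. t \<in> {0..T} \<Longrightarrow> d k t = c k t"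
  shows "mode_sol \<nu> T d"
proof -
  have e: "(\<lambda>k. d k t) = (\<lambda>k. c k t)" if "t \<in> {0..T}" for t using assms(2)[OF that] by auto
  have "driven \<nu> T d d"
    unfolding driven_def
  proof (intro allI ballI)
    fix k t assume t: "t \<in> {0..T}"
    have "(c k has_vector_derivative mode_rhs \<nu> (\<lambda>k. c k t) k) (at t within {0..T})"
      using assms(1) t unfolding mode_sol_def driven_def by blast
    then have "(d k has_vector_derivative mode_rhs \<nu> (\<lambda>k. c k t) k) (at t within {0..T})"
      by (rule has_vector_derivative_transform[OF t, rotated]) (use assms(2) in auto)
    then show "(d k has_vector_derivative mode_rhs \<nu> (\<lambda>k. d k t) k) (at t within {0..T})"
      using e[OF t] assms(2)[OF t] by simp
  qed
  moreover have "\<exists>C. \<forall>k. \<forall>t\<in>{0..T}. norm (d k t) * bracket k ^ p \<le> C" for p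
    using assms unfolding mode_sol_def by (metis (mono_tags))
  ultimately show ?thesis using assms(1) e unfolding mode_sol_def by simp
qed

text \<open>At the joint both one-sided derivatives equal the right-hand side at the common value.\<close>

lemma mode_sol_glue:
  fixes c d :: "int^'n \<Rightarrow> real \<Rightarrow> complex^'n"
  assumes c: "mode_sol \<nu> T c" and d: "mode_sol \<nu> S d" and eq: "\<And>k. d k 0 = c k T" and T: "0 \<le> T" "0 \<le> S"
  shows "mode_sol \<nu> (T + S) (\<lambda>k t. if t \<in> {0..T} then c k t else d k (t - T))"
proof -
  define h where "h = (\<lambda>k t. if t \<in> {0..T} then c k t else d k (t - T))"
  have cl: "closure {0..T} \<inter> closure {T..T + S} = {T}" "{0..T} \<union> {T} = {0..T}" "{T..T + S} \<union> {T} = {T..T+S}" using T by auto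
  have "driven \<nu> (T + S) h h"
    unfolding driven_def
  proof (intro allI ballI)
    fix k t assume t: "t \<in> {0..T + S}"
    define N where "N c t = mode_rhs \<nu> (\<lambda>k. c k t) k" for c :: "int^'n \<Rightarrow> real \<Rightarrow> complex^'n" and t
    have "((\<lambda>t. if t \<in> {0..T} then c k t else d k (t - T)) has_vector_derivative
        (if t \<in> {0..T} then N c t else N d (t - T))) (at t within {0..T + S})"
    proof (rule has_vector_derivative_If_within_closures[where S="{0..T}" and T="{T..T + S}"], unfold cl)
      show "t \<in> {0..T} \<union> {T..T + S}" "{0..T + S} = {0..T} \<union> {T..T + S}" using t T by auto
      show "(c k has_vector_derivative N c t) (at t within {0..T})" if "t \<in> {0..T}"
        using c that unfolding mode_sol_def driven_def N_def by blast
      show "((\<lambda>t. d k (t - T)) has_vector_derivative N d (t - T)) (at t within {T..T + S})" if "t \<in> {T..T + S}"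
      proof -
        have "(d k has_vector_derivative N d (t - T)) (at (t - T) within {0..S})"
          using d that unfolding mode_sol_def driven_def N_def by auto
        moreover have "(\<lambda>t. t - T) ` {T..T + S} = {0..S}" by (auto simp: image_iff intro: bexI[of _ "_ + T"])
        ultimately have "((d k \<circ> (\<lambda>t. t - T)) has_vector_derivative (1 *\<^sub>R N d (t - T))) (at t within {T..T + S})"
          by (intro vector_diff_chain_within) (auto intro!: derivative_eq_intros simp: has_vector_derivative_diff_const)
        then show ?thesis by (simp add: o_def)
      qed
      show "c k t = d k (t - T)" if "t \<in> closure {0..T}" "t \<in> closure {T..T + S}"
      proof -
        have "t = T" using that by simp
        then show ?thesis by (simp add: eq)
      qed
      show "N c t = N d (t - T)" if "t \<in> closure {0..T}" "t \<in> closure {T..T + S}"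
      proof -
        have "t = T" using that by simp
        then show ?thesis by (simp add: eq N_def)
      qed
    qed
    moreover have "N h t = (if t \<in> {0..T} then N c t else N d (t - T))"
      by (cases "t \<in> {0..T}") (simp_all only: N_def h_def if_True if_False)
    ultimately show "(h k has_vector_derivative mode_rhs \<nu> (\<lambda>k. h k t) k) (at t within {0..T + S})"
      unfolding N_def by (simp add: h_def)
  qed
  moreover have "\<exists>C. \<forall>k. \<forall>t\<in>{0..T + S}. norm (h k t) * bracket k ^ p \<le> C" for p
  proof -
    obtain C where C: "\<forall>k. \<forall>t\<in>{0..T}. norm (c k t) * bracket k ^ p \<le> C" using c unfolding mode_sol_def by blast
    obtain D where D: "\<forall>k. \<forall>t\<in>{0..S}. norm (d k t) * bracket k ^ p \<le> D" using d unfolding mode_sol_def by blast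
    show ?thesis
    proof (intro exI[of _ "max C D"] allI ballI)
      fix k t assume "t \<in> {0..T + S}"
      then show "norm (h k t) * bracket k ^ p \<le> max C D"
        using C[rule_format, of t k] D[rule_format, of "t - T" k] by (auto simp: h_def max_def)
    qed
  qed
  moreover have "real_modes (\<lambda>k. h k t) \<and> solenoidal (\<lambda>k. h k t)" if "t \<in> {0..T + S}" for t
  proof (cases "t \<in> {0..T}")
    case True
    then have "(\<lambda>k. h k t) = (\<lambda>k. c k t)" by (simp only: h_def if_True)
    then show ?thesis using c True unfolding mode_sol_def by simp
  next
    case False
    then have "(\<lambda>k. h k t) = (\<lambda>k. d k (t - T))" by (simp only: h_def if_False)
    moreover have "t - T \<in> {0..S}" using False that by auto
    ultimately show ?thesis using d unfolding mode_sol_def by simp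
  qed
  ultimately show ?thesis unfolding mode_sol_def h_def by blast
qed

section \<open>The differential inequality for the Wiener norm\<close>

text \<open>The Wiener seminorm at time \<open>t\<close>, in terms of the modes.\<close>

definition amplitude :: "(int^'n \<Rightarrow> real \<Rightarrow> complex^'n) \<Rightarrow> real \<Rightarrow> real" where
  "amplitude c t = (\<Sum>\<^sub>\<infinity>k\<in>UNIV - {0}. norm (c k t))"

text \<open>The equation \<open>B' = B\<^sup>3 / (4 \<nu>)\<close> is linear in the variable
  \<open>1 / B\<^sup>2\<close>, whose derivative is then \<open>- 1 / (2 \<nu>)\<close>.\<close>

lemma bernoulli_comparison:
  fixes B :: "real \<Rightarrow> real"
  assumes B: "\<And>s. s \<in> {0..T} \<Longrightarrow> (B has_vector_derivative B' s) (at s within {0..T})"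
    and le: "\<And>s. s \<in> {0..T} \<Longrightarrow> B' s \<le> (B s) ^ 3 / (4 * \<nu>)" and pos: "\<And>s. s \<in> {0..T} \<Longrightarrow> 0 < B s"
    and \<nu>: "\<nu> > 0" and t: "t \<in> {0..T}"
  shows "1 / (B 0)\<^sup>2 - t / (2 * \<nu>) \<le> 1 / (B t)\<^sup>2"
proof (cases "t = 0")
  case False
  define w where "w s = - (1 / (B s)\<^sup>2) - s / (2 * \<nu>)" for s
  have "w t \<le> w 0"
  proof (rule DERIV_nonpos_imp_decreasing_open[where f=w])
    show "0 \<le> t" using t by simp
    have "continuous_on {0..T} B"
      using B by (meson continuous_on_eq_continuous_within has_vector_derivative_continuous)
    then have "continuous_on {0..t} B" by (rule continuous_on_subset) (use t in auto)
    then show "continuous_on {0..t} w" unfolding w_def using pos t \<nu> by (intro continuous_intros) (auto simp: less_imp_neq[THEN not_sym])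
    fix s assume s: "0 < s" "s < t"
    have Bs: "0 < B s" using pos s t by simp
    have "(B has_real_derivative B' s) (at s)"
      using B[of s] s t by (simp add: at_within_Icc_at has_real_derivative_iff_has_vector_derivative)
    then have "((\<lambda>s. (B s)\<^sup>2) has_real_derivative 2 * B s * B' s) (at s)"
      by (auto intro!: derivative_eq_intros)
    then have "((\<lambda>s. inverse ((B s)\<^sup>2)) has_real_derivative - (inverse ((B s)\<^sup>2) * (2 * B s * B' s) * inverse ((B s)\<^sup>2))) (at s)"
      by (rule DERIV_inverse') (use Bs in auto)
    then have "((\<lambda>s. - inverse ((B s)\<^sup>2) - s / (2 * \<nu>)) has_real_derivative
        - (- (inverse ((B s)\<^sup>2) * (2 * B s * B' s) * inverse ((B s)\<^sup>2))) - 1 / (2 * \<nu>)) (at s)"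
      by (intro DERIV_diff DERIV_minus DERIV_cdivide DERIV_ident)
    moreover have "- (- (inverse ((B s)\<^sup>2) * (2 * B s * B' s) * inverse ((B s)\<^sup>2))) = 2 * B' s / (B s) ^ 3"
      using Bs by (simp add: power2_eq_square power3_eq_cube divide_inverse)
    ultimately have "(w has_real_derivative (2 * B' s / (B s) ^ 3 - 1 / (2 * \<nu>))) (at s)"
      by (simp add: w_def[abs_def] inverse_eq_divide)
    moreover have "2 * B' s / (B s) ^ 3 - 1 / (2 * \<nu>) \<le> 0"
      using le[of s] s t Bs \<nu> by (simp add: field_simps)
    ultimately show "\<exists>y. (w has_real_derivative y) (at s) \<and> y \<le> 0" by blast
  qed
  then show ?thesis by (simp add: w_def)
qed simp

text \<open>With the integrating factor \<open>exp (- \<integral>q)\<close> the function becomes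
  nonincreasing.\<close>

lemma gronwall_nonpos:
  fixes z :: "real \<Rightarrow> real"
  assumes z: "\<And>s. s \<in> {0..T} \<Longrightarrow> (z has_vector_derivative z' s) (at s within {0..T})"
    and le: "\<And>s. s \<in> {0..T} \<Longrightarrow> z' s \<le> q s * z s" and q: "continuous_on {0..T} q"
    and 0: "z 0 \<le> 0" and t: "t \<in> {0..T}"
  shows "z t \<le> 0"
proof (cases "t = 0")
  case False
  define E where "E s = integral {0..s} q" for s
  define y where "y s = z s * exp (- E s)" for s
  have E': "(E has_vector_derivative q s) (at s within {0..T})" if "s \<in> {0..T}" for s
    unfolding E_def by (rule integral_has_vector_derivative[OF q that])
  have cont: "continuous_on {0..t} f" if "\<And>s. s \<in> {0..T} \<Longrightarrow> (f has_vector_derivative f' s) (at s within {0..T})" for f f' :: "real \<Rightarrow> real"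
  proof -
    have "continuous_on {0..T} f"
      using that by (meson continuous_on_eq_continuous_within has_vector_derivative_continuous)
    then show ?thesis by (rule continuous_on_subset) (use t in auto)
  qed
  have "y t \<le> y 0"
  proof (rule DERIV_nonpos_imp_decreasing_open[where f=y])
    show "0 \<le> t" using t by simp
    show "continuous_on {0..t} y" unfolding y_def by (intro continuous_intros cont[OF z] cont[OF E'])
    fix s assume s: "0 < s" "s < t"
    have d: "(z has_real_derivative z' s) (at s)" "(E has_real_derivative q s) (at s)"
      using z[of s] E'[of s] s t by (simp_all add: at_within_Icc_at has_real_derivative_iff_has_vector_derivative)
    have "(y has_real_derivative ((z' s - q s * z s) * exp (- E s))) (at s)"
      unfolding y_def by (auto intro!: derivative_eq_intros d simp: algebra_simps)
    moreover have "(z' s - q s * z s) * exp (- E s) \<le> 0" using le[of s] s t by (intro mult_nonpos_nonneg) auto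
    ultimately show "\<exists>y'. (y has_real_derivative y') (at s) \<and> y' \<le> 0" by blast
  qed
  also have "y 0 \<le> 0" using 0 by (simp add: y_def E_def)
  finally show ?thesis by (simp add: y_def mult_le_0_iff)
qed (use 0 in auto)

text \<open>Both terms of the equation carry a factor \<open>k\<close>, which vanishes at the zero
  mode.\<close>

lemma mean_constant:
  fixes c :: "int^'n \<Rightarrow> real \<Rightarrow> complex^'n"
  assumes c: "mode_sol \<nu> T c" and t: "t \<in> {0..T}"
  shows "c 0 t = c 0 0"
proof -
  have "c 0 t - c 0 0 = 0"
  proof (rule linear_ode_unique[where f="\<lambda>t. c 0 t - c 0 0" and \<mu>=0 and T=T])
    fix s assume s: "s \<in> {0..T}"
    have "(c 0 has_vector_derivative - (\<nu> * (norm (freq (0::int^'n)))\<^sup>2) *\<^sub>R c 0 s + nonlin (\<lambda>k. c k s) (\<lambda>k. c k s) 0) (at s within {0..T})"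
      using c s unfolding mode_sol_def driven_def by blast
    then have "(c 0 has_vector_derivative 0) (at s within {0..T})" by simp
    then show "((\<lambda>s. c 0 s - c 0 0) has_vector_derivative - 0 *\<^sub>R (c 0 s - c 0 0)) (at s within {0..T})"
      by (auto intro!: derivative_eq_intros)
  qed (use t in auto)
  then show ?thesis by simp
qed

lemma real_modes_mean:
  assumes "real_modes a"
  shows "cdot k (a 0) = complex_of_real (Re (cdot k (a 0)))"
proof -
  have "a 0 = vcnj (a 0)" using assms unfolding real_modes_def by (metis minus_zero)
  then have "cnj (a 0 $ j) = a 0 $ j" for j by (metis vcnj_def vec_lambda_beta)
  then have "cnj (cdot k (a 0)) = cdot k (a 0)" by (simp add: cdot_def)
  then show ?thesis by (simp add: complex_eq_iff)
qed

text \<open>Interactions with the mean only rotate the phase of a mode; in all others the factor \<open>k\<close>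
  may be replaced by the frequency \<open>l\<close> of the transported mode because of incompressibility.\<close>

lemma nonlin_split:
  fixes a :: "int^'n \<Rightarrow> complex^'n"
  assumes r: "real_modes a" and s: "solenoidal a" and sm: "(\<lambda>k. norm (a k)) summable_on UNIV"
    and sm1: "(\<lambda>k. norm (freq k) * norm (a k)) summable_on UNIV" and k: "k \<noteq> 0"
  shows "norm (nonlin a a k + (\<i> * Re (cdot k (a 0))) *s a k)
    \<le> conv (\<lambda>k. if k = 0 then 0 else norm (a k)) (\<lambda>k. norm (freq k) * norm (a k)) k"
proof -
  define x where "x l = interaction k (a (k - l)) (a l)" for l
  define y where "y l = (if k - l = 0 then 0 else norm (a (k - l))) * (norm (freq l) * norm (a l))" for l
  have sx: "x summable_on A" for A
    unfolding x_def by (rule summable_on_subset_banach[OF nonlin_summable(2)[OF sm sm order.refl order.refl]]) simp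
  have sm0: "(\<lambda>k. if k = 0 then 0 else norm (a k)) summable_on UNIV"
    by (rule summable_on_comparison_test[OF sm]) auto
  have sy: "y summable_on UNIV"
    unfolding y_def
    by (rule conv_summable[OF _ _ sm0 sm1]) auto
  have y0: "0 \<le> y l" for l by (simp add: y_def)
  have kk: "leray_symbol k *v a k = a k"
    using s k by (simp add: leray_symbol_mult solenoidal_def)
  have x0: "x 0 = 0" using s by (simp add: x_def interaction_def solenoidal_def bounded_bilinear.zero_left[OF bounded_bilinear_smult])
  have xk: "x k = - ((\<i> * Re (cdot k (a 0))) *s a k)"
  proof -
    have "x k = - (leray_symbol k *v ((\<i> * cdot k (a 0)) *s a k))" by (simp add: x_def interaction_def)
    also have "\<dots> = - ((\<i> * cdot k (a 0)) *s (leray_symbol k *v a k))" by (simp only: vector_scalar_commute)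
    finally show ?thesis unfolding kk by (subst (asm) real_modes_mean[OF r]) simp
  qed
  have U: "(UNIV - {0, k}) \<union> {0, k} = UNIV" by auto
  have "nonlin a a k = infsum x UNIV" by (simp only: nonlin_def x_def[abs_def])
  also have "\<dots> = infsum x (UNIV - {0, k}) + sum x {0, k}"
    using infsum_Un_disjoint[OF sx[of "UNIV - {0, k}"] sx[of "{0, k}"]] unfolding U by simp
  finally have "nonlin a a k = infsum x (UNIV - {0, k}) + sum x {0, k}" .
  then have "nonlin a a k + (\<i> * Re (cdot k (a 0))) *s a k = infsum x (UNIV - {0, k})"
    using k x0 xk by simp
  also have "norm \<dots> \<le> infsum y (UNIV - {0, k})"
  proof (rule norm_infsum_le_infsum)
    fix l assume l: "l \<in> UNIV - {0, k}"
    have "cdot (k - l) (a (k - l)) = 0" using s unfolding solenoidal_def by blast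
    then have "cdot k (a (k - l)) = cdot l (a (k - l))"
      by (simp add: cdot_def algebra_simps sum_subtractf)
    then have "norm (x l) \<le> norm (cdot l (a (k - l))) * norm (a l)"
      using norm_leray_symbol[of k "(\<i> * cdot k (a (k - l))) *s a l"]
      by (simp add: x_def interaction_def norm_vector_smult norm_mult)
    also have "\<dots> \<le> norm (freq l) * norm (a (k - l)) * norm (a l)" by (intro mult_right_mono norm_cdot) auto
    also have "\<dots> = y l" using l by (auto simp: y_def)
    finally show "norm (x l) \<le> y l" .
  qed (rule summable_on_subset_banach[OF sy], simp)
  also have "\<dots> \<le> infsum y UNIV"
    by (rule infsum_mono_neutral[OF summable_on_subset_banach[OF sy] sy]) (use y0 in auto)
  finally show ?thesis by (simp only: conv_def y_def[abs_def])
qed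

text \<open>The moduli of the modes need not be differentiable where they vanish. They are replaced
  by majorants \<open>b\<^sub>k\<close> that solve linear scalar equations with the convolution of
  the moduli as forcing. The functions in the conclusion are the moments
  \<open>B = \<Sum> b\<^sub>k\<close>, \<open>B1 = \<Sum> \<bar>k\<bar> b\<^sub>k\<close>,
  \<open>B2 = \<Sum> \<bar>k\<bar>\<^sup>2 b\<^sub>k\<close> and the derivative \<open>D\<close> of
  \<open>B\<close>. The inequality with the cubic term completes the square in
  \<open>\<bar>k\<bar>\<close>.\<close>

lemma amplitude_majorant:
  fixes c :: "int^'n \<Rightarrow> real \<Rightarrow> complex^'n"
  assumes \<nu>: "\<nu> > 0" and c: "mode_sol \<nu> T c" and T: "0 \<le> T"
  shows "\<exists>B B1 B2 D. (\<forall>t\<in>{0..T}. (B has_vector_derivative D t) (at t within {0..T}) \<and>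
      amplitude c t \<le> B t \<and> B1 t \<le> B2 t \<and> 0 \<le> B1 t \<and> D t \<le> B t * B1 t - \<nu> * B2 t \<and>
      B t * B1 t \<le> \<nu> * B2 t + (B t) ^ 3 / (4 * \<nu>) \<and> (amplitude c 0 > 0 \<longrightarrow> B t > 0)) \<and>
      B 0 = amplitude c 0 \<and> continuous_on {0..T} B1"
proof -
  define P where "P = 2 * CARD('n)"
  define a0 where "a0 t k = (if k = 0 then 0 else norm (c k t))" for t k
  define a1 where "a1 t k = norm (freq k) * norm (c k t)" for t k
  define g where "g k t = (if k = 0 then 0 else conv (a0 t) (a1 t) k)" for k t
  have pos: "0 \<le> a0 t k" "0 \<le> a1 t k" for t k by (simp_all add: a0_def a1_def)
  have dec: "\<exists>C. \<forall>k. \<forall>t\<in>{0..T}. norm (c k t) * bracket k ^ p \<le> C" for p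
    using c unfolding mode_sol_def by blast
  have dec0: "\<exists>C. \<forall>k. \<forall>t\<in>{0..T}. a0 t k * bracket k ^ p \<le> C" for p
  proof -
    obtain C where C: "\<And>k t. t \<in> {0..T} \<Longrightarrow> norm (c k t) * bracket k ^ p \<le> C" using dec[of p] by blast
    have "0 \<le> C" using order_trans[OF _ C[of 0 0]] T by simp
    then show ?thesis using C by (intro exI[of _ C]) (auto simp: a0_def)
  qed
  have dec1: "\<exists>C. \<forall>k. \<forall>t\<in>{0..T}. a1 t k * bracket k ^ p \<le> C" for p
  proof -
    obtain C where C: "\<And>k t. t \<in> {0..T} \<Longrightarrow> norm (c k t) * bracket k ^ Suc p \<le> C" using dec[of "Suc p"] by blast
    have "a1 t k * bracket k ^ p \<le> C" if "t \<in> {0..T}" for k t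
    proof -
      have "a1 t k * bracket k ^ p \<le> bracket k * norm (c k t) * bracket k ^ p"
        unfolding a1_def by (intro mult_right_mono freq_le_bracket) auto
      also have "\<dots> = norm (c k t) * bracket k ^ Suc p" by simp
      also have "\<dots> \<le> C" by (rule C[OF that])
      finally show ?thesis .
    qed
    then show ?thesis by blast
  qed
  obtain C0 where C0: "\<And>k t. t \<in> {0..T} \<Longrightarrow> a0 t k * bracket k ^ P \<le> C0" using dec0[of P] by blast
  obtain C1 where C1: "\<And>k t. t \<in> {0..T} \<Longrightarrow> a1 t k * bracket k ^ P \<le> C1" using dec1[of P] by blast
  have s0: "a0 t summable_on UNIV" "infsum (a0 t) UNIV \<le> C0 * lattice_sum TYPE('n)" if "t \<in> {0..T}" for t
    using decay_summable[of "a0 t" C0] C0[OF that] pos by (simp_all add: P_def)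
  have s1: "a1 t summable_on UNIV" "infsum (a1 t) UNIV \<le> C1 * lattice_sum TYPE('n)" if "t \<in> {0..T}" for t
    using decay_summable[of "a1 t" C1] C1[OF that] pos by (simp_all add: P_def)
  have decg: "\<exists>C\<ge>0. \<forall>k. \<forall>t\<in>{0..T}. g k t * bracket k ^ p \<le> C" for p
  proof -
    obtain E0 where E0: "\<And>k t. t \<in> {0..T} \<Longrightarrow> a0 t k * bracket k ^ p \<le> E0" using dec0[of p] by blast
    obtain E1 where E1: "\<And>k t. t \<in> {0..T} \<Longrightarrow> a1 t k * bracket k ^ p \<le> E1" using dec1[of p] by blast
    define C where "C = 2 ^ p * (E0 * (C1 * lattice_sum TYPE('n)) + C0 * lattice_sum TYPE('n) * E1)"
    have "g k t * bracket k ^ p \<le> max 0 C" if t: "t \<in> {0..T}" for k t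
      using conv_bounds(3)[OF pos(1) pos(2) s0(1)[OF t] s1(1)[OF t] s0(2)[OF t] s1(2)[OF t] E0[OF t] E1[OF t], of k]
      by (auto simp: g_def C_def)
    then show ?thesis by (intro exI[of _ "max 0 C"]) auto
  qed
  have g0: "0 \<le> g k t" for k t
    by (simp add: g_def conv_def infsum_nonneg pos)
  have cc: "continuous_on {0..T} (c k)" for k
    using c driven_continuous unfolding mode_sol_def by blast
  have gcont: "continuous_on {0..T} (g k)" for k
  proof (cases "k = 0")
    case False
    have "continuous_on {0..T} (\<lambda>t. \<Sum>\<^sub>\<infinity>l. a0 t (k - l) * a1 t l)"
    proof (rule continuous_on_infsum[where M="\<lambda>l. C0 * (C1 * (1 / bracket l ^ P))"])
      show "continuous_on {0..T} (\<lambda>t. a0 t (k - l) * a1 t l)" for l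
        unfolding a0_def a1_def by (cases "k - l = 0") (auto intro!: continuous_intros cc)
      show "(\<lambda>l::int^'n. C0 * (C1 * (1 / bracket l ^ P))) summable_on UNIV"
        unfolding P_def by (intro summable_on_cmult_right summable_bracket)
      fix l t assume t: "t \<in> {0..T}"
      have "a0 t m * 1 \<le> a0 t m * bracket m ^ P" for m by (rule mult_left_mono) (auto simp: pos)
      then have a0C: "a0 t m \<le> C0" for m using C0[OF t, of m] by (metis mult.right_neutral order_trans)
      have C00: "0 \<le> C0" by (rule order_trans[OF pos(1) a0C])
      have "a1 t l \<le> C1 * (1 / bracket l ^ P)" using C1[OF t, of l] by (simp add: pos_le_divide_eq)
      then have "a0 t (k - l) * a1 t l \<le> C0 * (C1 * (1 / bracket l ^ P))"
        by (intro mult_mono a0C C00 pos)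
      then show "norm (a0 t (k - l) * a1 t l) \<le> C0 * (C1 * (1 / bracket l ^ P))" using pos by simp
    qed
    then show ?thesis using False by (simp add: g_def conv_def)
  qed (simp add: g_def)
  have "\<exists>b. b 0 = a0 0 k \<and> (\<forall>t\<in>{0..T}. (b has_vector_derivative (- (\<nu> * (norm (freq k))\<^sup>2) *\<^sub>R b t + g k t)) (at t within {0..T}))" for k
    by (rule linear_ode_exists[OF gcont])
  then obtain b where b0: "\<And>k. b k 0 = a0 0 k" and b': "\<And>k t. t \<in> {0..T} \<Longrightarrow>
      (b k has_vector_derivative (- (\<nu> * (norm (freq k))\<^sup>2) *\<^sub>R b k t + g k t)) (at t within {0..T})"
    by metis
  have bcont: "continuous_on {0..T} (b k)" for k
    using b' by (meson continuous_on_eq_continuous_within has_vector_derivative_continuous)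
  have bzero: "b 0 t = 0" if "t \<in> {0..T}" for t
    by (rule linear_ode_unique[where \<mu>=0 and T=T]) (use b'[of _ 0] b0[of 0] that in \<open>auto simp: g_def a0_def\<close>)
  have ab: "a0 t k \<le> b k t" if t: "t \<in> {0..T}" for t k
  proof (cases "k = 0")
    case True then show ?thesis using bzero[OF t] by (simp add: a0_def)
  next
    case False
    \<comment> \<open>In the frame that moves with the mean flow the rotating term disappears.\<close>
    define \<theta> where "\<theta> = Re (cdot k (c 0 0))"
    define d where "d t = cis (\<theta> * t) *s c k t" for t
    define G where "G t = cis (\<theta> * t) *s (nonlin (\<lambda>k. c k t) (\<lambda>k. c k t) k + (\<i> * \<theta>) *s c k t)" for t
    have "norm (d t) \<le> b k t"
    proof (rule duhamel_compare[OF _ b' _ _ t])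
      fix s assume s: "s \<in> {0..T}"
      have ck: "(c k has_vector_derivative mode_rhs \<nu> (\<lambda>k. c k s) k) (at s within {0..T})"
        using c s unfolding mode_sol_def driven_def by blast
      have ce: "((\<lambda>t. cis (\<theta> * t)) has_vector_derivative (\<theta> *\<^sub>R (\<i> * cis (\<theta> * s)))) (at s within {0..T})"
      proof -
        have "((\<lambda>z. exp (\<i> * (of_real \<theta> * z))) has_field_derivative exp (\<i> * (of_real \<theta> * of_real s)) * (\<i> * of_real \<theta>)) (at (of_real s))"
          by (auto intro!: derivative_eq_intros)
        from has_vector_derivative_real_field[OF this, of "{0..T}"] show ?thesis
          by (simp add: cis_conv_exp scaleR_conv_of_real mult.assoc mult.commute mult.left_commute)
      qed
      have "(d has_vector_derivative (cis (\<theta> * s) *s (mode_rhs \<nu> (\<lambda>k. c k s) k)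
          + (\<theta> *\<^sub>R (\<i> * cis (\<theta> * s))) *s c k s)) (at s within {0..T})"
        unfolding d_def by (rule bounded_bilinear.has_vector_derivative[OF bounded_bilinear_smult ce ck])
      also have "(cis (\<theta> * s) *s (mode_rhs \<nu> (\<lambda>k. c k s) k)
          + (\<theta> *\<^sub>R (\<i> * cis (\<theta> * s))) *s c k s) = - (\<nu> * (norm (freq k))\<^sup>2) *\<^sub>R d s + G s"
        unfolding d_def G_def by (simp add: vec_eq_iff scaleR_conv_of_real algebra_simps)
      finally show "(d has_vector_derivative - (\<nu> * (norm (freq k))\<^sup>2) *\<^sub>R d s + G s) (at s within {0..T})" .
      have th: "\<theta> = Re (cdot k (c 0 s))" unfolding \<theta>_def using mean_constant[OF c s] by simp
      have "norm (G s) = norm (nonlin (\<lambda>k. c k s) (\<lambda>k. c k s) k + (\<i> * \<theta>) *s c k s)"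
        by (simp only: G_def norm_vector_smult norm_cis mult_1_left)
      also have "\<dots> \<le> conv (a0 s) (a1 s) k"
        unfolding th a0_def[abs_def] a1_def[abs_def]
        by (rule nonlin_split[OF _ _ mode_sol_summable[OF c s] _ False]) (use c s s1(1)[OF s] in \<open>auto simp: mode_sol_def a1_def[abs_def]\<close>)
      finally show "norm (G s) \<le> g k s" using False by (simp add: g_def)
    next
      show "norm (d 0) \<le> b k 0" using False by (simp add: b0 d_def a0_def norm_vector_smult)
    qed
    then show ?thesis using False by (simp add: a0_def d_def norm_vector_smult)
  qed
  have bpos: "0 \<le> b k t" if "t \<in> {0..T}" for k t using order_trans[OF pos(1) ab[OF that]] .
  have decb: "\<exists>C\<ge>0. \<forall>k. \<forall>t\<in>{0..T}. b k t * bracket k ^ p \<le> C" for p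
  proof -
    obtain E0 where E0: "\<And>k t. t \<in> {0..T} \<Longrightarrow> a0 t k * bracket k ^ p \<le> E0" using dec0[of p] by blast
    obtain G where G: "G \<ge> 0" "\<And>k t. t \<in> {0..T} \<Longrightarrow> g k t * bracket k ^ p \<le> G" using decg[of p] by blast
    have "b k t * bracket k ^ p \<le> max 0 (E0 + G * exp (1 * T) / (2 * sqrt (\<nu> * 1)))" if t: "t \<in> {0..T}" for k t
    proof (cases "k = 0")
      case True then show ?thesis using bzero[OF t] by simp
    next
      case False
      have "norm (b k t) * bracket k ^ p \<le> norm (b k 0) * bracket k ^ p + G * exp (1 * t) / (2 * sqrt (\<nu> * 1))"
      proof (rule duhamel_bound_freq[OF b' _ \<nu> _ _ _ G(1) t])
        fix s assume s: "s \<in> {0..T}"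
        have "1 * 1 \<le> norm (freq k) * exp (1 * s)" by (rule mult_mono[OF norm_freq_ge_1[OF False]]) (use s in auto)
        then have "G * 1 \<le> G * (norm (freq k) * exp (1 * s))" by (intro mult_left_mono G) simp
        then show "norm (g k s) * bracket k ^ p \<le> norm (freq k) * (G * exp (1 * s))"
          using G(2)[OF s, of k] g0[of k s] by (simp add: algebra_simps)
      qed auto
      also have "\<dots> \<le> E0 + G * exp (1 * T) / (2 * sqrt (\<nu> * 1))"
        using E0[of 0 k] t \<nu> G(1) pos(1)[of 0 k] by (intro add_mono divide_right_mono mult_left_mono) (auto simp: b0)
      finally show ?thesis using bpos[OF t, of k] by simp
    qed
    then show ?thesis by (intro exI[of _ "max 0 (E0 + G * exp (1 * T) / (2 * sqrt (\<nu> * 1)))"]) auto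
  qed
  have decbp: "\<exists>C\<ge>0. \<forall>k. \<forall>t\<in>{0..T}. norm (freq k) ^ m * b k t \<le> C * (1 / bracket k ^ P)" for m
  proof -
    obtain C where C: "C \<ge> 0" "\<And>k t. t \<in> {0..T} \<Longrightarrow> b k t * bracket k ^ (P + m) \<le> C" using decb[of "P + m"] by blast
    have "norm (freq k) ^ m * b k t \<le> C * (1 / bracket k ^ P)" if t: "t \<in> {0..T}" for k t
    proof -
      have "norm (freq k) ^ m * b k t * bracket k ^ P \<le> bracket k ^ m * b k t * bracket k ^ P"
        by (intro mult_right_mono power_mono freq_le_bracket bpos[OF t]) auto
      also have "\<dots> \<le> C" using C(2)[OF t, of k] by (simp add: power_add algebra_simps)
      finally show ?thesis by (simp add: pos_le_divide_eq)
    qed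
    then show ?thesis using C(1) by blast
  qed
  have Ps: "(\<lambda>k::int^'n. C * (1 / bracket k ^ P)) summable_on UNIV" for C
    unfolding P_def by (intro summable_on_cmult_right summable_bracket)
  define Bm where "Bm m t = (\<Sum>\<^sub>\<infinity>k. norm (freq k) ^ m * b k t)" for m t
  have sB: "(\<lambda>k. norm (freq k) ^ m * b k t) summable_on UNIV" if t: "t \<in> {0..T}" for m t
  proof -
    obtain C where C: "\<And>k t. t \<in> {0..T} \<Longrightarrow> norm (freq k) ^ m * b k t \<le> C * (1 / bracket k ^ P)" using decbp[of m] by blast
    show ?thesis by (rule summable_on_comparison_test[OF Ps C[OF t]]) (use bpos[OF t] in auto)
  qed
  have Bcont: "continuous_on {0..T} (Bm 1)"
  proof -
    obtain C where C: "\<And>k t. t \<in> {0..T} \<Longrightarrow> norm (freq k) ^ 1 * b k t \<le> C * (1 / bracket k ^ P)" using decbp[of 1] by blast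
    show ?thesis unfolding Bm_def
      by (rule continuous_on_infsum[OF _ _ Ps, of _ _ C]) (use C bpos in \<open>auto intro!: continuous_intros bcont\<close>)
  qed
  define D where "D t = (\<Sum>\<^sub>\<infinity>k. - (\<nu> * (norm (freq k))\<^sup>2) *\<^sub>R b k t + g k t)" for t
  obtain C2 where C2: "\<And>k t. t \<in> {0..T} \<Longrightarrow> norm (freq k) ^ 2 * b k t \<le> C2 * (1 / bracket k ^ P)" using decbp[of 2] by blast
  obtain Cg where "\<And>k t. t \<in> {0..T} \<Longrightarrow> g k t * bracket k ^ P \<le> Cg" using decg[of P] by blast
  then have Cg: "\<And>k t. t \<in> {0..T} \<Longrightarrow> g k t \<le> Cg * (1 / bracket k ^ P)" by (simp add: pos_le_divide_eq)
  have B': "(Bm 0 has_vector_derivative D t) (at t within {0..T})" if t: "t \<in> {0..T}" for t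
  proof -
    have "((\<lambda>t. \<Sum>\<^sub>\<infinity>k. b k t) has_vector_derivative D t) (at t within {0..T})"
      unfolding D_def
    proof (rule has_vector_derivative_infsum[OF _ t b' _ Ps])
      show "convex {0..T}" by simp
      fix k s assume s: "s \<in> {0..T}"
      have "norm (- (\<nu> * (norm (freq k))\<^sup>2) *\<^sub>R b k s + g k s) \<le> norm (- (\<nu> * (norm (freq k))\<^sup>2) *\<^sub>R b k s) + norm (g k s)"
        by (rule norm_triangle_ineq)
      also have "\<dots> = \<nu> * (norm (freq k) ^ 2 * b k s) + g k s" using \<nu> bpos[OF s] g0 by (simp add: abs_mult)
      also have "\<dots> \<le> \<nu> * (C2 * (1 / bracket k ^ P)) + Cg * (1 / bracket k ^ P)"
        by (intro add_mono mult_left_mono C2 Cg s) (use \<nu> in auto)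
      finally show "norm (- (\<nu> * (norm (freq k))\<^sup>2) *\<^sub>R b k s + g k s) \<le> (\<nu> * C2 + Cg) * (1 / bracket k ^ P)"
        by (simp only: distrib_right mult.assoc)
    next
      fix s assume "s \<in> {0..T}" then show "(\<lambda>k. b k s) summable_on UNIV" using sB[of s 0] by simp
    qed
    then show ?thesis by (simp add: Bm_def[abs_def])
  qed
  have amp: "amplitude c t = infsum (a0 t) UNIV" for t
    unfolding amplitude_def by (rule infsum_cong_neutral) (auto simp: a0_def)
  have A0B: "infsum (a0 t) UNIV \<le> Bm 0 t" if t: "t \<in> {0..T}" for t
    unfolding Bm_def by (rule infsum_mono[OF s0(1)[OF t] sB[OF t]]) (simp add: ab[OF t])
  have A1B: "infsum (a1 t) UNIV \<le> Bm 1 t" if t: "t \<in> {0..T}" for t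
    unfolding Bm_def
  proof (rule infsum_mono[OF s1(1)[OF t] sB[OF t]])
    show "a1 t k \<le> norm (freq k) ^ 1 * b k t" for k
      using mult_left_mono[OF ab[OF t, of k] norm_ge_zero[of "freq k"]] by (auto simp: a0_def a1_def split: if_splits)
  qed
  have sg: "g k t \<le> conv (a0 t) (a1 t) k" for k t
    by (simp add: g_def conv_def infsum_nonneg pos)
  have D: "D t \<le> Bm 0 t * Bm 1 t - \<nu> * Bm 2 t" if t: "t \<in> {0..T}" for t
  proof -
    have sgt: "(\<lambda>k. g k t) summable_on UNIV" by (rule summable_on_comparison_test[OF Ps Cg[OF t]]) (use g0 in auto)
    have sb2: "(\<lambda>k. - \<nu> * (norm (freq k) ^ 2 * b k t)) summable_on UNIV" by (rule summable_on_cmult_right[OF sB[OF t]])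
    have "D t = (\<Sum>\<^sub>\<infinity>k. - \<nu> * (norm (freq k) ^ 2 * b k t) + g k t)" unfolding D_def by (simp add: mult.assoc)
    also have "\<dots> = - \<nu> * Bm 2 t + (\<Sum>\<^sub>\<infinity>k. g k t)"
      unfolding Bm_def infsum_add[OF sb2 sgt] infsum_cmult_right' ..
    also have "(\<Sum>\<^sub>\<infinity>k. g k t) \<le> infsum (conv (a0 t) (a1 t)) UNIV"
      by (rule infsum_mono[OF sgt infsum_conv_le(1)[OF pos s0(1)[OF t] s1(1)[OF t]] sg])
    also have "\<dots> \<le> infsum (a0 t) UNIV * infsum (a1 t) UNIV"
      by (rule infsum_conv_le(2)[OF pos s0(1)[OF t] s1(1)[OF t]])
    also have "\<dots> \<le> Bm 0 t * Bm 1 t"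
      by (intro mult_mono A0B A1B t infsum_nonneg pos) (use order_trans[OF infsum_nonneg A0B[OF t]] pos in auto)
    finally show ?thesis by simp
  qed
  have B12: "Bm 1 t \<le> Bm 2 t" if t: "t \<in> {0..T}" for t
    unfolding Bm_def
  proof (rule infsum_mono[OF sB[OF t] sB[OF t]])
    show "norm (freq k) ^ 1 * b k t \<le> norm (freq k) ^ 2 * b k t" for k
    proof (cases "k = 0")
      case False
      have "norm (freq k) ^ 1 \<le> norm (freq k) ^ 2" by (rule power_increasing[OF _ norm_freq_ge_1[OF False]]) simp
      then show ?thesis by (rule mult_right_mono[OF _ bpos[OF t]])
    qed simp
  qed
  have Young: "Bm 0 t * Bm 1 t \<le> \<nu> * Bm 2 t + (Bm 0 t) ^ 3 / (4 * \<nu>)" if t: "t \<in> {0..T}" for t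
  proof -
    define y where "y = Bm 0 t"
    have tw: "y * (norm (freq k) ^ 1 * b k t) \<le> \<nu> * (norm (freq k) ^ 2 * b k t) + y\<^sup>2 / (4 * \<nu>) * (norm (freq k) ^ 0 * b k t)" for k
    proof -
      have "0 \<le> \<nu> * (norm (freq k) - y / (2 * \<nu>))\<^sup>2" using \<nu> by simp
      also have "\<dots> = \<nu> * norm (freq k) ^ 2 + y\<^sup>2 / (4 * \<nu>) - y * norm (freq k)"
        using \<nu> by (simp add: power2_eq_square field_simps)
      finally have "y * norm (freq k) \<le> \<nu> * norm (freq k) ^ 2 + y\<^sup>2 / (4 * \<nu>)" by simp
      then have "y * norm (freq k) * b k t \<le> (\<nu> * norm (freq k) ^ 2 + y\<^sup>2 / (4 * \<nu>)) * b k t"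
        by (rule mult_right_mono[OF _ bpos[OF t]])
      then show ?thesis by (simp add: algebra_simps)
    qed
    have "y * Bm 1 t \<le> (\<Sum>\<^sub>\<infinity>k. \<nu> * (norm (freq k) ^ 2 * b k t) + y\<^sup>2 / (4 * \<nu>) * (norm (freq k) ^ 0 * b k t))"
      unfolding Bm_def infsum_cmult_right'[symmetric]
      by (rule infsum_mono[OF _ _ tw]) (intro summable_on_add summable_on_cmult_right sB[OF t])+
    also have "\<dots> = \<nu> * Bm 2 t + y\<^sup>2 / (4 * \<nu>) * Bm 0 t"
      unfolding Bm_def infsum_cmult_right'[symmetric]
      by (rule infsum_add; intro summable_on_cmult_right sB[OF t])
    also have "y\<^sup>2 / (4 * \<nu>) * Bm 0 t = y ^ 3 / (4 * \<nu>)" by (simp add: y_def power2_eq_square power3_eq_cube)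
    finally show ?thesis by (simp add: y_def)
  qed
  \<comment> \<open>Since the forcing is nonnegative, the majorant of a mode that is present
    initially decays no faster than under the heat equation.\<close>
  have Bpos: "Bm 0 t > 0" if t: "t \<in> {0..T}" and A: "amplitude c 0 > 0" for t
  proof -
    have "\<exists>k. a0 0 k \<noteq> 0" using A unfolding amp by (metis infsum_0 less_irrefl)
    then obtain k where k: "a0 0 k > 0" using pos(1) by (metis less_eq_real_def)
    have "norm (exp (- (\<nu> * (norm (freq k))\<^sup>2) * t) * b k 0) \<le> b k t"
    proof (rule duhamel_compare[OF _ b' _ _ t, where G="\<lambda>_. 0"])
      show "((\<lambda>t. exp (- (\<nu> * (norm (freq k))\<^sup>2) * t) * b k 0) has_vector_derivative
        - (\<nu> * (norm (freq k))\<^sup>2) *\<^sub>R (exp (- (\<nu> * (norm (freq k))\<^sup>2) * s) * b k 0) + 0) (at s within {0..T})" for s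
        unfolding has_real_derivative_iff_has_vector_derivative[symmetric]
        by (auto intro!: derivative_eq_intros)
    qed (use g0 pos in \<open>auto simp: b0\<close>)
    moreover have "0 < exp (- (\<nu> * (norm (freq k))\<^sup>2) * t) * b k 0" using k by (simp add: b0)
    ultimately have "0 < b k t" by (metis abs_of_pos less_le_trans real_norm_def)
    also have "b k t = sum (\<lambda>k. norm (freq k) ^ 0 * b k t) {k}" by simp
    also have "\<dots> \<le> Bm 0 t" unfolding Bm_def by (rule finite_sum_le_infsum[OF sB[OF t]]) (use bpos[OF t] in auto)
    finally show ?thesis .
  qed
  have "Bm 0 0 = amplitude c 0" unfolding amp Bm_def by (simp add: b0)
  moreover have "0 \<le> Bm 1 t" if t: "t \<in> {0..T}" for t
    unfolding Bm_def by (intro infsum_nonneg mult_nonneg_nonneg bpos[OF t]) auto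
  ultimately show ?thesis
    using B' A0B D B12 Young Bpos Bcont amp
    by (intro exI[of _ "Bm 0"] exI[of _ "Bm 1"] exI[of _ "Bm 2"] exI[of _ D]) simp
qed

text \<open>By \<open>B\<^sub>1 \<le> B\<^sub>2\<close> the differential inequality becomes
  \<open>(B - \<nu>)' \<le> B\<^sub>1 (B - \<nu>)\<close>.\<close>

lemma amplitude_le_viscosity:
  fixes c :: "int^'n \<Rightarrow> real \<Rightarrow> complex^'n"
  assumes \<nu>: "\<nu> > 0" and c: "mode_sol \<nu> T c" and le: "amplitude c 0 \<le> \<nu>" and t: "t \<in> {0..T}"
  shows "amplitude c t \<le> \<nu>"
proof -
  have T: "0 \<le> T" using t by simp
  obtain B B1 B2 D where *: "\<And>t. t \<in> {0..T} \<Longrightarrow> (B has_vector_derivative D t) (at t within {0..T})"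
      "\<And>t. t \<in> {0..T} \<Longrightarrow> amplitude c t \<le> B t" "\<And>t. t \<in> {0..T} \<Longrightarrow> B1 t \<le> B2 t"
      "\<And>t. t \<in> {0..T} \<Longrightarrow> D t \<le> B t * B1 t - \<nu> * B2 t" "B 0 = amplitude c 0" "continuous_on {0..T} B1"
    using amplitude_majorant[OF \<nu> c T] by blast
  have "B t - \<nu> \<le> 0"
  proof (rule gronwall_nonpos[where z="\<lambda>t. B t - \<nu>" and z'=D and q=B1 and T=T])
    fix s assume s: "s \<in> {0..T}"
    show "((\<lambda>t. B t - \<nu>) has_vector_derivative D s) (at s within {0..T})"
      using has_vector_derivative_diff[OF *(1)[OF s] has_vector_derivative_const] by simp
    have "\<nu> * B1 s \<le> \<nu> * B2 s" by (rule mult_left_mono[OF *(3)[OF s]]) (use \<nu> in auto)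
    then show "D s \<le> B1 s * (B s - \<nu>)" using *(4)[OF s] by (simp add: algebra_simps)
  qed (use * le t in auto)
  then show ?thesis using *(2)[OF t] by linarith
qed

lemma amplitude_bernoulli:
  fixes c :: "int^'n \<Rightarrow> real \<Rightarrow> complex^'n"
  assumes \<nu>: "\<nu> > 0" and c: "mode_sol \<nu> T c" and A: "amplitude c 0 > 0" and t: "t \<in> {0..T}"
    and d: "1 / (amplitude c 0)\<^sup>2 - t / (2 * \<nu>) > 0"
  shows "(amplitude c t)\<^sup>2 \<le> 1 / (1 / (amplitude c 0)\<^sup>2 - t / (2 * \<nu>))"
proof -
  have T: "0 \<le> T" using t by simp
  obtain B B1 B2 D where *: "\<And>t. t \<in> {0..T} \<Longrightarrow> (B has_vector_derivative D t) (at t within {0..T})"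
      "\<And>t. t \<in> {0..T} \<Longrightarrow> amplitude c t \<le> B t" "\<And>t. t \<in> {0..T} \<Longrightarrow> B t * B1 t \<le> \<nu> * B2 t + (B t) ^ 3 / (4 * \<nu>)"
      "\<And>t. t \<in> {0..T} \<Longrightarrow> D t \<le> B t * B1 t - \<nu> * B2 t" "B 0 = amplitude c 0" "\<And>t. t \<in> {0..T} \<Longrightarrow> B t > 0"
    using amplitude_majorant[OF \<nu> c T] A by blast
  have "1 / (B 0)\<^sup>2 - t / (2 * \<nu>) \<le> 1 / (B t)\<^sup>2"
    by (rule bernoulli_comparison[OF *(1) _ *(6) \<nu> t]) (use *(3,4) in force)+
  then have "(B t)\<^sup>2 \<le> 1 / (1 / (amplitude c 0)\<^sup>2 - t / (2 * \<nu>))"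
    using d *(6)[OF t] unfolding *(5) by (simp add: pos_le_divide_eq mult.commute)
  moreover have "(amplitude c t)\<^sup>2 \<le> (B t)\<^sup>2"
    by (rule power_mono[OF *(2)[OF t]]) (simp add: amplitude_def infsum_nonneg)
  ultimately show ?thesis by linarith
qed

section \<open>Fourier analysis on the torus\<close>

abbreviation cube :: "(real^'n) set" where "cube \<equiv> cbox 0 (\<chi> j. 2 * pi)"

lemma torus_periodic_lattice:
  fixes m :: "int^'n"
  assumes "torus_periodic f"
  shows "f (x + (2 * pi) *\<^sub>R freq m) = f x"
proof -
  have 1: "f (x + axis i (2 * pi * of_int z)) = f x" for x i z
  proof (induction z arbitrary: x rule: int_induct[of _ 0])
    case base show ?case by (simp add: axis_def zero_vec_def[symmetric])
  next
    case (step1 z)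
    have "axis i (2 * pi * of_int (z + 1)) = axis i (2 * pi * of_int z) + (axis i (2 * pi) :: real^'n)"
      by (simp add: axis_def vec_eq_iff algebra_simps)
    then have "f (x + axis i (2 * pi * of_int (z + 1))) = f ((x + axis i (2 * pi * of_int z)) + axis i (2 * pi))"
      by (simp add: add.assoc)
    also have "\<dots> = f (x + axis i (2 * pi * of_int z))" using assms unfolding torus_periodic_def by blast
    finally show ?case using step1 by simp
  next
    case (step2 z)
    have "axis i (2 * pi * of_int z) = axis i (2 * pi * of_int (z - 1)) + (axis i (2 * pi) :: real^'n)"
      by (simp add: axis_def vec_eq_iff algebra_simps)
    then have "f (x + axis i (2 * pi * of_int z)) = f ((x + axis i (2 * pi * of_int (z - 1))) + axis i (2 * pi))"
      by (simp add: add.assoc)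
    also have "\<dots> = f (x + axis i (2 * pi * of_int (z - 1)))" using assms unfolding torus_periodic_def by blast
    finally show ?case using step2 by simp
  qed
  have 2: "f (x + (\<Sum>i\<in>F. axis i (2 * pi * of_int (m $ i)))) = f x" for F x
  proof (induction F arbitrary: x rule: infinite_finite_induct)
    case (insert i F)
    have "f (x + (\<Sum>i\<in>insert i F. axis i (2 * pi * of_int (m $ i)))) =
        f ((x + axis i (2 * pi * of_int (m $ i))) + (\<Sum>i\<in>F. axis i (2 * pi * of_int (m $ i))))"
      using insert by (simp add: add.assoc)
    also have "\<dots> = f x" unfolding insert 1 ..
    finally show ?case .
  qed auto
  have "(2 * pi) *\<^sub>R freq m = (\<Sum>i\<in>UNIV. axis i (2 * pi * of_int (m $ i)))"
    by (simp add: vec_eq_iff axis_def if_distrib cong: if_cong)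
  then show ?thesis using 2[of x UNIV] by simp
qed

lemma reduce_to_cube: "\<exists>m::int^'n. x - (2 * pi) *\<^sub>R freq m \<in> cube"
proof (intro exI[of _ "\<chi> j. \<lfloor>x $ j / (2 * pi)\<rfloor>"])
  have "2 * pi * of_int \<lfloor>x $ j / (2 * pi)\<rfloor> \<le> x $ j" "x $ j \<le> 2 * pi + 2 * pi * of_int \<lfloor>x $ j / (2 * pi)\<rfloor>" for j
  proof -
    define z where "z = real_of_int \<lfloor>x $ j / (2 * pi)\<rfloor>"
    have "z \<le> x $ j / (2 * pi)" "x $ j / (2 * pi) \<le> z + 1" unfolding z_def by linarith+
    then have "2 * pi * z \<le> x $ j" "x $ j \<le> 2 * pi + 2 * pi * z" by (simp_all add: field_simps)
    then show "2 * pi * of_int \<lfloor>x $ j / (2 * pi)\<rfloor> \<le> x $ j" "x $ j \<le> 2 * pi + 2 * pi * of_int \<lfloor>x $ j / (2 * pi)\<rfloor>"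
      unfolding z_def by blast+
  qed
  then show "x - (2 * pi) *\<^sub>R freq (\<chi> j. \<lfloor>x $ j / (2 * pi)\<rfloor>) \<in> cube"
    by (simp add: mem_box_cart algebra_simps)
qed

text \<open>The translated cube and the cube differ by two slabs that are lattice translates of each other.\<close>

lemma integral_translate:
  fixes g :: "real^'n \<Rightarrow> 'b::banach"
  assumes g: "continuous_on UNIV g" "torus_periodic g" and h: "0 \<le> h" "h \<le> 2 * pi"
  shows "integral cube (\<lambda>x. g (x + axis i h)) = integral cube g"
proof -
  define W where "W s t = (cbox (\<chi> j. if j = i then s else 0) (\<chi> j. if j = i then t else 2 * pi) :: (real^'n) set)" for s t :: real
  have B: "(axis i 1 :: real^'n) \<in> Basis" by (simp add: axis_in_Basis_iff)
  have int: "g integrable_on cbox a b" for a b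
    by (rule integrable_continuous) (rule continuous_on_subset[OF g(1)], simp)
  have memW: "x \<in> W s t \<longleftrightarrow> s \<le> x $ i \<and> x $ i \<le> t \<and> (\<forall>j. j \<noteq> i \<longrightarrow> 0 \<le> x $ j \<and> x $ j \<le> 2 * pi)" for x s t
  proof
    assume "x \<in> W s t"
    then have *: "(if j = i then s else 0) \<le> x $ j \<and> x $ j \<le> (if j = i then t else 2 * pi)" for j
      by (simp add: W_def mem_box_cart)
    have "0 \<le> x $ j \<and> x $ j \<le> 2 * pi" if "j \<noteq> i" for j using *[of j] that by simp
    then show "s \<le> x $ i \<and> x $ i \<le> t \<and> (\<forall>j. j \<noteq> i \<longrightarrow> 0 \<le> x $ j \<and> x $ j \<le> 2 * pi)" using *[of i] by simp
  qed (simp add: W_def mem_box_cart)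
  have split: "integral (W s t) g = integral (W s r) g + integral (W r t) g" if "s \<le> r" "r \<le> t" for s r t
  proof -
    have "W s t \<inter> {x. x \<bullet> axis i 1 \<le> r} = W s r" "W s t \<inter> {x. x \<bullet> axis i 1 \<ge> r} = W r t"
      using that by (auto simp: memW inner_axis)
    then show ?thesis using integral_split[OF int B, of "\<chi> j. if j = i then s else 0" "\<chi> j. if j = i then t else 2 * pi" r]
      by (simp add: W_def)
  qed
  have shift: "integral (W (s - r) (t - r)) (\<lambda>x. g (x + axis i r)) = integral (W s t) g" for s t r
  proof -
    have "(\<chi> j. if j = i then s - r else 0) = (\<chi> j. if j = i then s else 0) - axis i r"
      "(\<chi> j. if j = i then t - r else 2 * pi) = (\<chi> j. if j = i then t else 2 * pi) - axis i r"
      by (auto simp: vec_eq_iff axis_def)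
    then show ?thesis unfolding W_def by (simp only: integral_shift_cbox)
  qed
  have c: "cube = W 0 (2 * pi)"
  proof -
    have "(0::real^'n) = (\<chi> j. if j = i then 0 else 0)" "(\<chi> j. 2 * pi) = ((\<chi> j. if j = i then 2 * pi else 2 * pi) :: real^'n)"
      by (simp_all add: vec_eq_iff)
    then show ?thesis unfolding W_def by (simp only:)
  qed
  have "integral cube (\<lambda>x. g (x + axis i h)) = integral (W h (2 * pi + h)) g"
    unfolding c using shift[of h h "2 * pi + h"] by simp
  also have "\<dots> = integral (W h (2 * pi)) g + integral (W (2 * pi) (2 * pi + h)) g" using h by (intro split) auto
  also have "integral (W (2 * pi) (2 * pi + h)) g = integral (W 0 h) (\<lambda>x. g (x + axis i (2 * pi)))"
    using shift[of "2 * pi" "2 * pi" "2 * pi + h"] by simp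
  also have "(\<lambda>x. g (x + axis i (2 * pi))) = g" using g(2) by (auto simp: torus_periodic_def)
  also have "integral (W h (2 * pi)) g + integral (W 0 h) g = integral (W 0 (2 * pi)) g"
    using split[of 0 h "2 * pi"] h by simp
  finally show ?thesis unfolding c .
qed

text \<open>The integral of \<open>F\<close> over a translated cube does not depend on the
  translation; the claim is the derivative of this statement.\<close>

lemma integral_directional_derivative:
  fixes F F' :: "real^'n \<Rightarrow> 'b::banach"
  assumes F: "continuous_on UNIV F" "torus_periodic F" and F': "continuous_on UNIV F'"
    and d: "\<And>x. ((\<lambda>s. F (x + axis i s)) has_vector_derivative F' x) (at 0)"
  shows "integral cube F' = 0"
proof -
  have ax: "axis i (s + t) = axis i s + (axis i t :: real^'n)" for s t :: real by (simp add: axis_def vec_eq_iff)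
  have d': "((\<lambda>s. F (x + axis i s)) has_vector_derivative F' (x + axis i s)) (at s within {0..2*pi})" for x s
  proof -
    have "((\<lambda>r. F ((x + axis i s) + axis i r)) has_vector_derivative F' (x + axis i s)) (at (s - s))" using d by simp
    moreover have "((\<lambda>r. r - s) has_vector_derivative 1) (at s)" by (auto intro!: derivative_eq_intros)
    ultimately have "((\<lambda>r. F ((x + axis i s) + axis i r)) \<circ> (\<lambda>r. r - s) has_vector_derivative 1 *\<^sub>R F' (x + axis i s)) (at s)"
      by (intro vector_diff_chain_at)
    moreover have "(\<lambda>r. F ((x + axis i s) + axis i r)) \<circ> (\<lambda>r. r - s) = (\<lambda>r. F (x + axis i r))"
      by (simp add: o_def add.assoc ax[symmetric])
    ultimately show ?thesis by (simp add: has_vector_derivative_at_within)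
  qed
  have axc: "continuous_on A (\<lambda>s. axis i s :: real^'n)" for A
  proof -
    have "(\<lambda>s. axis i s :: real^'n) = (\<lambda>s. s *\<^sub>R axis i 1)" by (simp add: axis_def vec_eq_iff fun_eq_iff)
    then show ?thesis by (rule ssubst) (intro continuous_intros)
  qed
  have "((\<lambda>s. integral cube (\<lambda>x. F (x + axis i s))) has_vector_derivative integral cube (\<lambda>x. F' (x + axis i 0))) (at 0 within {0..2*pi})"
  proof (rule leibniz_rule_vector_derivative[where fx="\<lambda>s x. F' (x + axis i s)"])
    show "(\<lambda>x. F (x + axis i s)) integrable_on cube" for s
      by (rule integrable_continuous) (intro continuous_on_compose2[OF F(1)] continuous_intros, auto)
    show "continuous_on ({0..2 * pi} \<times> cube) (\<lambda>(s, x). F' (x + axis i s))"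
      unfolding split_beta
      by (intro continuous_on_compose2[OF F'] continuous_intros continuous_on_compose2[OF axc]) auto
  qed (use d' in auto)
  then have "((\<lambda>s. integral cube F) has_vector_derivative integral cube (\<lambda>x. F' (x + axis i 0))) (at 0 within {0..2*pi})"
    by (rule has_vector_derivative_transform[rotated 2]) (auto simp: integral_translate[OF F])
  moreover have "axis i 0 = (0 :: real^'n)" by (simp add: axis_def vec_eq_iff)
  ultimately have "((\<lambda>s. integral cube F) has_vector_derivative integral cube F') (at 0 within {0..2*pi})" by simp
  moreover have "((\<lambda>s. integral cube F) has_vector_derivative 0) (at 0 within {0..2*pi})" by (rule has_vector_derivative_const)
  ultimately show ?thesis
    by (intro vector_derivative_unique_within_closed_interval[of 0 "2 * pi" 0]) auto
qed

lemma wave_eq: "wave k x = cis (freq k \<bullet> x)"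
  by (simp add: wave_def cis_conv_exp inner_vec_def)

lemma wave_0 [simp]: "wave 0 x = 1" by (simp add: wave_eq)

lemma norm_wave [simp]: "norm (wave k x) = 1" by (simp add: wave_eq)

lemma wave_add: "wave (k + l) x = wave k x * wave l x"
  by (simp add: wave_eq cis_mult inner_add_left)

lemma wave_shift: "wave k (x + y) = wave k x * wave k y"
  by (simp add: wave_eq cis_mult inner_add_right)

lemma wave_minus: "wave (- k) x = cnj (wave k x)"
  by (simp add: wave_eq cis_cnj)

lemma wave_diff: "wave (- k) x * wave l x = wave (l - k) x"
  by (simp flip: wave_add)

lemma continuous_on_wave [continuous_intros]: "continuous_on S (wave k)"
  unfolding wave_eq[abs_def] by (intro continuous_intros)

lemma torus_periodic_wave: "torus_periodic (wave k)"
proof -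
  have "wave k (axis i (2 * pi)) = 1" for i
    by (simp add: wave_eq inner_axis mult.commute[of _ "2 * pi"] cis_multiple_2pi)
  then show ?thesis by (simp add: torus_periodic_def wave_shift)
qed

lemma has_derivative_wave:
  "(wave k has_derivative (\<lambda>h. (\<i> * of_real (freq k \<bullet> h)) * wave k x)) (at x within S)"
proof -
  have "(cis has_derivative (\<lambda>h. h *\<^sub>R (\<i> * cis y))) (at y within T)" for y T
  proof -
    have "((\<lambda>z. exp (\<i> * z)) has_field_derivative exp (\<i> * of_real y) * \<i>) (at (of_real y))"
      by (auto intro!: derivative_eq_intros)
    moreover have eq: "cis = (\<lambda>x. exp (\<i> * complex_of_real x))" by (simp add: cis_conv_exp fun_eq_iff)
    ultimately have "(cis has_derivative (\<lambda>h. h *\<^sub>R (exp (\<i> * of_real y) * \<i>))) (at y within T)"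
      using has_vector_derivative_real_field[of "\<lambda>z. exp (\<i> * z)" _ y T] unfolding eq has_vector_derivative_def by blast
    then show ?thesis by (simp add: cis_conv_exp mult.commute)
  qed
  from has_derivative_compose[OF _ this[where T=UNIV], where f="\<lambda>x. freq k \<bullet> x" and f'="\<lambda>h. freq k \<bullet> h" and x=x and s=S]
  have "((\<lambda>x. cis (freq k \<bullet> x)) has_derivative (\<lambda>h. (freq k \<bullet> h) *\<^sub>R (\<i> * cis (freq k \<bullet> x)))) (at x within S)"
    by (simp add: has_derivative_inner_right[OF has_derivative_ident])
  then show ?thesis unfolding wave_eq[abs_def] by (simp add: scaleR_conv_of_real mult_ac)
qed

lemma content_cube: "Henstock_Kurzweil_Integration.content (cube :: (real^'n) set) = (2 * pi) ^ CARD('n)"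
proof -
  have "(0::real^'n) \<in> cube" by (simp add: mem_box_cart)
  then have "(cube :: (real^'n) set) \<noteq> {}" by blast
  from content_cbox_cart[OF this] show ?thesis by simp
qed

lemma integral_cube_const: "integral cube (\<lambda>x::real^'n. 1::complex) = of_real ((2 * pi) ^ CARD('n))"
proof -
  have "integral cube (\<lambda>x::real^'n. 1::complex) = Henstock_Kurzweil_Integration.content (cube :: (real^'n) set) *\<^sub>R 1"
    by (rule integral_const)
  then show ?thesis unfolding content_cube by (simp add: scaleR_conv_of_real)
qed

text \<open>For \<open>k \<noteq> 0\<close> a translation by half a period in a direction with
  \<open>k\<^sub>i \<noteq> 0\<close> preserves the integral and flips its sign.\<close>

lemma integral_wave: "integral cube (wave k) = (if k = 0 then of_real ((2 * pi) ^ CARD('n)) else 0)" for k :: "int^'n"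
proof (cases "k = 0")
  case True
  then have "wave k = (\<lambda>x. 1)" by auto
  then show ?thesis using integral_cube_const[where 'n='n] True by simp
next
  case False
  then obtain i where i: "k $ i \<noteq> 0" by (auto simp: vec_eq_iff)
  define h where "h = pi / \<bar>real_of_int (k $ i)\<bar>"
  have k1: "1 \<le> \<bar>real_of_int (k $ i)\<bar>" using i by linarith
  then have h: "0 \<le> h" "h \<le> 2 * pi" by (auto simp: h_def field_simps intro: order_trans[of _ pi])
  have "freq k \<bullet> axis i h = pi \<or> freq k \<bullet> axis i h = - pi"
    using i by (auto simp: inner_axis h_def abs_if)
  then have "wave k (axis i h) = - 1" by (auto simp: wave_eq complex_eq_iff)
  then have "integral cube (wave k) = integral cube (\<lambda>x. - wave k x)"
    using integral_translate[OF continuous_on_wave torus_periodic_wave h, of k i] by (simp add: wave_shift)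
  then show ?thesis using False by simp
qed

subsection \<open>Completeness of the trigonometric system\<close>

inductive trig_poly :: "(real^'n \<Rightarrow> complex) \<Rightarrow> bool" where
  wave: "trig_poly (\<lambda>x. z * wave k x)"
| add: "trig_poly f \<Longrightarrow> trig_poly g \<Longrightarrow> trig_poly (\<lambda>x. f x + g x)"

lemma trig_poly_mult:
  assumes "trig_poly f" "trig_poly g"
  shows "trig_poly (\<lambda>x. f x * g x)"
proof -
  have 1: "trig_poly (\<lambda>x. (z * wave k x) * g x)" if "trig_poly g" for z k g
    using that
  proof (induction rule: trig_poly.induct)
    case (wave w l)
    show ?case using trig_poly.wave[of "z * w" "k + l"] by (simp add: wave_add mult_ac)
  next
    case (add f g)
    show ?case using trig_poly.add[OF add.IH] by (simp add: distrib_left)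
  qed
  show ?thesis
    using assms
  proof (induction rule: trig_poly.induct)
    case (wave z k)
    then show ?case by (rule 1)
  next
    case (add f1 f2)
    show ?case using trig_poly.add[OF add.IH(1)[OF assms(2)] add.IH(2)[OF assms(2)]] by (simp add: distrib_right)
  qed
qed

lemma trig_poly_continuous: "trig_poly f \<Longrightarrow> continuous_on S f"
  by (induction rule: trig_poly.induct) (intro continuous_intros; assumption)+

definition torus_embed :: "real^'n \<Rightarrow> complex^'n" where
  "torus_embed x = (\<chi> j. cis (x $ j))"

lemma torus_embed_eq:
  assumes "torus_embed x = torus_embed y" "torus_periodic f"
  shows "f x = f y"
proof -
  have "\<exists>n::int. x $ j = y $ j + 2 * pi * n" for j
  proof -
    have "cis (x $ j) = cis (y $ j)" using assms(1) by (simp add: torus_embed_def vec_eq_iff)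
    then show ?thesis using sin_cos_eq_iff[of "x $ j" "y $ j"] by (simp add: complex_eq_iff)
  qed
  then obtain m where "\<And>j. x $ j = y $ j + 2 * pi * real_of_int (m j)" by metis
  then have "x = y + (2 * pi) *\<^sub>R freq (\<chi> j. m j)" by (simp add: vec_eq_iff)
  then show ?thesis by (simp add: torus_periodic_lattice[OF assms(2)])
qed

text \<open>Stone--Weierstrass on the torus embedded in \<open>\<complex>\<^sup>n\<close>, where trigonometric polynomials separate points.\<close>

lemma trig_poly_dense:
  fixes r :: "real^'n \<Rightarrow> real"
  assumes r: "continuous_on UNIV r" "torus_periodic r" and e: "e > 0"
  shows "\<exists>p. trig_poly (\<lambda>x. complex_of_real (p x)) \<and> (\<forall>x\<in>cube. \<bar>r x - p x\<bar> < e)"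
proof -
  define S where "S = torus_embed ` (cube :: (real^'n) set)"
  have contE: "continuous_on A (torus_embed :: real^'n \<Rightarrow> complex^'n)" for A
    unfolding torus_embed_def by (intro continuous_intros)
  define R where "R = {F. continuous_on S F \<and> trig_poly (\<lambda>x. complex_of_real (F (torus_embed x :: complex^'n)))}"
  have S: "compact S" unfolding S_def by (intro compact_continuous_image contE compact_cbox)
  have re: "trig_poly (\<lambda>x. complex_of_real (Re (torus_embed x $ j)))" "trig_poly (\<lambda>x. complex_of_real (Im (torus_embed x $ j)))" for j :: 'n
  proof -
    have w: "wave (axis j 1) x = cis (x $ j)" "wave (- axis j 1) x = cis (- x $ j)" for x :: "real^'n"
      by (simp_all add: wave_def cis_conv_exp axis_def if_distrib sum.delta if_distribR cong: if_cong)
    have "(\<lambda>x. complex_of_real (Re (torus_embed x $ j))) = (\<lambda>x. 1 / 2 * wave (axis j 1) x + 1 / 2 * wave (- axis j 1) x)"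
      unfolding w by (simp add: torus_embed_def complex_eq_iff fun_eq_iff)
    then show "trig_poly (\<lambda>x. complex_of_real (Re (torus_embed x $ j)))" by (simp only: trig_poly.intros)
    have "(\<lambda>x. complex_of_real (Im (torus_embed x $ j))) = (\<lambda>x. - \<i> / 2 * wave (axis j 1) x + \<i> / 2 * wave (- axis j 1) x)"
      unfolding w by (simp add: torus_embed_def complex_eq_iff fun_eq_iff)
    then show "trig_poly (\<lambda>x. complex_of_real (Im (torus_embed x $ j)))" by (simp only: trig_poly.intros)
  qed
  interpret function_ring_on R S
  proof
    show "compact S" by (rule S)
    show "continuous_on S f" if "f \<in> R" for f using that by (simp add: R_def)
    show "(\<lambda>x. f x + g x) \<in> R" if "f \<in> R" "g \<in> R" for f g
      using that trig_poly.add unfolding R_def by (fastforce intro: continuous_intros)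
    show "(\<lambda>x. f x * g x) \<in> R" if "f \<in> R" "g \<in> R" for f g
      using that trig_poly_mult unfolding R_def by (fastforce intro: continuous_intros)
    show "(\<lambda>_. c) \<in> R" for c using trig_poly.wave[of "of_real c" 0] by (simp add: R_def)
    fix x y :: "complex^'n" assume "x \<noteq> y"
    then obtain j where "x $ j \<noteq> y $ j" by (auto simp: vec_eq_iff)
    then have "Re (x $ j) \<noteq> Re (y $ j) \<or> Im (x $ j) \<noteq> Im (y $ j)" by (simp add: complex_eq_iff)
    moreover have R: "(\<lambda>x. Re (x $ j)) \<in> R" "(\<lambda>x. Im (x $ j)) \<in> R"
      using re by (auto simp: R_def intro!: continuous_intros)
    ultimately show "\<exists>f\<in>R. f x \<noteq> f y"
      using bexI[OF _ R(1), of "\<lambda>f. f x \<noteq> f y"] bexI[OF _ R(2), of "\<lambda>f. f x \<noteq> f y"] by argo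
  qed
  \<comment> \<open>The periodic function descends to the embedded torus. Closed sets have closed
    preimages because the embedding is a quotient map from a compact set.\<close>
  define G where "G y = r (SOME x. x \<in> cube \<and> torus_embed x = y)" for y
  have G: "G (torus_embed x) = r x" if "x \<in> cube" for x
  proof -
    have "(SOME z. z \<in> cube \<and> torus_embed z = torus_embed x) \<in> cube \<and> torus_embed (SOME z. z \<in> cube \<and> torus_embed z = torus_embed x) = torus_embed x"
      by (rule someI_ex) (use that in blast)
    then show ?thesis unfolding G_def using torus_embed_eq[OF _ r(2)] by blast
  qed
  have "continuous_on S G"
    unfolding continuous_on_closed_invariant
  proof (intro allI impI)
    fix C :: "real set" assume C: "closed C"
    have "compact (cube \<inter> r -` C)"
      by (intro compact_Int_closed compact_cbox closed_vimage[OF C r(1)])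
    then have "closed (torus_embed ` (cube \<inter> r -` C))" by (intro compact_imp_closed compact_continuous_image contE)
    moreover have "torus_embed ` (cube \<inter> r -` C) \<inter> S = G -` C \<inter> S"
      unfolding S_def using G by auto
    ultimately show "\<exists>A. closed A \<and> A \<inter> S = G -` C \<inter> S" by blast
  qed
  then obtain g where g: "g \<in> R" "\<And>y. y \<in> S \<Longrightarrow> \<bar>G y - g y\<bar> < e"
    using Stone_Weierstrass_basic e by blast
  show ?thesis
  proof (intro exI[of _ "\<lambda>x. g (torus_embed x)"] conjI ballI)
    show "trig_poly (\<lambda>x. complex_of_real (g (torus_embed x)))" using g(1) by (simp add: R_def)
    show "\<bar>r x - g (torus_embed x)\<bar> < e" if "x \<in> cube" for x
      using g(2)[of "torus_embed x"] G[OF that] that by (simp add: S_def)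
  qed
qed

lemma box_cube_nonempty: "box 0 (\<chi> j. 2 * pi) \<noteq> ({} :: (real^'n) set)"
proof -
  have "(\<chi> j. pi) \<in> box 0 (\<chi> j. 2 * pi)" by (simp add: mem_box_cart)
  then show ?thesis by blast
qed

text \<open>The real part \<open>r\<close> of \<open>g\<close> is orthogonal to all real
  trigonometric polynomials. Approximating \<open>r\<close> itself by these gives
  \<open>\<integral>r\<^sup>2 = 0\<close>.\<close>

lemma fourier_unique_Re:
  fixes g :: "real^'n \<Rightarrow> complex"
  assumes g: "continuous_on UNIV g" "torus_periodic g" and 0: "\<And>k. integral cube (\<lambda>x. wave k x * g x) = 0"
  shows "Re (g x) = 0"
proof -
  define r where "r x = Re (g x)" for x
  have r: "continuous_on UNIV r" "torus_periodic r"
    using g unfolding r_def[abs_def] by (auto intro!: continuous_intros simp: torus_periodic_def)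
  have gc: "continuous_on cube g" and rc: "continuous_on cube r"
    using continuous_on_subset[OF g(1)] continuous_on_subset[OF r(1)] by auto
  have ann: "integral cube (\<lambda>x. p x * g x) = 0" if "trig_poly p" for p
    using that
  proof (induction rule: trig_poly.induct)
    case (wave z k)
    have "integral cube (\<lambda>x. z * (wave k x * g x)) = z * integral cube (\<lambda>x. wave k x * g x)" by (rule integral_mult_right)
    then show ?case using 0 by (simp add: mult.assoc)
  next
    case (add f h)
    then show ?case
      by (simp add: distrib_right integral_add integrable_continuous continuous_intros trig_poly_continuous gc)
  qed
  have annr: "integral cube (\<lambda>x. p x * r x) = 0" if p: "trig_poly (\<lambda>x. complex_of_real (p x))" for p
  proof -
    have "(\<lambda>x. complex_of_real (p x) * g x) integrable_on cube"
      by (intro integrable_continuous continuous_intros trig_poly_continuous[OF p] gc)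
    from integral_linear[OF this bounded_linear_Re] ann[OF p] show ?thesis by (simp add: o_def r_def)
  qed
  have cr: "continuous_on cube p" if p: "trig_poly (\<lambda>x. complex_of_real (p x))" for p
    using continuous_on_Re[OF trig_poly_continuous[OF p, of cube]] by simp
  have "compact (r ` cube)" by (intro compact_continuous_image rc compact_cbox)
  then obtain M where M: "M > 0" "\<And>x. x \<in> cube \<Longrightarrow> \<bar>r x\<bar> \<le> M"
    by (metis bounded_pos compact_imp_bounded imageI real_norm_def)
  define V where "V = Henstock_Kurzweil_Integration.content (cube :: (real^'n) set)"
  have V: "0 \<le> V" by (simp add: V_def)
  have le: "integral cube (\<lambda>x. (r x)\<^sup>2) \<le> e * M * V" if e: "e > 0" for e
  proof -
    obtain p where p: "trig_poly (\<lambda>x. complex_of_real (p x))" "\<And>x. x \<in> cube \<Longrightarrow> \<bar>r x - p x\<bar> < e"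
      using trig_poly_dense[OF r e] by blast
    have "integral cube (\<lambda>x. (r x)\<^sup>2) = integral cube (\<lambda>x. (r x - p x) * r x + p x * r x)"
      by (simp add: power2_eq_square algebra_simps)
    also have "\<dots> = integral cube (\<lambda>x. (r x - p x) * r x) + integral cube (\<lambda>x. p x * r x)"
      by (intro integral_add integrable_continuous continuous_intros cr[OF p(1)] rc)
    also have "\<dots> = integral cube (\<lambda>x. (r x - p x) * r x)" using annr[OF p(1)] by simp
    also have "\<dots> \<le> norm (integral cube (\<lambda>x. (r x - p x) * r x))" by simp
    also have "\<dots> \<le> e * M * V"
      unfolding V_def
    proof (rule integrable_bound)
      show "norm ((r x - p x) * r x) \<le> e * M" if "x \<in> cube" for x
        using mult_mono[OF less_imp_le[OF p(2)[OF that]] M(2)[OF that]] e by (simp add: abs_mult)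
    qed (use e M in \<open>auto intro!: integrable_continuous continuous_intros cr[OF p(1)] rc\<close>)
    finally show ?thesis .
  qed
  have "integral cube (\<lambda>x. (r x)\<^sup>2) \<le> 0"
  proof (rule ccontr)
    assume "\<not> ?thesis"
    then have I: "integral cube (\<lambda>x. (r x)\<^sup>2) > 0" by simp
    define I where "I = integral cube (\<lambda>x. (r x)\<^sup>2)"
    have "I \<le> (I / (2 * (M * V + 1))) * M * V" unfolding I_def by (rule le) (use I M V in \<open>auto intro!: divide_pos_pos add_nonneg_pos mult_nonneg_nonneg\<close>)
    also have "\<dots> = I * ((M * V) / (2 * (M * V + 1)))" by simp
    also have "\<dots> < I * 1"
    proof (rule mult_strict_left_mono)
      have "0 \<le> M * V" using M V by simp
      then show "(M * V) / (2 * (M * V + 1)) < 1" by (simp add: divide_simps)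
    qed (use I in \<open>simp add: I_def\<close>)
    finally show False by simp
  qed
  moreover have "0 \<le> integral cube (\<lambda>x. (r x)\<^sup>2)"
    by (intro integral_nonneg integrable_continuous continuous_intros rc) auto
  ultimately have "integral cube (\<lambda>x. (r x)\<^sup>2) = 0" by simp
  then have z: "r x = 0" if "x \<in> cube" for x
    using integral_cbox_eq_0_iff[OF _ box_cube_nonempty, of "\<lambda>x. (r x)\<^sup>2"] that rc by (auto intro: continuous_intros)
  obtain m :: "int^'n" where m: "x - (2 * pi) *\<^sub>R freq m \<in> cube" using reduce_to_cube by blast
  have "r x = r ((x - (2 * pi) *\<^sub>R freq m) + (2 * pi) *\<^sub>R freq m)" by simp
  also have "\<dots> = 0" unfolding torus_periodic_lattice[OF r(2)] by (rule z[OF m])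
  finally show ?thesis by (simp add: r_def)
qed

lemma fourier_unique:
  fixes g :: "real^'n \<Rightarrow> complex"
  assumes g: "continuous_on UNIV g" "torus_periodic g" and 0: "\<And>k. integral cube (\<lambda>x. wave k x * g x) = 0"
  shows "g x = 0"
proof -
  have "Re (g x) = 0" by (rule fourier_unique_Re[OF assms])
  moreover have "Re (\<i> * g x) = 0"
  proof (rule fourier_unique_Re)
    show "integral cube (\<lambda>x. wave k x * (\<i> * g x)) = 0" for k
      using integral_mult_right[of cube \<i> "\<lambda>x. wave k x * g x"] 0[of k] by (simp add: mult.left_commute)
  qed (use g in \<open>auto intro!: continuous_intros simp: torus_periodic_def\<close>)
  ultimately show ?thesis by (simp add: complex_eq_iff)
qed

subsection \<open>Fourier coefficients of vector fields\<close>

text \<open>The coefficients are needed for complex fields too, since sums of Fourier series take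
  complex values before their symmetry is used.\<close>

definition cfourier :: "(real^'n \<Rightarrow> complex^'n) \<Rightarrow> int^'n \<Rightarrow> complex^'n" where
  "cfourier F k = (1 / (2 * pi) ^ CARD('n)) *\<^sub>R integral cube (\<lambda>x. wave (- k) x *s F x)"

lemma fourier_coeff_eq: "fourier_coeff f k = cfourier (\<lambda>x. complex_vec (f x)) k"
  by (simp add: fourier_coeff_def cfourier_def)

lemma continuous_on_smult [continuous_intros]:
  "continuous_on S f \<Longrightarrow> continuous_on S g \<Longrightarrow> continuous_on S (\<lambda>x. f x *s (g x :: complex^'n))"
  by (rule bounded_bilinear.continuous_on[OF bounded_bilinear_smult])

lemma bounded_linear_smult_right: "bounded_linear (\<lambda>v::complex^'n. z *s v)"
  by (rule bounded_bilinear.bounded_linear_right[OF bounded_bilinear_smult])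

lemma bounded_linear_smult_left: "bounded_linear (\<lambda>z. z *s (v::complex^'n))"
  by (rule bounded_bilinear.bounded_linear_left[OF bounded_bilinear_smult])

lemma bounded_linear_complex_vec: "bounded_linear (complex_vec :: real^'n \<Rightarrow> complex^'n)"
  by (rule bounded_linear_intro[where K=1])
     (auto simp: complex_vec_def vec_eq_iff norm_vec_def complex_eq_iff)

lemma bounded_linear_component: "bounded_linear (\<lambda>v::complex^'n. v $ j)"
  by (rule bounded_linear_vec_nth)

lemma integral_smult_left:
  assumes "f integrable_on cbox a b"
  shows "integral (cbox a b) (\<lambda>x. f x *s (v::complex^'n)) = integral (cbox a b) f *s v"
  using integral_linear[OF assms bounded_linear_smult_left[of v]] by (simp add: o_def)

context
  fixes b :: "int^'n \<Rightarrow> complex^'n"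
  assumes sm: "(\<lambda>l. norm (b l)) summable_on UNIV"
begin

lemma series_summable: "(\<lambda>l. wave l x *s b l) summable_on A"
proof -
  have "(\<lambda>l. wave l x *s b l) summable_on UNIV"
    by (rule summable_on_norm_bound(1)[OF _ sm]) (simp add: norm_vector_smult)
  then show ?thesis by (rule summable_on_subset_banach) simp
qed

lemma series_continuous: "continuous_on S (\<lambda>x. \<Sum>\<^sub>\<infinity>l. wave l x *s b l)"
  by (rule continuous_on_infsum[OF _ _ sm]) (auto intro!: continuous_intros simp: norm_vector_smult)

lemma series_periodic: "torus_periodic (\<lambda>x. \<Sum>\<^sub>\<infinity>l. wave l x *s b l)"
proof -
  have "wave l (x + axis i (2 * pi)) = wave l x" for l x and i :: 'n
    using torus_periodic_wave[of l] unfolding torus_periodic_def by blast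
  then show ?thesis by (simp add: torus_periodic_def)
qed

text \<open>Multiplication by a function turns into convolution with its Fourier coefficients.\<close>

lemma cfourier_mult_series:
  fixes \<phi> :: "real^'n \<Rightarrow> complex"
  assumes \<phi>: "continuous_on UNIV \<phi>"
  shows "((\<lambda>l. ((1 / (2 * pi) ^ CARD('n)) *\<^sub>R integral cube (\<lambda>x. wave (- (k - l)) x * \<phi> x)) *s b l)
     has_sum cfourier (\<lambda>x. \<phi> x *s (\<Sum>\<^sub>\<infinity>l. wave l x *s b l)) k) UNIV"
proof -
  have pc: "continuous_on cube \<phi>" using continuous_on_subset[OF \<phi>] by auto
  have "compact (\<phi> ` cube)" by (intro compact_continuous_image pc compact_cbox)
  then obtain M where M: "M > 0" "\<And>x. x \<in> cube \<Longrightarrow> norm (\<phi> x) \<le> M"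
    by (metis bounded_pos compact_imp_bounded imageI)
  define f where "f l x = wave (- k) x *s (\<phi> x *s (wave l x *s b l))" for l x
  have "((\<lambda>l. integral cube (f l)) has_sum integral cube (\<lambda>x. \<Sum>\<^sub>\<infinity>l. f l x)) UNIV"
  proof (rule infsum_integral_cbox)
    show "continuous_on cube (f l)" for l unfolding f_def by (intro continuous_intros pc)
    show "norm (f l x) \<le> M * norm (b l)" if "x \<in> cube" for l x
      using M(2)[OF that] by (simp add: f_def norm_vector_smult norm_mult mult_right_mono)
    show "(\<lambda>l. M * norm (b l)) summable_on UNIV" by (rule summable_on_cmult_right[OF sm])
  qed
  moreover have "(\<Sum>\<^sub>\<infinity>l. f l x) = wave (- k) x *s (\<phi> x *s (\<Sum>\<^sub>\<infinity>l. wave l x *s b l))" for x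
    unfolding f_def
    by (simp only: infsum_bounded_linear_banach[OF bounded_linear_smult_right] series_summable summable_on_bounded_linear[OF bounded_linear_smult_right])
  moreover have "integral cube (f l) = integral cube (\<lambda>x. wave (- (k - l)) x * \<phi> x) *s b l" for l
  proof -
    have "f l = (\<lambda>x. (wave (- (k - l)) x * \<phi> x) *s b l)"
      by (simp add: f_def fun_eq_iff wave_diff[symmetric] mult_ac)
    then show ?thesis
      using integral_smult_left[OF integrable_continuous, of 0 "\<chi> j. 2 * pi" "\<lambda>x. wave (- (k - l)) x * \<phi> x" "b l"]
      by (simp add: continuous_intros pc)
  qed
  ultimately have "((\<lambda>l. integral cube (\<lambda>x. wave (- (k - l)) x * \<phi> x) *s b l) has_sum
     integral cube (\<lambda>x. wave (- k) x *s (\<phi> x *s (\<Sum>\<^sub>\<infinity>l. wave l x *s b l)))) UNIV" by simp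
  from has_sum_scaleR[OF this, of "1 / (2 * pi) ^ CARD('n)"] show ?thesis
    unfolding cfourier_def by (simp add: bounded_bilinear.scaleR_left[OF bounded_bilinear_smult])
qed

lemma cfourier_series: "cfourier (\<lambda>x. \<Sum>\<^sub>\<infinity>l. wave l x *s b l) k = b k"
proof -
  have "((\<lambda>l. ((1 / (2 * pi) ^ CARD('n)) *\<^sub>R integral cube (\<lambda>x. wave (- (k - l)) x * 1)) *s b l)
     has_sum cfourier (\<lambda>x. 1 *s (\<Sum>\<^sub>\<infinity>l. wave l x *s b l)) k) UNIV"
    by (rule cfourier_mult_series) simp
  moreover have "((1 / (2 * pi) ^ CARD('n)) *\<^sub>R integral cube (\<lambda>x. wave (- (k - l)) x * 1)) *s b l = (if l = k then b k else 0)" for l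
    using integral_wave[of "- (k - l)"] by (simp add: scaleR_conv_of_real)
  ultimately have "((\<lambda>l. if l = k then b k else 0) has_sum cfourier (\<lambda>x. \<Sum>\<^sub>\<infinity>l. wave l x *s b l) k) UNIV" by simp
  moreover have "((\<lambda>l. if l = k then b k else 0) has_sum b k) UNIV"
    by (rule has_sum_finite_neutralI[of "{k}"]) auto
  ultimately show ?thesis by (rule has_sum_unique)
qed

end

lemma cfourier_component:
  fixes F :: "real^'n \<Rightarrow> complex^'n"
  assumes "continuous_on UNIV F"
  shows "cfourier F k $ j = (1 / (2 * pi) ^ CARD('n)) *\<^sub>R integral cube (\<lambda>x. wave (- k) x * F x $ j)"
proof -
  have "(\<lambda>x. wave (- k) x *s F x) integrable_on cube"
    by (intro integrable_continuous continuous_intros continuous_on_subset[OF assms]) auto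
  from integral_linear[OF this bounded_linear_component[of j]] show ?thesis
    by (simp add: cfourier_def o_def)
qed

text \<open>The sum of the series is continuous with the same coefficients, so uniqueness applies to
  the difference.\<close>

lemma fourier_inversion:
  fixes F :: "real^'n \<Rightarrow> complex^'n"
  assumes F: "continuous_on UNIV F" "torus_periodic F" and sm: "(\<lambda>k. norm (cfourier F k)) summable_on UNIV"
  shows "F x = (\<Sum>\<^sub>\<infinity>k. wave k x *s cfourier F k)"
proof -
  define H where "H x = (\<Sum>\<^sub>\<infinity>k. wave k x *s cfourier F k)" for x
  have H: "continuous_on UNIV H" "torus_periodic H"
    unfolding H_def[abs_def] by (rule series_continuous[OF sm] series_periodic[OF sm])+
  have eq: "cfourier H k = cfourier F k" for k unfolding H_def[abs_def] by (rule cfourier_series[OF sm])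
  have "F x $ j - H x $ j = 0" for j
  proof (rule fourier_unique[where g="\<lambda>x. F x $ j - H x $ j"])
    show "continuous_on UNIV (\<lambda>x. F x $ j - H x $ j)" by (intro continuous_intros F H)
    show "torus_periodic (\<lambda>x. F x $ j - H x $ j)" using F(2) H(2) by (simp add: torus_periodic_def)
    fix k
    have i: "(\<lambda>x. wave k x * F x $ j) integrable_on cube" "(\<lambda>x. wave k x * H x $ j) integrable_on cube"
      by (intro integrable_continuous continuous_intros continuous_on_subset[OF F(1)] continuous_on_subset[OF H(1)]; simp)+
    have "integral cube (\<lambda>x. wave k x * F x $ j) = integral cube (\<lambda>x. wave k x * H x $ j)"
      using arg_cong[OF eq[of "- k"], of "\<lambda>v. v $ j"] by (simp add: cfourier_component F H)
    then show "integral cube (\<lambda>x. wave k x * (F x $ j - H x $ j)) = 0"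
      by (simp add: right_diff_distrib integral_diff[OF i])
  qed
  then show ?thesis by (simp add: vec_eq_iff H_def)
qed

text \<open>Integration by parts: the integral of the derivative of \<open>wave (- k)\<close> times
  \<open>F\<close> vanishes by periodicity.\<close>

lemma cfourier_derivative:
  fixes F F' :: "real^'n \<Rightarrow> complex^'n"
  assumes F: "continuous_on UNIV F" "torus_periodic F" and F': "continuous_on UNIV F'"
    and d: "\<And>x. ((\<lambda>s. F (x + axis i s)) has_vector_derivative F' x) (at 0)"
  shows "cfourier F' k = (\<i> * of_int (k $ i)) *s cfourier F k"
proof -
  define w where "w = - (\<i> * of_int (k $ i))"
  have dw: "((\<lambda>s. wave (- k) (x + axis i s)) has_vector_derivative w * wave (- k) x) (at 0)" for x
  proof -
    have "(wave (- k) has_derivative (\<lambda>h. (\<i> * of_real (freq (- k) \<bullet> h)) * wave (- k) (x + axis i 0))) (at (x + axis i 0))"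
      by (rule has_derivative_wave)
    moreover have "((\<lambda>s. x + axis i s) has_derivative (\<lambda>s. s *\<^sub>R axis i 1)) (at 0)"
    proof -
      have "(\<lambda>s. x + axis i s) = (\<lambda>s. x + s *\<^sub>R axis i 1)" by (simp add: axis_def vec_eq_iff fun_eq_iff)
      then show ?thesis by (rule ssubst) (auto intro!: derivative_eq_intros)
    qed
    ultimately have "((\<lambda>s. wave (- k) (x + axis i s)) has_derivative (\<lambda>s. (\<i> * of_real (freq (- k) \<bullet> (s *\<^sub>R axis i 1))) * wave (- k) (x + axis i 0))) (at 0)"
      using has_derivative_compose by blast
    moreover have "x + axis i 0 = x" by (simp add: axis_def vec_eq_iff)
    moreover have "freq (- k) \<bullet> (s *\<^sub>R axis i 1) = - (s * real_of_int (k $ i))" for s by (simp add: inner_axis)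
    ultimately show ?thesis
      by (simp add: has_vector_derivative_def w_def scaleR_conv_of_real mult_ac)
  qed
  have "integral cube (\<lambda>x. wave (- k) x *s F' x + (w * wave (- k) x) *s F x) = 0"
  proof (rule integral_directional_derivative[where F="\<lambda>x. wave (- k) x *s F x" and i=i])
    show "torus_periodic (\<lambda>x. wave (- k) x *s F x)" using F(2) torus_periodic_wave[of "- k"] by (simp add: torus_periodic_def)
    show "((\<lambda>s. wave (- k) (x + axis i s) *s F (x + axis i s)) has_vector_derivative wave (- k) x *s F' x + (w * wave (- k) x) *s F x) (at 0)" for x
    proof -
      have e: "x + axis i 0 = x" by (simp add: axis_def vec_eq_iff)
      show ?thesis using bounded_bilinear.has_vector_derivative[OF bounded_bilinear_smult dw[of x] d[of x]] unfolding e .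
    qed
  qed (intro continuous_intros F F')+
  moreover have "integral cube (\<lambda>x. wave (- k) x *s F' x + (w * wave (- k) x) *s F x) =
     integral cube (\<lambda>x. wave (- k) x *s F' x) + integral cube (\<lambda>x. w *s (wave (- k) x *s F x))"
    unfolding vector_smult_assoc
    by (intro integral_add integrable_continuous continuous_intros continuous_on_subset[OF F(1)] continuous_on_subset[OF F'(1)]) auto
  moreover have "integral cube (\<lambda>x. w *s (wave (- k) x *s F x)) = w *s integral cube (\<lambda>x. wave (- k) x *s F x)"
  proof -
    have "(\<lambda>x. wave (- k) x *s F x) integrable_on cube"
      by (intro integrable_continuous continuous_intros continuous_on_subset[OF F(1)]) auto
    from integral_linear[OF this bounded_linear_smult_right[of w]] show ?thesis by (simp add: o_def)
  qed
  ultimately have "integral cube (\<lambda>x. wave (- k) x *s F' x) = (\<i> * of_int (k $ i)) *s integral cube (\<lambda>x. wave (- k) x *s F x)"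
    by (simp add: w_def eq_neg_iff_add_eq_0 vec_eq_iff)
  then show ?thesis by (simp add: cfourier_def vec_eq_iff)
qed

lemma norm_cfourier_le:
  fixes F :: "real^'n \<Rightarrow> complex^'n"
  assumes F: "continuous_on UNIV F" and B: "\<And>x. x \<in> cube \<Longrightarrow> norm (F x) \<le> B"
  shows "norm (cfourier F k) \<le> B"
proof -
  note V = content_cube[where 'n='n]
  have "(0::real^'n) \<in> cube" by (simp add: mem_box_cart)
  then have B0: "0 \<le> B" using B order_trans[OF norm_ge_zero] by blast
  have "norm (integral cube (\<lambda>x. wave (- k) x *s F x)) \<le> B * Henstock_Kurzweil_Integration.content (cube :: (real^'n) set)"
    by (rule integrable_bound[OF B0])
       (auto intro!: integrable_continuous continuous_intros continuous_on_subset[OF F] simp: norm_vector_smult B)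
  then have "norm (integral cube (\<lambda>x. wave (- k) x *s F x)) \<le> B * (2 * pi) ^ CARD('n)" unfolding V .
  moreover have "norm (cfourier F k) = norm (integral cube (\<lambda>x. wave (- k) x *s F x)) / (2 * pi) ^ CARD('n)"
    by (simp add: cfourier_def)
  ultimately show ?thesis by (simp only: pos_divide_le_eq zero_less_power pi_gt_zero mult_pos_pos zero_less_numeral)
qed

section \<open>Smooth functions\<close>

lemma Ck_on_cong:
  assumes "Ck_on k S f" "\<And>x. x \<in> S \<Longrightarrow> f x = g x"
  shows "Ck_on k S g"
proof (cases k)
  case 0 then show ?thesis using assms continuous_on_cong[of S S f g] by simp
next
  case (Suc k')
  then obtain f' where f': "\<forall>x\<in>S. (f has_derivative f' x) (at x within S)" "\<forall>v. Ck_on k' S (\<lambda>x. f' x v)"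
    using assms(1) by auto
  have "\<forall>x\<in>S. (g has_derivative f' x) (at x within S)"
    using f'(1) assms(2) has_derivative_transform by metis
  then show ?thesis using f'(2) Suc by auto
qed

text \<open>Every point can be moved by small amounts along each axis without leaving
  \<open>S\<close>. This makes derivatives within \<open>S\<close> unique, also at the initial time
  of a slab, where only one sign is possible.\<close>

definition dense_dirs :: "'a::euclidean_space set \<Rightarrow> bool" where
  "dense_dirs S \<longleftrightarrow> (\<forall>z\<in>S. \<forall>i\<in>Basis. \<forall>e>0. \<exists>d. 0 < \<bar>d\<bar> \<and> \<bar>d\<bar> < e \<and> z + d *\<^sub>R i \<in> S)"

lemma dense_dirs_UNIV: "dense_dirs UNIV"
  unfolding dense_dirs_def by (intro ballI allI impI, rule_tac x="e/2" in exI) auto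

lemma time_interval_later:
  assumes "t \<in> time_interval T"
  shows "\<exists>b\<in>time_interval T. t < b"
proof -
  obtain b where b: "ereal t < b" "b < T" using assms unfolding time_interval_def using dense by blast
  then obtain b' where "b = ereal b'" by (cases b) auto
  then show ?thesis using b assms by (intro bexI[of _ b']) (auto simp: time_interval_def)
qed

lemma time_interval_down: "t \<in> time_interval T \<Longrightarrow> 0 \<le> s \<Longrightarrow> s \<le> t \<Longrightarrow> s \<in> time_interval T"
  unfolding time_interval_def by (auto intro: le_less_trans[of "ereal s" "ereal t" T])

lemma time_interval_subset: "b \<in> time_interval T \<Longrightarrow> {0..b} \<subseteq> time_interval T"
  using time_interval_down by auto

lemma convex_time_interval: "convex (time_interval T)"
  unfolding is_interval_convex_1[symmetric] is_interval_1
proof (intro ballI allI impI)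
  fix a b x assume "a \<in> time_interval T" "b \<in> time_interval T" "a \<le> x \<and> x \<le> b"
  then show "x \<in> time_interval T" using time_interval_down[of b T x] by (simp add: time_interval_def)
qed

lemma time_interval_at:
  assumes "t \<in> time_interval T" "b \<in> time_interval T" "t < b"
  shows "at t within time_interval T = at t within {0..b}"
  by (rule at_within_nhd[of t "{..<b}"]) (use assms time_interval_subset[OF assms(2)] in \<open>auto simp: time_interval_def\<close>)

lemma slab_at:
  assumes "t \<in> time_interval T" "b \<in> time_interval T" "t < b"
  shows "at (x, t) within (UNIV \<times> time_interval T) = at (x, t) within (UNIV \<times> {0..b})"
  by (rule at_within_nhd[of "(x, t)" "UNIV \<times> {..<b}"])
     (use assms time_interval_subset[OF assms(2)] in \<open>auto simp: time_interval_def intro: open_Times\<close>)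

lemma time_interval_nontrivial: "t \<in> time_interval T \<Longrightarrow> at t within time_interval T \<noteq> bot"
proof -
  assume t: "t \<in> time_interval T"
  then obtain b where b: "b \<in> time_interval T" "t < b" using time_interval_later by blast
  have "0 \<le> t" using t by (simp add: time_interval_def)
  then have "t islimpt {0..b}"
    by (intro islimpt_subset[OF islimpt_greaterThanLessThan1[OF b(2)]]) auto
  then show ?thesis unfolding time_interval_at[OF t b] by (simp add: trivial_limit_within)
qed

lemma dense_dirs_slab: "dense_dirs (UNIV \<times> time_interval T :: ('a::euclidean_space \<times> real) set)"
  unfolding dense_dirs_def
proof (intro ballI allI impI)
  fix z i :: "'a \<times> real" and e :: real
  assume z: "z \<in> UNIV \<times> time_interval T" and i: "i \<in> Basis" and e: "e > 0"
  obtain x t where xt: "z = (x, t)" by (cases z)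
  then have t: "t \<in> time_interval T" using z by auto
  obtain b where b: "b \<in> time_interval T" "t < b" using time_interval_later[OF t] by blast
  have t0: "0 \<le> t" using t by (simp add: time_interval_def)
  define d where "d = min (e / 2) (b - t)"
  have d: "0 < d" "d < e" "t + d \<le> b" using e b by (auto simp: d_def)
  have "snd i = 0 \<or> snd i = 1" using i by (auto simp: Basis_prod_def)
  then have "t + d * snd i \<in> time_interval T" using d t0 t by (auto intro: time_interval_down[OF b(1)])
  then show "\<exists>d. 0 < \<bar>d\<bar> \<and> \<bar>d\<bar> < e \<and> z + d *\<^sub>R i \<in> UNIV \<times> time_interval T"
    using d by (intro exI[of _ d]) (auto simp: xt mem_Times_iff)
qed

text \<open>The definition of smoothness provides a separate derivative for each order of
  differentiability. Uniqueness of derivatives identifies them, so that a single derivative is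
  itself smooth.\<close>

lemma smooth_on_derivative:
  fixes f :: "'a::euclidean_space \<Rightarrow> 'b::real_normed_vector"
  assumes S: "dense_dirs S" and f: "smooth_on S f"
  obtains f' where "\<And>z. z \<in> S \<Longrightarrow> (f has_derivative f' z) (at z within S)" "\<And>v. smooth_on S (\<lambda>z. f' z v)"
proof -
  have "\<forall>k. \<exists>f'. (\<forall>x\<in>S. (f has_derivative f' x) (at x within S)) \<and> (\<forall>v. Ck_on k S (\<lambda>x. f' x v))"
  proof
    fix k
    have "Ck_on (Suc k) S f" using f unfolding smooth_on_def by blast
    then show "\<exists>f'. (\<forall>x\<in>S. (f has_derivative f' x) (at x within S)) \<and> (\<forall>v. Ck_on k S (\<lambda>x. f' x v))"
      by simp
  qed
  then obtain F where F: "\<And>k x. x \<in> S \<Longrightarrow> (f has_derivative F k x) (at x within S)" "\<And>k v. Ck_on k S (\<lambda>x. F k x v)"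
    by metis
  have eq: "F k x = F 0 x" if "x \<in> S" for k x
    by (rule frechet_derivative_unique_within[OF F(1)[OF that] F(1)[OF that]]) (use S that in \<open>auto simp: dense_dirs_def\<close>)
  have "Ck_on k S (\<lambda>x. F 0 x v)" for k v
    by (rule Ck_on_cong[OF F(2)[of k v] fun_cong[OF eq]])
  then show ?thesis using that[of "F 0"] F(1) by (simp add: smooth_on_def)
qed

lemma smooth_on_continuous: "smooth_on S f \<Longrightarrow> continuous_on S f"
  unfolding smooth_on_def by (metis Ck_on.simps(1))

lemma Ck_on_slice:
  fixes F :: "'a::euclidean_space \<times> real \<Rightarrow> 'b::real_normed_vector"
  assumes "Ck_on k (UNIV \<times> I) F" "t \<in> I"
  shows "Ck_on k UNIV (\<lambda>x. F (x, t))"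
  using assms(1)
proof (induction k arbitrary: F)
  case 0
  then have "continuous_on (UNIV \<times> I) F" by simp
  then show ?case using assms(2) by (auto intro!: continuous_on_compose2[of "UNIV \<times> I" F] continuous_intros)
next
  case (Suc k)
  then obtain F' where F': "\<And>z. z \<in> UNIV \<times> I \<Longrightarrow> (F has_derivative F' z) (at z within UNIV \<times> I)"
    "\<And>v. Ck_on k (UNIV \<times> I) (\<lambda>z. F' z v)" by auto
  have "((\<lambda>x. F (x, t)) has_derivative (\<lambda>h. F' (x, t) (h, 0))) (at x)" for x
  proof -
    have "((\<lambda>x. (x, t)) has_derivative (\<lambda>h. (h, 0))) (at x)" by (auto intro!: derivative_eq_intros)
    moreover have "(F has_derivative F' (x, t)) (at (x, t) within range (\<lambda>x. (x, t)))"
      by (rule has_derivative_subset[OF F'(1)]) (use assms(2) in auto)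
    ultimately show ?thesis by (rule has_derivative_in_compose)
  qed
  then show ?case using Suc.IH[OF F'(2)] by (auto intro!: exI[of _ "\<lambda>x h. F' (x, t) (h, 0)"])
qed

lemma smooth_on_slice:
  fixes F :: "'a::euclidean_space \<times> real \<Rightarrow> 'b::real_normed_vector"
  shows "smooth_on (UNIV \<times> I) F \<Longrightarrow> t \<in> I \<Longrightarrow> smooth_on UNIV (\<lambda>x. F (x, t))"
  unfolding smooth_on_def by (intro allI Ck_on_slice[where F=F and I=I]) auto

lemma slab_derivative:
  fixes F :: "'a::euclidean_space \<times> real \<Rightarrow> 'b::real_normed_vector"
  assumes F: "smooth_on (UNIV \<times> time_interval T) F"
  obtains F' :: "'a \<times> real \<Rightarrow> 'a \<times> real \<Rightarrow> 'b" where "\<And>v. smooth_on (UNIV \<times> time_interval T) (\<lambda>z. F' z v)"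
    "\<And>x t. t \<in> time_interval T \<Longrightarrow> ((\<lambda>x. F (x, t)) has_derivative (\<lambda>h. F' (x, t) (h, 0))) (at x)"
    "\<And>x t. t \<in> time_interval T \<Longrightarrow> ((\<lambda>s. F (x, s)) has_vector_derivative F' (x, t) (0, 1)) (at t within time_interval T)"
proof -
  let ?I = "time_interval T"
  obtain F' where F': "\<And>z. z \<in> UNIV \<times> ?I \<Longrightarrow> (F has_derivative F' z) (at z within UNIV \<times> ?I)"
    "\<And>v. smooth_on (UNIV \<times> ?I) (\<lambda>z. F' z v)"
    using smooth_on_derivative[OF dense_dirs_slab F] by blast
  have 1: "((\<lambda>x. F (x, t)) has_derivative (\<lambda>h. F' (x, t) (h, 0))) (at x)" if "t \<in> ?I" for x t
  proof -
    have "((\<lambda>x. (x, t)) has_derivative (\<lambda>h. (h, 0))) (at x)" by (auto intro!: derivative_eq_intros)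
    moreover have "(F has_derivative F' (x, t)) (at (x, t) within range (\<lambda>x. (x, t)))"
      by (rule has_derivative_subset[OF F'(1)]) (use that in auto)
    ultimately show ?thesis by (rule has_derivative_in_compose)
  qed
  have 2: "((\<lambda>s. F (x, s)) has_vector_derivative F' (x, t) (0, 1)) (at t within ?I)" if "t \<in> ?I" for x t
  proof -
    have "((\<lambda>s. (x, s)) has_derivative (\<lambda>h. (0, h))) (at t within ?I)" by (auto intro!: derivative_eq_intros)
    moreover have "(F has_derivative F' (x, t)) (at (x, t) within (\<lambda>s. (x, s)) ` ?I)"
      by (rule has_derivative_subset[OF F'(1)]) (use that in auto)
    ultimately have d: "((\<lambda>s. F (x, s)) has_derivative (\<lambda>h. F' (x, t) (0, h))) (at t within ?I)" by (rule has_derivative_in_compose)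
    have l: "F' (x, t) (0, h) = h *\<^sub>R F' (x, t) (0, 1)" for h
    proof -
      have "linear (F' (x, t))" using F'(1)[of "(x, t)"] that has_derivative_linear by blast
      from linear_cmul[OF this, of h "(0, 1)"] show ?thesis by simp
    qed
    have "(\<lambda>h. F' (x, t) (0, h)) = (\<lambda>h. h *\<^sub>R F' (x, t) (0, 1))" by (rule ext) (rule l)
    then show ?thesis using d unfolding has_vector_derivative_def by metis
  qed
  show ?thesis
  proof (rule that[of F'])
    show "smooth_on (UNIV \<times> ?I) (\<lambda>z. F' z v)" for v by (rule F'(2))
  qed (fact 1, fact 2)
qed

section \<open>Smooth periodic vector fields\<close>

lemma axis_vector_derivative:
  fixes f :: "real^'n \<Rightarrow> 'b::real_normed_vector"
  assumes "(f has_derivative f') (at x)"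
  shows "((\<lambda>s. f (x + axis i s)) has_vector_derivative f' (axis i 1)) (at 0)"
proof -
  have e: "axis i s = s *\<^sub>R (axis i 1 :: real^'n)" for s :: real by (simp add: axis_def vec_eq_iff)
  have "((\<lambda>s. x + s *\<^sub>R axis i 1) has_derivative (\<lambda>s. s *\<^sub>R axis i 1)) (at 0)" by (auto intro!: derivative_eq_intros)
  moreover have "(f has_derivative f') (at (x + 0 *\<^sub>R axis i 1))" using assms by simp
  ultimately have "((\<lambda>s. f (x + s *\<^sub>R axis i 1)) has_derivative (\<lambda>s. f' (s *\<^sub>R axis i 1))) (at 0)"
    by (rule has_derivative_compose)
  moreover have "f' (s *\<^sub>R axis i 1) = s *\<^sub>R f' (axis i 1)" for s
    by (rule linear_cmul[OF has_derivative_linear[OF assms]])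
  ultimately have "((\<lambda>s. f (x + s *\<^sub>R axis i 1)) has_vector_derivative f' (axis i 1)) (at 0)"
    by (simp add: has_vector_derivative_def)
  moreover have "(\<lambda>s. f (x + axis i s)) = (\<lambda>s. f (x + s *\<^sub>R axis i 1))" by (rule ext) (subst e, rule refl)
  ultimately show ?thesis by simp
qed

lemma smooth_torus_continuous: "smooth_torus f \<Longrightarrow> continuous_on S f"
  unfolding smooth_torus_def using smooth_on_continuous continuous_on_subset by blast

lemma smooth_torus_periodic: "smooth_torus f \<Longrightarrow> torus_periodic f"
  unfolding smooth_torus_def by blast

lemma smooth_torus_partial:
  fixes f :: "real^'n \<Rightarrow> real^'n"
  assumes f: "smooth_torus f"
  shows "((\<lambda>s. f (x + axis i s)) has_vector_derivative partial i f x) (at 0)" "smooth_torus (partial i f)"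
proof -
  obtain f' where f': "\<And>z. (f has_derivative f' z) (at z)" "\<And>v. smooth_on UNIV (\<lambda>z. f' z v)"
    using smooth_on_derivative[OF dense_dirs_UNIV, of f] f unfolding smooth_torus_def by auto
  have p: "partial i f = (\<lambda>x. f' x (axis i 1))"
    using frechet_derivative_at[OF f'(1)] by (simp add: partial_def fun_eq_iff)
  show d: "((\<lambda>s. f (x + axis i s)) has_vector_derivative partial i f x) (at 0)" for x
    unfolding p by (rule axis_vector_derivative[OF f'(1)])
  have "partial i f (x + axis j (2 * pi)) = partial i f x" for x j
  proof (rule vector_derivative_unique_at[OF d])
    have "(\<lambda>s. f (x + axis j (2 * pi) + axis i s)) = (\<lambda>s. f (x + axis i s))"
    proof
      fix s
      have "f (x + axis j (2 * pi) + axis i s) = f ((x + axis i s) + axis j (2 * pi))" by (simp add: algebra_simps)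
      then show "f (x + axis j (2 * pi) + axis i s) = f (x + axis i s)"
        using smooth_torus_periodic[OF f] by (simp add: torus_periodic_def)
    qed
    then show "((\<lambda>s. f (x + axis j (2 * pi) + axis i s)) has_vector_derivative partial i f x) (at 0)" using d[of x] by simp
  qed
  then show "smooth_torus (partial i f)" unfolding smooth_torus_def torus_periodic_def p using f'(2) by auto
qed

lemma continuous_on_complex_vec [continuous_intros]:
  "continuous_on S f \<Longrightarrow> continuous_on S (\<lambda>x. complex_vec (f x :: real^'n))"
  by (rule bounded_linear.continuous_on[OF bounded_linear_complex_vec])

lemma norm_complex_vec [simp]: "norm (complex_vec v) = norm v"
  by (simp add: complex_vec_def norm_vec_def)

lemma torus_periodic_complex_vec: "torus_periodic f \<Longrightarrow> torus_periodic (\<lambda>x. complex_vec (f x))"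
  by (simp add: torus_periodic_def)

lemma fourier_coeff_partial:
  assumes f: "smooth_torus f"
  shows "fourier_coeff (partial i f) k = (\<i> * of_int (k $ i)) *s fourier_coeff f k"
  unfolding fourier_coeff_eq
proof (rule cfourier_derivative)
  show "((\<lambda>s. complex_vec (f (x + axis i s))) has_vector_derivative complex_vec (partial i f x)) (at 0)" for x
    by (rule bounded_linear.has_vector_derivative[OF bounded_linear_complex_vec smooth_torus_partial(1)[OF f]])
qed (intro continuous_intros torus_periodic_complex_vec smooth_torus_continuous smooth_torus_periodic smooth_torus_partial(2) f)+

lemma smooth_torus_partial_iter: "smooth_torus f \<Longrightarrow> smooth_torus ((partial i ^^ m) f)"
  by (induction m) (auto intro: smooth_torus_partial)

lemma fourier_coeff_partial_iter:
  "smooth_torus f \<Longrightarrow> fourier_coeff ((partial i ^^ m) f) k = ((\<i> * of_int (k $ i)) ^ m) *s fourier_coeff f k"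
proof (induction m)
  case (Suc m)
  then show ?case using fourier_coeff_partial[OF smooth_torus_partial_iter[OF Suc.prems, where i=i and m=m], of i k]
    by (simp add: vector_smult_assoc)
qed simp

lemma norm_fourier_coeff_le:
  assumes "smooth_torus f" "\<And>x. x \<in> cube \<Longrightarrow> norm (f x) \<le> B"
  shows "norm (fourier_coeff f k) \<le> B"
  unfolding fourier_coeff_eq
  by (rule norm_cfourier_le) (use assms in \<open>auto intro!: continuous_intros smooth_torus_continuous\<close>)

lemma bracket_power_le_components:
  fixes k :: "int^'n"
  shows "bracket k ^ p \<le> 2 ^ p * (1 + real CARD('n) ^ p * (\<Sum>j\<in>UNIV. \<bar>real_of_int (k $ j)\<bar> ^ p))"
proof -
  obtain i where i: "\<And>j. \<bar>real_of_int (k $ j)\<bar> \<le> \<bar>real_of_int (k $ i)\<bar>"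
  proof -
    have "finite (range (\<lambda>j. \<bar>real_of_int (k $ j)\<bar>))" by simp
    then have "Max (range (\<lambda>j. \<bar>real_of_int (k $ j)\<bar>)) \<in> range (\<lambda>j. \<bar>real_of_int (k $ j)\<bar>)" by (rule Max_in) auto
    then obtain i where "Max (range (\<lambda>j. \<bar>real_of_int (k $ j)\<bar>)) = \<bar>real_of_int (k $ i)\<bar>" by (rule imageE)
    then show ?thesis using that[of i] by (metis Max_ge finite finite_imageI rangeI)
  qed
  define a where "a = \<bar>real_of_int (k $ i)\<bar>"
  have "norm (freq k) \<le> (\<Sum>j\<in>UNIV. \<bar>freq k $ j\<bar>)" by (rule norm_le_l1_cart)
  also have "\<dots> \<le> (\<Sum>j\<in>(UNIV::'n set). a)" by (rule sum_mono) (use i in \<open>simp add: a_def\<close>)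
  finally have "bracket k \<le> 1 + real CARD('n) * a" by (simp add: bracket_def)
  also have "\<dots> \<le> 2 * max 1 (real CARD('n) * a)" by simp
  finally have "bracket k ^ p \<le> (2 * max 1 (real CARD('n) * a)) ^ p" by (rule power_mono) simp
  also have "\<dots> \<le> 2 ^ p * (1 + (real CARD('n) * a) ^ p)"
    by (simp add: power_mult_distrib max_def a_def)
  also have "(real CARD('n) * a) ^ p \<le> real CARD('n) ^ p * (\<Sum>j\<in>UNIV. \<bar>real_of_int (k $ j)\<bar> ^ p)"
    unfolding power_mult_distrib a_def
    by (intro mult_left_mono member_le_sum[where f="\<lambda>j. \<bar>real_of_int (k $ j)\<bar> ^ p"]) auto
  finally show ?thesis by simp
qed

text \<open>Differentiating \<open>p\<close> times in direction \<open>j\<close> multiplies the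
  coefficient by \<open>(i k\<^sub>j)\<^sup>p\<close>, and the weight is controlled by these powers
  of the components. The constant involves only suprema over the cube, which makes it uniform in
  further parameters such as time.\<close>

lemma fourier_coeff_decay:
  fixes f :: "real^'n \<Rightarrow> real^'n"
  assumes f: "smooth_torus f" and B: "\<And>x. x \<in> cube \<Longrightarrow> norm (f x) \<le> B"
    "\<And>j x. x \<in> cube \<Longrightarrow> norm ((partial j ^^ p) f x) \<le> B"
  shows "norm (fourier_coeff f k) * bracket k ^ p \<le> 2 ^ p * (B + real CARD('n) ^ p * (real CARD('n) * B))"
proof -
  have "\<bar>real_of_int (k $ j)\<bar> ^ p * norm (fourier_coeff f k) = norm (fourier_coeff ((partial j ^^ p) f) k)" for j
    by (simp add: fourier_coeff_partial_iter[OF f] norm_vector_smult norm_power norm_mult)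
  also have "norm (fourier_coeff ((partial j ^^ p) f) k) \<le> B" for j
    by (rule norm_fourier_coeff_le[OF smooth_torus_partial_iter[OF f] B(2)])
  finally have *: "\<bar>real_of_int (k $ j)\<bar> ^ p * norm (fourier_coeff f k) \<le> B" for j .
  have "norm (fourier_coeff f k) * bracket k ^ p \<le> norm (fourier_coeff f k) *
      (2 ^ p * (1 + real CARD('n) ^ p * (\<Sum>j\<in>UNIV. \<bar>real_of_int (k $ j)\<bar> ^ p)))"
    by (intro mult_left_mono bracket_power_le_components) simp
  also have "\<dots> = 2 ^ p * (norm (fourier_coeff f k) + real CARD('n) ^ p * (\<Sum>j\<in>UNIV. \<bar>real_of_int (k $ j)\<bar> ^ p * norm (fourier_coeff f k)))"
    by (simp add: sum_distrib_left sum_distrib_right algebra_simps)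
  also have "\<dots> \<le> 2 ^ p * (B + real CARD('n) ^ p * (\<Sum>j\<in>(UNIV::'n set). B))"
    by (intro mult_left_mono add_mono sum_mono * norm_fourier_coeff_le[OF f B(1)]) auto
  finally show ?thesis by simp
qed

lemma continuous_bounded_cube:
  assumes "continuous_on cube (f :: real^'n \<Rightarrow> 'b::real_normed_vector)"
  shows "\<exists>B. \<forall>x\<in>cube. norm (f x) \<le> B"
proof -
  have "bounded (f ` cube)" by (intro compact_imp_bounded compact_continuous_image assms compact_cbox)
  then show ?thesis by (auto simp: bounded_iff)
qed

lemma fourier_coeff_rapid:
  fixes f :: "real^'n \<Rightarrow> real^'n"
  assumes f: "smooth_torus f"
  shows "\<exists>Q. \<forall>k. norm (fourier_coeff f k) * bracket k ^ p \<le> Q"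
proof -
  obtain B0 where B0: "\<And>x. x \<in> cube \<Longrightarrow> norm (f x) \<le> B0"
    using continuous_bounded_cube[OF smooth_torus_continuous[OF f]] by blast
  have "\<forall>j. \<exists>B. \<forall>x\<in>cube. norm ((partial j ^^ p) f x) \<le> B"
    using continuous_bounded_cube[OF smooth_torus_continuous[OF smooth_torus_partial_iter[OF f]]] by blast
  then obtain B where B: "\<And>j x. x \<in> cube \<Longrightarrow> norm ((partial j ^^ p) f x) \<le> B j" by metis
  define M where "M = max B0 (Max (range B))"
  have "B j \<le> M" for j unfolding M_def by (simp add: max.coboundedI2)
  then have "norm (f x) \<le> M" "norm ((partial j ^^ p) f x) \<le> M" if "x \<in> cube" for j x
    using B0[OF that] B[OF that, of j] order_trans by (auto simp: M_def)
  then show ?thesis using fourier_coeff_decay[OF f, of M p] by blast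
qed

lemma slab_partial_iter:
  fixes F :: "(real^'n) \<times> real \<Rightarrow> real^'n"
  assumes "smooth_on (UNIV \<times> time_interval T) F"
  shows "\<exists>G. smooth_on (UNIV \<times> time_interval T) G \<and> (\<forall>t\<in>time_interval T. \<forall>x. (partial j ^^ m) (\<lambda>x. F (x, t)) x = G (x, t))"
proof (induction m)
  case 0 show ?case using assms by auto
next
  case (Suc m)
  then obtain G where G: "smooth_on (UNIV \<times> time_interval T) G" "\<And>t x. t \<in> time_interval T \<Longrightarrow> (partial j ^^ m) (\<lambda>x. F (x, t)) x = G (x, t)"
    by blast
  obtain G' :: "(real^'n) \<times> real \<Rightarrow> (real^'n) \<times> real \<Rightarrow> real^'n" where G': "\<And>v. smooth_on (UNIV \<times> time_interval T) (\<lambda>z. G' z v)"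
    "\<And>x t. t \<in> time_interval T \<Longrightarrow> ((\<lambda>x. G (x, t)) has_derivative (\<lambda>h. G' (x, t) (h, 0))) (at x)"
    "\<And>x t. t \<in> time_interval T \<Longrightarrow> ((\<lambda>s. G (x, s)) has_vector_derivative G' (x, t) (0, 1)) (at t within time_interval T)"
    using slab_derivative[OF G(1)] by blast
  have "(partial j ^^ Suc m) (\<lambda>x. F (x, t)) x = G' (x, t) (axis j 1, 0)" if t: "t \<in> time_interval T" for x t
  proof -
    have e: "(partial j ^^ m) (\<lambda>x. F (x, t)) = (\<lambda>x. G (x, t))" using G(2)[OF t] by auto
    have "(partial j ^^ Suc m) (\<lambda>x. F (x, t)) x = partial j ((partial j ^^ m) (\<lambda>x. F (x, t))) x" by simp
    also have "\<dots> = frechet_derivative (\<lambda>x. G (x, t)) (at x) (axis j 1)" unfolding e partial_def ..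
    also have "\<dots> = G' (x, t) (axis j 1, 0)" by (simp only: frechet_derivative_at[OF G'(2)[OF t], symmetric])
    finally show ?thesis .
  qed
  then show ?case using G'(1)[of "(axis j 1, 0)"] by (intro exI[of _ "\<lambda>z. G' z (axis j 1, 0)"]) auto
qed

lemma slab_bounded:
  fixes G :: "(real^'n) \<times> real \<Rightarrow> 'b::real_normed_vector"
  assumes G: "smooth_on (UNIV \<times> time_interval T) G" and b: "b \<in> time_interval T"
  shows "\<exists>B. \<forall>x\<in>cube. \<forall>t\<in>{0..b}. norm (G (x, t)) \<le> B"
proof -
  have "continuous_on (cube \<times> {0..b}) G"
    by (rule continuous_on_subset[OF smooth_on_continuous[OF G]]) (use time_interval_subset[OF b] in auto)
  then have "bounded (G ` (cube \<times> {0..b}))"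
    by (intro compact_imp_bounded compact_continuous_image compact_Times compact_cbox) auto
  then show ?thesis by (auto simp: bounded_iff)
qed

lemma slab_fourier_rapid:
  fixes F :: "(real^'n) \<times> real \<Rightarrow> real^'n"
  assumes F: "smooth_on (UNIV \<times> time_interval T) F" and per: "\<And>t. t \<in> time_interval T \<Longrightarrow> torus_periodic (\<lambda>x. F (x, t))"
    and b: "b \<in> time_interval T"
  shows "\<exists>C. \<forall>k. \<forall>t\<in>{0..b}. norm (fourier_coeff (\<lambda>x. F (x, t)) k) * bracket k ^ p \<le> C"
proof -
  obtain B0 where B0: "\<And>x t. x \<in> cube \<Longrightarrow> t \<in> {0..b} \<Longrightarrow> norm (F (x, t)) \<le> B0"
    using slab_bounded[OF F b] by blast
  have "\<forall>j. \<exists>B. \<forall>x\<in>cube. \<forall>t\<in>{0..b}. norm ((partial j ^^ p) (\<lambda>x. F (x, t)) x) \<le> B"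
  proof
    fix j
    obtain G where G: "smooth_on (UNIV \<times> time_interval T) G" "\<And>t x. t \<in> time_interval T \<Longrightarrow> (partial j ^^ p) (\<lambda>x. F (x, t)) x = G (x, t)"
      using slab_partial_iter[OF F] by blast
    then show "\<exists>B. \<forall>x\<in>cube. \<forall>t\<in>{0..b}. norm ((partial j ^^ p) (\<lambda>x. F (x, t)) x) \<le> B"
      using slab_bounded[OF G(1) b] time_interval_subset[OF b] by (metis subsetD)
  qed
  then obtain B where B: "\<And>j x t. x \<in> cube \<Longrightarrow> t \<in> {0..b} \<Longrightarrow> norm ((partial j ^^ p) (\<lambda>x. F (x, t)) x) \<le> B j" by metis
  define M where "M = max B0 (Max (range B))"
  have BM: "B j \<le> M" for j unfolding M_def by (simp add: max.coboundedI2)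
  have "norm (fourier_coeff (\<lambda>x. F (x, t)) k) * bracket k ^ p \<le> 2 ^ p * (M + real CARD('n) ^ p * (real CARD('n) * M))"
    if t: "t \<in> {0..b}" for k t
  proof (rule fourier_coeff_decay)
    show "smooth_torus (\<lambda>x. F (x, t))"
      unfolding smooth_torus_def using per smooth_on_slice[OF F] t time_interval_subset[OF b] by blast
    show "norm (F (x, t)) \<le> M" if "x \<in> cube" for x using B0[OF that t] by (simp add: M_def)
    show "norm ((partial j ^^ p) (\<lambda>x. F (x, t)) x) \<le> M" if "x \<in> cube" for j x using B[OF that t] BM order_trans by blast
  qed
  then show ?thesis by blast
qed

lemma smooth_torus_summable:
  assumes "smooth_torus f" shows "(\<lambda>k. norm (fourier_coeff f k)) summable_on UNIV"
  using fourier_coeff_rapid[OF assms] decay_summable(1) by blast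

lemma smooth_torus_inversion:
  assumes f: "smooth_torus f"
  shows "complex_vec (f x) = (\<Sum>\<^sub>\<infinity>k. wave k x *s fourier_coeff f k)"
  unfolding fourier_coeff_eq
  by (rule fourier_inversion)
     (use smooth_torus_summable[OF f] in \<open>auto simp: fourier_coeff_eq intro!: continuous_intros torus_periodic_complex_vec smooth_torus_continuous smooth_torus_periodic f\<close>)

lemma smooth_torus_eqI:
  assumes "smooth_torus f" "smooth_torus g" "\<And>k. fourier_coeff f k = fourier_coeff g k"
  shows "f x = g x"
proof -
  have "complex_vec (f x) = complex_vec (g x)"
    unfolding smooth_torus_inversion[OF assms(1)] smooth_torus_inversion[OF assms(2)] assms(3) ..
  then show ?thesis by (simp add: complex_vec_def vec_eq_iff)
qed

lemma cfourier_sum: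
  fixes F :: "'j \<Rightarrow> real^'n \<Rightarrow> complex^'n"
  assumes "finite J" "\<And>j. j \<in> J \<Longrightarrow> continuous_on UNIV (F j)"
  shows "cfourier (\<lambda>x. \<Sum>j\<in>J. F j x) k = (\<Sum>j\<in>J. cfourier (F j) k)"
proof -
  have "(\<lambda>x. wave (- k) x *s (\<Sum>j\<in>J. F j x)) = (\<lambda>x. \<Sum>j\<in>J. wave (- k) x *s F j x)"
    by (simp add: fun_eq_iff vec_eq_iff sum_distrib_left)
  moreover have "integral cube (\<lambda>x. \<Sum>j\<in>J. wave (- k) x *s F j x) = (\<Sum>j\<in>J. integral cube (\<lambda>x. wave (- k) x *s F j x))"
    by (intro integral_sum integrable_continuous continuous_intros continuous_on_subset[OF assms(2)] assms(1)) auto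
  ultimately show ?thesis by (simp add: cfourier_def scaleR_sum_right)
qed

lemma laplacian_eq_sum: "complex_vec (laplacian f x) = (\<Sum>i\<in>UNIV. complex_vec (partial i (partial i f) x))"
  unfolding laplacian_def by (rule linear_sum[OF bounded_linear.linear[OF bounded_linear_complex_vec]])

lemma cfourier_laplacian:
  fixes f :: "real^'n \<Rightarrow> real^'n"
  assumes f: "smooth_torus f"
  shows "cfourier (\<lambda>x. complex_vec (laplacian f x)) k = - ((norm (freq k))\<^sup>2) *\<^sub>R fourier_coeff f k"
    and "continuous_on UNIV (\<lambda>x. complex_vec (laplacian f x))"
    and "torus_periodic (\<lambda>x. complex_vec (laplacian f x))"
proof -
  have s: "smooth_torus (partial i (partial i f))" for i by (intro smooth_torus_partial(2) f)
  have c: "continuous_on UNIV (\<lambda>x. complex_vec (partial i (partial i f) x))" for i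
    by (intro continuous_intros smooth_torus_continuous s)
  show "continuous_on UNIV (\<lambda>x. complex_vec (laplacian f x))" unfolding laplacian_eq_sum by (intro continuous_intros c)
  show "torus_periodic (\<lambda>x. complex_vec (laplacian f x))"
    using smooth_torus_periodic[OF s] by (simp add: laplacian_eq_sum torus_periodic_def)
  have "cfourier (\<lambda>x. complex_vec (laplacian f x)) k = (\<Sum>i\<in>UNIV. fourier_coeff (partial i (partial i f)) k)"
    unfolding laplacian_eq_sum fourier_coeff_eq by (rule cfourier_sum[OF _ c]) simp
  also have "\<dots> = (\<Sum>i\<in>UNIV. (- complex_of_real ((real_of_int (k $ i))\<^sup>2)) *s fourier_coeff f k)"
    by (simp add: fourier_coeff_partial smooth_torus_partial(2) f vector_smult_assoc power2_eq_square mult_ac)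
  also have "\<dots> = (\<Sum>i\<in>UNIV. - complex_of_real ((real_of_int (k $ i))\<^sup>2)) *s fourier_coeff f k"
    by (simp add: vec_eq_iff sum_distrib_right)
  also have "(\<Sum>i\<in>UNIV. - complex_of_real ((real_of_int (k $ i))\<^sup>2)) = of_real (- (norm (freq k))\<^sup>2)"
    by (simp add: norm_vec_def L2_set_def sum_nonneg sum_negf)
  also have "of_real (- (norm (freq k))\<^sup>2) *s fourier_coeff f k = - ((norm (freq k))\<^sup>2) *\<^sub>R fourier_coeff f k"
    by (rule scaleR_eq_smult[symmetric])
  finally show "cfourier (\<lambda>x. complex_vec (laplacian f x)) k = - ((norm (freq k))\<^sup>2) *\<^sub>R fourier_coeff f k" .
qed

lemma real_modes_fourier:
  fixes f :: "real^'n \<Rightarrow> real^'n"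
  assumes f: "smooth_torus f"
  shows "real_modes (fourier_coeff f)"
  unfolding real_modes_def
proof
  fix k
  have i: "(\<lambda>x. wave (- k) x *s complex_vec (f x)) integrable_on cube"
    by (intro integrable_continuous continuous_intros smooth_torus_continuous f)
  have "vcnj (fourier_coeff f k) = (1 / (2 * pi) ^ CARD('n)) *\<^sub>R vcnj (integral cube (\<lambda>x. wave (- k) x *s complex_vec (f x)))"
    unfolding fourier_coeff_def by (rule linear_cmul[OF bounded_linear.linear[OF bounded_linear_vcnj]])
  also have "vcnj (integral cube (\<lambda>x. wave (- k) x *s complex_vec (f x))) = integral cube (\<lambda>x. vcnj (wave (- k) x *s complex_vec (f x)))"
    using integral_linear[OF i bounded_linear_vcnj] by (simp add: o_def)
  also have "(\<lambda>x. vcnj (wave (- k) x *s complex_vec (f x))) = (\<lambda>x. wave (- (- k)) x *s complex_vec (f x))"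
    by (simp add: vcnj_def complex_vec_def vec_eq_iff wave_minus fun_eq_iff)
  finally show "fourier_coeff f (- k) = vcnj (fourier_coeff f k)" by (simp add: fourier_coeff_def)
qed

lemma solenoidal_fourier:
  fixes f :: "real^'n \<Rightarrow> real^'n"
  assumes f: "smooth_torus f"
  shows "solenoidal (fourier_coeff f) \<longleftrightarrow> (\<forall>x. div_field f x = 0)"
proof
  note sp = smooth_torus_partial(2)[OF f]
  have cf: "continuous_on UNIV (\<lambda>x. complex_vec (partial i f x))" for i
    by (intro continuous_intros smooth_torus_continuous sp)
  {
    assume d: "\<forall>x. div_field f x = 0"
    show "solenoidal (fourier_coeff f)"
      unfolding solenoidal_def
    proof
      fix k
      have "\<i> * cdot k (fourier_coeff f k) = (\<Sum>i\<in>UNIV. fourier_coeff (partial i f) k $ i)"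
        by (simp add: fourier_coeff_partial[OF f] cdot_def sum_distrib_left mult_ac)
      also have "\<dots> = (\<Sum>i\<in>UNIV. (1 / (2 * pi) ^ CARD('n)) *\<^sub>R integral cube (\<lambda>x. wave (- k) x * complex_vec (partial i f x) $ i))"
        unfolding fourier_coeff_eq by (simp add: cfourier_component[OF cf])
      also have "\<dots> = (1 / (2 * pi) ^ CARD('n)) *\<^sub>R integral cube (\<lambda>x. \<Sum>i\<in>UNIV. wave (- k) x * complex_vec (partial i f x) $ i)"
        unfolding scaleR_sum_right[symmetric]
        by (subst integral_sum) (auto intro!: integrable_continuous continuous_intros continuous_on_subset[OF cf])
      also have "(\<lambda>x. \<Sum>i\<in>UNIV. wave (- k) x * complex_vec (partial i f x) $ i) = (\<lambda>x. 0)"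
      proof
        fix x
        have "(\<Sum>i\<in>UNIV. wave (- k) x * complex_vec (partial i f x) $ i) = wave (- k) x * of_real (div_field f x)"
          by (simp add: complex_vec_def div_field_def sum_distrib_left)
        then show "(\<Sum>i\<in>UNIV. wave (- k) x * complex_vec (partial i f x) $ i) = 0" using d by simp
      qed
      finally show "cdot k (fourier_coeff f k) = 0" by simp
    qed
  }
  {
    assume s: "solenoidal (fourier_coeff f)"
    show "\<forall>x. div_field f x = 0"
    proof
      fix x
      have hs: "((\<lambda>k. (wave k x *s fourier_coeff (partial i f) k) $ i) has_sum complex_vec (partial i f x) $ i) UNIV" for i
        unfolding smooth_torus_inversion[OF sp]
        by (intro has_sum_bounded_linear[OF bounded_linear_component] has_sum_infsum series_summable[OF smooth_torus_summable[OF sp]])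
      have "((\<lambda>k. \<Sum>i\<in>UNIV. (wave k x *s fourier_coeff (partial i f) k) $ i) has_sum (\<Sum>i\<in>UNIV. complex_vec (partial i f x) $ i)) UNIV"
        by (rule has_sum_sum[OF hs])
      then have "((\<lambda>k. \<Sum>i\<in>UNIV. (wave k x *s fourier_coeff (partial i f) k) $ i) has_sum of_real (div_field f x)) UNIV"
        by (simp add: div_field_def complex_vec_def)
      moreover have "(\<Sum>i\<in>UNIV. (wave k x *s fourier_coeff (partial i f) k) $ i) = 0" for k
      proof -
        have "(\<Sum>i\<in>UNIV. (wave k x *s fourier_coeff (partial i f) k) $ i) = wave k x * \<i> * cdot k (fourier_coeff f k)"
          by (simp add: fourier_coeff_partial[OF f] cdot_def sum_distrib_left mult_ac)
        then show ?thesis using s by (simp add: solenoidal_def)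
      qed
      ultimately have "of_real (div_field f x) = (0::complex)" using has_sum_unique[OF _ has_sum_0_simp] by fastforce
      then show "div_field f x = 0" by simp
    qed
  }
qed

text \<open>The factor \<open>\<bar>k\<bar>\<close> in the nonlinearity costs one order of decay.\<close>

lemma nonlin_rapid:
  fixes a b :: "int^'n \<Rightarrow> complex^'n"
  assumes A: "\<And>k. norm (a k) * bracket k ^ (2 * CARD('n)) \<le> A" "\<And>k. norm (b k) * bracket k ^ (2 * CARD('n)) \<le> B"
    and Q: "\<And>k. norm (a k) * bracket k ^ Suc p \<le> Qa" "\<And>k. norm (b k) * bracket k ^ Suc p \<le> Qb"
  shows "norm (nonlin a b k) * bracket k ^ p \<le> 2 ^ Suc p * (Qa * (B * lattice_sum TYPE('n)) + A * lattice_sum TYPE('n) * Qb)"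
proof -
  define C where "C = 2 ^ Suc p * (Qa * (B * lattice_sum TYPE('n)) + A * lattice_sum TYPE('n) * Qb)"
  have "0 \<le> A" "0 \<le> B" "0 \<le> Qa" "0 \<le> Qb"
    using order_trans[OF _ A(1)[of 0]] order_trans[OF _ A(2)[of 0]] order_trans[OF _ Q(1)[of 0]] order_trans[OF _ Q(2)[of 0]] by simp_all
  then have C0: "0 \<le> C" using lattice_sum_pos[where 'n='n] by (simp add: C_def)
  have "norm (nonlin a b k) * bracket k ^ Suc p \<le> norm (freq k) * C"
    unfolding C_def
    by (rule nonlin_bound[OF decay_summable(1)[OF A(1)] decay_summable(1)[OF A(2)] decay_summable(3)[OF A(1)] decay_summable(3)[OF A(2)] Q])
  also have "\<dots> \<le> bracket k * C" by (rule mult_right_mono[OF freq_le_bracket C0])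
  finally have "bracket k * (norm (nonlin a b k) * bracket k ^ p) \<le> bracket k * C" by (simp add: algebra_simps)
  then show ?thesis unfolding C_def[symmetric] by (simp only: mult_le_cancel_left_pos[OF bracket_pos])
qed

lemma nonlin_fourier_rapid:
  fixes f :: "real^'n \<Rightarrow> real^'n"
  assumes f: "smooth_torus f"
  shows "(\<lambda>k. norm (nonlin (fourier_coeff f) (fourier_coeff f) k)) summable_on UNIV"
proof -
  obtain A where A: "\<And>k. norm (fourier_coeff f k) * bracket k ^ (2 * CARD('n)) \<le> A" using fourier_coeff_rapid[OF f] by blast
  obtain Q where Q: "\<And>k. norm (fourier_coeff f k) * bracket k ^ Suc (2 * CARD('n)) \<le> Q" using fourier_coeff_rapid[OF f] by blast
  show ?thesis by (rule decay_summable(1)[OF nonlin_rapid[OF A A Q Q]])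
qed

text \<open>Incompressibility moves the derivative in the advection term onto the whole product.\<close>

lemma leray_advection:
  fixes f :: "real^'n \<Rightarrow> real^'n"
  assumes f: "smooth_torus f" and d: "\<forall>x. div_field f x = 0"
  shows "leray (advection f) x = (\<Sum>\<^sub>\<infinity>k. wave k x *s (- nonlin (fourier_coeff f) (fourier_coeff f) k))"
proof -
  define c where "c = fourier_coeff f"
  note sp = smooth_torus_partial(2)[OF f]
  have sol: "cdot k (c k) = 0" for k using solenoidal_fourier[OF f] d unfolding c_def solenoidal_def by blast
  have "leray_symbol k *v fourier_coeff (advection f) k = - nonlin c c k" for k
  proof -
    have adv: "complex_vec (advection f x) = (\<Sum>j\<in>UNIV. of_real (f x $ j) *s complex_vec (partial j f x))" for x
      by (simp add: advection_def complex_vec_def vec_eq_iff)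
    have fc: "continuous_on UNIV (\<lambda>x. complex_of_real (f x $ j))" for j
      by (intro continuous_intros smooth_torus_continuous f)
    have "fourier_coeff (advection f) k = (\<Sum>j\<in>UNIV. cfourier (\<lambda>x. of_real (f x $ j) *s complex_vec (partial j f x)) k)"
      unfolding fourier_coeff_eq adv
    proof (rule cfourier_sum)
      show "continuous_on UNIV (\<lambda>x. complex_of_real (f x $ j) *s complex_vec (partial j f x))" for j
        by (intro continuous_intros fc smooth_torus_continuous sp)
    qed simp
    moreover have hs: "((\<lambda>l. c (k - l) $ j *s ((\<i> * of_int (l $ j)) *s c l)) has_sum
        cfourier (\<lambda>x. of_real (f x $ j) *s complex_vec (partial j f x)) k) UNIV" for j
    proof -
      have e: "(1 / (2 * pi) ^ CARD('n)) *\<^sub>R integral cube (\<lambda>x. wave (- m) x * complex_of_real (f x $ j)) = c m $ j" for m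
        unfolding c_def fourier_coeff_eq
        by (subst cfourier_component) (auto intro!: continuous_intros smooth_torus_continuous f simp: complex_vec_def)
      show ?thesis
        using cfourier_mult_series[OF smooth_torus_summable[OF sp[of j]] fc[of j], of k]
        unfolding smooth_torus_inversion[OF sp] e fourier_coeff_partial[OF f] c_def[symmetric] .
    qed
    have "((\<lambda>l. \<Sum>j\<in>UNIV. c (k - l) $ j *s ((\<i> * of_int (l $ j)) *s c l)) has_sum
        (\<Sum>j\<in>UNIV. cfourier (\<lambda>x. of_real (f x $ j) *s complex_vec (partial j f x)) k)) UNIV"
      by (rule has_sum_sum[OF hs])
    ultimately have "((\<lambda>l. \<Sum>j\<in>UNIV. c (k - l) $ j *s ((\<i> * of_int (l $ j)) *s c l)) has_sum fourier_coeff (advection f) k) UNIV"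
      by simp
    moreover have "(\<Sum>j\<in>UNIV. c (k - l) $ j *s ((\<i> * of_int (l $ j)) *s c l)) = (\<i> * cdot k (c (k - l))) *s c l" for l
    proof -
      have "cdot k (c (k - l)) = cdot l (c (k - l))"
        using sol[of "k - l"] by (simp add: cdot_def algebra_simps sum_subtractf)
      then show ?thesis
        by (simp add: vec_eq_iff cdot_def sum_distrib_left sum_distrib_right mult_ac)
    qed
    ultimately have "((\<lambda>l. (\<i> * cdot k (c (k - l))) *s c l) has_sum fourier_coeff (advection f) k) UNIV" by simp
    from has_sum_bounded_linear[OF bounded_linear_minus[OF bounded_linear_ident] has_sum_bounded_linear[OF bounded_linear_leray_symbol[of k] this]]
    have "((\<lambda>l. interaction k (c (k - l)) (c l)) has_sum - (leray_symbol k *v fourier_coeff (advection f) k)) UNIV"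
      by (simp add: interaction_def)
    then have "nonlin c c k = - (leray_symbol k *v fourier_coeff (advection f) k)" unfolding nonlin_def by (rule infsumI)
    then show ?thesis by simp
  qed
  then show ?thesis by (simp add: leray_def c_def)
qed

section \<open>Regularity of synthesised solutions\<close>

text \<open>Uniformity is required on closed subintervals \<open>{0..b}\<close> only: the constants
  may blow up at \<open>T\<close>.\<close>

definition rapid_on :: "ereal \<Rightarrow> (int^'n \<Rightarrow> real \<Rightarrow> complex^'n) \<Rightarrow> bool" where
  "rapid_on T c \<longleftrightarrow> (\<forall>p. \<forall>b\<in>time_interval T. \<exists>C. \<forall>k. \<forall>t\<in>{0..b}. norm (c k t) * bracket k ^ p \<le> C)"

text \<open>The modes have \<open>j\<close> continuous time derivatives, each of which decays
  rapidly. Decay of the derivatives is part of the notion since the series of derivatives has to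
  converge.\<close>

primrec time_smooth :: "nat \<Rightarrow> ereal \<Rightarrow> (int^'n \<Rightarrow> real \<Rightarrow> complex^'n) \<Rightarrow> bool" where
  "time_smooth 0 T c \<longleftrightarrow> rapid_on T c \<and> (\<forall>k. continuous_on (time_interval T) (c k))"
| "time_smooth (Suc j) T c \<longleftrightarrow> rapid_on T c \<and>
     (\<exists>c'. (\<forall>k. \<forall>t\<in>time_interval T. (c k has_vector_derivative c' k t) (at t within time_interval T)) \<and> time_smooth j T c')"

lemma rapid_onD:
  assumes "rapid_on T c" "b \<in> time_interval T"
  obtains C where "C \<ge> 0" "\<And>k t. t \<in> {0..b} \<Longrightarrow> norm (c k t) * bracket k ^ p \<le> C"
proof -
  obtain C where "\<forall>k. \<forall>t\<in>{0..b}. norm (c k t) * bracket k ^ p \<le> C"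
    using assms unfolding rapid_on_def by blast
  then have "\<forall>k. \<forall>t\<in>{0..b}. norm (c k t) * bracket k ^ p \<le> max 0 C" by (auto simp: le_max_iff_disj)
  then show ?thesis using that[of "max 0 C"] by auto
qed

lemma time_smooth_rapid: "time_smooth j T c \<Longrightarrow> rapid_on T c"
  by (cases j) auto

lemma time_smooth_continuous: "time_smooth j T c \<Longrightarrow> continuous_on (time_interval T) (c k)"
proof (cases j)
  case (Suc i)
  assume "time_smooth j T c"
  then obtain c' where "\<And>t. t \<in> time_interval T \<Longrightarrow> (c k has_vector_derivative c' k t) (at t within time_interval T)"
    using Suc by auto
  then show ?thesis by (meson continuous_on_eq_continuous_within has_vector_derivative_continuous)
qed auto

lemma time_smooth_mono: "time_smooth (Suc j) T c \<Longrightarrow> time_smooth j T c"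
proof (induction j arbitrary: c)
  case 0
  then show ?case using time_smooth_rapid[OF 0] time_smooth_continuous[OF 0] by simp
next
  case (Suc j)
  obtain c' where c': "\<forall>k. \<forall>t\<in>time_interval T. (c k has_vector_derivative c' k t) (at t within time_interval T)"
    "time_smooth (Suc j) T c'" using Suc.prems by (simp only: time_smooth.simps) blast
  then show ?case using Suc.IH[OF c'(2)] time_smooth_rapid[OF Suc.prems] by auto
qed

lemma rapid_on_add:
  assumes "rapid_on T a" "rapid_on T b"
  shows "rapid_on T (\<lambda>k t. a k t + b k t)"
  unfolding rapid_on_def
proof (intro allI ballI)
  fix p s assume s: "s \<in> time_interval T"
  obtain A where A: "\<And>k t. t \<in> {0..s} \<Longrightarrow> norm (a k t) * bracket k ^ p \<le> A" using rapid_onD[OF assms(1) s] by metis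
  obtain B where B: "\<And>k t. t \<in> {0..s} \<Longrightarrow> norm (b k t) * bracket k ^ p \<le> B" using rapid_onD[OF assms(2) s] by metis
  have "norm (a k t + b k t) * bracket k ^ p \<le> A + B" if "t \<in> {0..s}" for k t
  proof -
    have "norm (a k t + b k t) * bracket k ^ p \<le> (norm (a k t) + norm (b k t)) * bracket k ^ p"
      by (intro mult_right_mono norm_triangle_ineq) simp
    then show ?thesis using A[OF that, of k] B[OF that, of k] by (simp add: distrib_right)
  qed
  then show "\<exists>C. \<forall>k. \<forall>t\<in>{0..s}. norm (a k t + b k t) * bracket k ^ p \<le> C" by blast
qed

lemma time_smooth_add:
  "time_smooth j T a \<Longrightarrow> time_smooth j T b \<Longrightarrow> time_smooth j T (\<lambda>k t. a k t + b k t)"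
proof (induction j arbitrary: a b)
  case 0 then show ?case by (auto intro!: rapid_on_add continuous_intros)
next
  case (Suc j)
  obtain a' where a': "\<And>k t. t \<in> time_interval T \<Longrightarrow> (a k has_vector_derivative a' k t) (at t within time_interval T)"
    "time_smooth j T a'" using Suc.prems(1) by auto
  obtain b' where b': "\<And>k t. t \<in> time_interval T \<Longrightarrow> (b k has_vector_derivative b' k t) (at t within time_interval T)"
    "time_smooth j T b'" using Suc.prems(2) by auto
  have "rapid_on T (\<lambda>k t. a k t + b k t)" using Suc.prems by (auto intro: rapid_on_add)
  moreover have "\<forall>k. \<forall>t\<in>time_interval T. ((\<lambda>t. a k t + b k t) has_vector_derivative a' k t + b' k t) (at t within time_interval T)"
    using a'(1) b'(1) by (auto intro!: has_vector_derivative_add)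
  ultimately show ?case using Suc.IH[OF a'(2) b'(2)] by (auto intro!: exI[of _ "\<lambda>k t. a' k t + b' k t"])
qed

text \<open>Multipliers of polynomial growth arise from spatial derivatives and from the Laplacian;
  rapid decay absorbs them.\<close>

lemma time_smooth_multiplier:
  assumes L: "\<And>k. bounded_linear (L k)" "\<And>k v. norm (L k v) \<le> K * bracket k ^ q * norm v"
  shows "time_smooth j T c \<Longrightarrow> time_smooth j T (\<lambda>k t. L k (c k t))"
proof (induction j arbitrary: c)
  have rap: "rapid_on T (\<lambda>k t. L k (c k t))" if c: "rapid_on T c" for c
    unfolding rapid_on_def
  proof (intro allI ballI)
    fix p s assume s: "s \<in> time_interval T"
    obtain C where C: "C \<ge> 0" "\<And>k t. t \<in> {0..s} \<Longrightarrow> norm (c k t) * bracket k ^ (p + q) \<le> C" using rapid_onD[OF c s] by metis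
    have "norm (L k (c k t)) * bracket k ^ p \<le> \<bar>K\<bar> * C" if "t \<in> {0..s}" for k t
    proof -
      have "norm (L k (c k t)) \<le> \<bar>K\<bar> * bracket k ^ q * norm (c k t)"
        by (rule order_trans[OF L(2)]) (intro mult_right_mono, auto)
      then have "norm (L k (c k t)) * bracket k ^ p \<le> \<bar>K\<bar> * bracket k ^ q * norm (c k t) * bracket k ^ p"
        by (rule mult_right_mono) simp
      also have "\<dots> = \<bar>K\<bar> * (norm (c k t) * bracket k ^ (p + q))" by (simp add: power_add)
      also have "\<dots> \<le> \<bar>K\<bar> * C" by (rule mult_left_mono[OF C(2)[OF that]]) simp
      finally show ?thesis .
    qed
    then show "\<exists>C. \<forall>k. \<forall>t\<in>{0..s}. norm (L k (c k t)) * bracket k ^ p \<le> C" by blast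
  qed
  {
    case 0 then show ?case by (auto intro!: rap bounded_linear.continuous_on[OF L(1)])
  next
    case (Suc j)
    obtain c' where c': "\<And>k t. t \<in> time_interval T \<Longrightarrow> (c k has_vector_derivative c' k t) (at t within time_interval T)"
      "time_smooth j T c'" using Suc.prems by auto
    have "rapid_on T (\<lambda>k t. L k (c k t))" using Suc.prems by (auto intro: rap)
    moreover have "\<forall>k. \<forall>t\<in>time_interval T. ((\<lambda>t. L k (c k t)) has_vector_derivative L k (c' k t)) (at t within time_interval T)"
      using c'(1) by (auto intro!: bounded_linear.has_vector_derivative[OF L(1)])
    ultimately show ?case using Suc.IH[OF c'(2)] by (auto intro!: exI[of _ "\<lambda>k t. L k (c' k t)"])
  }
qed

lemma nonlin_vector_derivative:
  fixes a b a' b' :: "int^'n \<Rightarrow> real \<Rightarrow> complex^'n"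
  defines "P \<equiv> 2 * CARD('n)"
  assumes a: "\<And>k t. t \<in> {0..s} \<Longrightarrow> (a k has_vector_derivative a' k t) (at t within {0..s})"
    and b: "\<And>k t. t \<in> {0..s} \<Longrightarrow> (b k has_vector_derivative b' k t) (at t within {0..s})"
    and A: "\<And>k t. t \<in> {0..s} \<Longrightarrow> norm (a k t) * bracket k ^ P \<le> A" "\<And>k t. t \<in> {0..s} \<Longrightarrow> norm (a' k t) * bracket k ^ P \<le> A'"
    and B: "\<And>k t. t \<in> {0..s} \<Longrightarrow> norm (b k t) * bracket k ^ P \<le> B" "\<And>k t. t \<in> {0..s} \<Longrightarrow> norm (b' k t) * bracket k ^ P \<le> B'"
    and t: "t \<in> {0..s}"
  shows "((\<lambda>t. nonlin (\<lambda>k. a k t) (\<lambda>k. b k t) k) has_vector_derivative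
     nonlin (\<lambda>k. a k t) (\<lambda>k. b' k t) k + nonlin (\<lambda>k. a' k t) (\<lambda>k. b k t) k) (at t within {0..s})"
proof -
  have s: "(\<lambda>k. norm (a k r)) summable_on UNIV" "(\<lambda>k. norm (b k r)) summable_on UNIV"
    "(\<lambda>k. norm (a' k r)) summable_on UNIV" "(\<lambda>k. norm (b' k r)) summable_on UNIV" if "r \<in> {0..s}" for r
    using decay_summable(1)[OF A(1)[OF that, unfolded P_def]] decay_summable(1)[OF A(2)[OF that, unfolded P_def]]
      decay_summable(1)[OF B(1)[OF that, unfolded P_def]] decay_summable(1)[OF B(2)[OF that, unfolded P_def]] by auto
  note ns = nonlin_summable(2)[OF _ _ order.refl order.refl, where k=k]
  have "((\<lambda>t. \<Sum>\<^sub>\<infinity>l. interaction k (a (k - l) t) (b l t)) has_vector_derivative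
      (\<Sum>\<^sub>\<infinity>l. interaction k (a (k - l) t) (b' l t) + interaction k (a' (k - l) t) (b l t))) (at t within {0..s})"
  proof (rule has_vector_derivative_infsum[OF _ t, where M="\<lambda>l. norm (freq k) * (A * (B' * (1 / bracket l ^ P))) + norm (freq k) * (A' * (B * (1 / bracket l ^ P)))"])
    show "convex {0..s}" by simp
    fix l r assume r: "r \<in> {0..s}"
    show "((\<lambda>t. interaction k (a (k - l) t) (b l t)) has_vector_derivative interaction k (a (k - l) r) (b' l r) + interaction k (a' (k - l) r) (b l r)) (at r within {0..s})"
      by (rule bounded_bilinear.has_vector_derivative[OF bounded_bilinear_interaction a[OF r] b[OF r]])
    have 1: "norm (interaction k (u (k - l)) (v l)) \<le> norm (freq k) * (U * (V * (1 / bracket l ^ P)))"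
      if "\<And>k. norm (u k) * bracket k ^ P \<le> U" "\<And>k. norm (v k) * bracket k ^ P \<le> V" for u v :: "int^'n \<Rightarrow> complex^'n" and U V
    proof -
      have "norm (interaction k (u (k - l)) (v l)) \<le> norm (freq k) * (norm (u (k - l)) * norm (v l))" by (rule norm_interaction)
      also have "\<dots> \<le> norm (freq k) * (U * (V * (1 / bracket l ^ P)))"
      proof (intro mult_left_mono mult_mono norm_le_of_decay[OF that(1)])
        show "norm (v l) \<le> V * (1 / bracket l ^ P)" using that(2)[of l] by (simp add: pos_le_divide_eq)
        show "0 \<le> U" by (rule order_trans[OF norm_ge_zero norm_le_of_decay[OF that(1)]])
      qed auto
      finally show ?thesis .
    qed
    show "norm (interaction k (a (k - l) r) (b' l r) + interaction k (a' (k - l) r) (b l r))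
        \<le> norm (freq k) * (A * (B' * (1 / bracket l ^ P))) + norm (freq k) * (A' * (B * (1 / bracket l ^ P)))"
      by (rule order_trans[OF norm_triangle_ineq add_mono[OF
        1[where u="\<lambda>k. a k r" and v="\<lambda>k. b' k r", OF A(1)[OF r] B(2)[OF r]]
        1[where u="\<lambda>k. a' k r" and v="\<lambda>k. b k r", OF A(2)[OF r] B(1)[OF r]]]])
  next
    show "(\<lambda>l::int^'n. norm (freq k) * (A * (B' * (1 / bracket l ^ P))) + norm (freq k) * (A' * (B * (1 / bracket l ^ P)))) summable_on UNIV"
      unfolding P_def by (intro summable_on_add summable_on_cmult_right summable_bracket)
    show "(\<lambda>l. interaction k (a (k - l) r) (b l r)) summable_on UNIV" if "r \<in> {0..s}" for r
      by (rule ns[OF s(1)[OF that] s(2)[OF that]])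
  qed
  moreover have "(\<Sum>\<^sub>\<infinity>l. interaction k (a (k - l) t) (b' l t) + interaction k (a' (k - l) t) (b l t)) =
      nonlin (\<lambda>k. a k t) (\<lambda>k. b' k t) k + nonlin (\<lambda>k. a' k t) (\<lambda>k. b k t) k"
    unfolding nonlin_def by (rule infsum_add[OF ns[OF s(1)[OF t] s(4)[OF t]] ns[OF s(3)[OF t] s(2)[OF t]]])
  ultimately show ?thesis unfolding nonlin_def by simp
qed

lemma time_interval_vector_derivativeI:
  assumes t: "t \<in> time_interval T"
    and d: "\<And>b. b \<in> time_interval T \<Longrightarrow> t < b \<Longrightarrow> (f has_vector_derivative f') (at t within {0..b})"
  shows "(f has_vector_derivative f') (at t within time_interval T)"
  using time_interval_later[OF t] d time_interval_at[OF t] by metis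

lemma time_interval_continuousI:
  fixes f :: "real \<Rightarrow> 'b::real_normed_vector"
  assumes "\<And>b. b \<in> time_interval T \<Longrightarrow> continuous_on {0..b} f"
  shows "continuous_on (time_interval T) f"
  unfolding continuous_on_eq_continuous_within
proof
  fix t assume t: "t \<in> time_interval T"
  obtain b where b: "b \<in> time_interval T" "t < b" using time_interval_later[OF t] by blast
  have "continuous (at t within {0..b}) f"
    using assms[OF b(1)] t b(2) unfolding continuous_on_eq_continuous_within by (auto simp: time_interval_def)
  then show "continuous (at t within time_interval T) f" unfolding time_interval_at[OF t b] .
qed

lemma has_vector_derivative_subinterval:
  assumes "b \<in> time_interval T" "t \<in> {0..b}" "(f has_vector_derivative f') (at t within time_interval T)"
  shows "(f has_vector_derivative f') (at t within {0..b})"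
  using has_vector_derivative_within_subset[OF assms(3) time_interval_subset[OF assms(1)]] .

lemma rapid_on_nonlin:
  fixes a b :: "int^'n \<Rightarrow> real \<Rightarrow> complex^'n"
  assumes "rapid_on T a" "rapid_on T b"
  shows "rapid_on T (\<lambda>k t. nonlin (\<lambda>k. a k t) (\<lambda>k. b k t) k)"
  unfolding rapid_on_def
proof (intro allI ballI)
  fix p s assume s: "s \<in> time_interval T"
  obtain A where A: "\<And>k t. t \<in> {0..s} \<Longrightarrow> norm (a k t) * bracket k ^ (2 * CARD('n)) \<le> A" using rapid_onD[OF assms(1) s] by metis
  obtain B where B: "\<And>k t. t \<in> {0..s} \<Longrightarrow> norm (b k t) * bracket k ^ (2 * CARD('n)) \<le> B" using rapid_onD[OF assms(2) s] by metis
  obtain A' where A': "\<And>k t. t \<in> {0..s} \<Longrightarrow> norm (a k t) * bracket k ^ Suc p \<le> A'" using rapid_onD[OF assms(1) s] by metis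
  obtain B' where B': "\<And>k t. t \<in> {0..s} \<Longrightarrow> norm (b k t) * bracket k ^ Suc p \<le> B'" using rapid_onD[OF assms(2) s] by metis
  show "\<exists>C. \<forall>k. \<forall>t\<in>{0..s}. norm (nonlin (\<lambda>k. a k t) (\<lambda>k. b k t) k) * bracket k ^ p \<le> C"
    using nonlin_rapid[where a="\<lambda>k. a k t" and b="\<lambda>k. b k t" for t, OF A B A' B'] by blast
qed

lemma time_smooth_nonlin:
  fixes a b :: "int^'n \<Rightarrow> real \<Rightarrow> complex^'n"
  shows "time_smooth j T a \<Longrightarrow> time_smooth j T b \<Longrightarrow> time_smooth j T (\<lambda>k t. nonlin (\<lambda>k. a k t) (\<lambda>k. b k t) k)"
proof (induction j arbitrary: a b)
  case 0
  have "continuous_on (time_interval T) (\<lambda>t. nonlin (\<lambda>k. a k t) (\<lambda>k. b k t) k)" for k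
  proof (rule time_interval_continuousI)
    fix s assume s: "s \<in> time_interval T"
    obtain A where A: "\<And>k t. t \<in> {0..s} \<Longrightarrow> norm (a k t) * bracket k ^ (2 * CARD('n)) \<le> A" using rapid_onD[OF time_smooth_rapid[OF 0(1)] s] by metis
    obtain B where B: "\<And>k t. t \<in> {0..s} \<Longrightarrow> norm (b k t) * bracket k ^ (2 * CARD('n)) \<le> B" using rapid_onD[OF time_smooth_rapid[OF 0(2)] s] by metis
    show "continuous_on {0..s} (\<lambda>t. nonlin (\<lambda>k. a k t) (\<lambda>k. b k t) k)"
    proof (rule nonlin_continuous[where M="max A B"])
      show "continuous_on {0..s} (a k)" "continuous_on {0..s} (b k)" for k
        using time_smooth_continuous[OF 0(1)] time_smooth_continuous[OF 0(2)] time_interval_subset[OF s] continuous_on_subset by blast+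
      show "norm (a k t) \<le> max A B" if "t \<in> {0..s}" for k t using norm_le_of_decay[OF A[OF that]] by (rule max.coboundedI1)
      show "norm (b k t) * bracket k ^ (2 * CARD('n)) \<le> max A B" if "t \<in> {0..s}" for k t using B[OF that] by (rule max.coboundedI2)
    qed
  qed
  then show ?case using 0 by (auto intro: rapid_on_nonlin)
next
  case (Suc j)
  obtain a' where a': "\<And>k t. t \<in> time_interval T \<Longrightarrow> (a k has_vector_derivative a' k t) (at t within time_interval T)"
    "time_smooth j T a'" using Suc.prems(1) by auto
  obtain b' where b': "\<And>k t. t \<in> time_interval T \<Longrightarrow> (b k has_vector_derivative b' k t) (at t within time_interval T)"
    "time_smooth j T b'" using Suc.prems(2) by auto
  define c' where "c' k t = nonlin (\<lambda>k. a k t) (\<lambda>k. b' k t) k + nonlin (\<lambda>k. a' k t) (\<lambda>k. b k t) k" for k t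
  have "time_smooth j T c'"
    unfolding c'_def
    by (rule time_smooth_add[OF Suc.IH[OF time_smooth_mono[OF Suc.prems(1)] b'(2)] Suc.IH[OF a'(2) time_smooth_mono[OF Suc.prems(2)]]])
  moreover have "((\<lambda>t. nonlin (\<lambda>k. a k t) (\<lambda>k. b k t) k) has_vector_derivative c' k t) (at t within time_interval T)"
    if t: "t \<in> time_interval T" for k t
    unfolding c'_def
  proof (rule time_interval_vector_derivativeI[OF t])
    fix s assume s: "s \<in> time_interval T" "t < s"
    obtain A where A: "\<And>k t. t \<in> {0..s} \<Longrightarrow> norm (a k t) * bracket k ^ (2 * CARD('n)) \<le> A"
      using rapid_onD[OF time_smooth_rapid[OF Suc.prems(1)] s(1)] by metis
    obtain B where B: "\<And>k t. t \<in> {0..s} \<Longrightarrow> norm (b k t) * bracket k ^ (2 * CARD('n)) \<le> B"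
      using rapid_onD[OF time_smooth_rapid[OF Suc.prems(2)] s(1)] by metis
    obtain A' where A': "\<And>k t. t \<in> {0..s} \<Longrightarrow> norm (a' k t) * bracket k ^ (2 * CARD('n)) \<le> A'"
      using rapid_onD[OF time_smooth_rapid[OF a'(2)] s(1)] by metis
    obtain B' where B': "\<And>k t. t \<in> {0..s} \<Longrightarrow> norm (b' k t) * bracket k ^ (2 * CARD('n)) \<le> B'"
      using rapid_onD[OF time_smooth_rapid[OF b'(2)] s(1)] by metis
    have in_I: "r \<in> time_interval T" if "r \<in> {0..s}" for r using time_interval_subset[OF s(1)] that by blast
    show "((\<lambda>t. nonlin (\<lambda>k. a k t) (\<lambda>k. b k t) k) has_vector_derivative
      nonlin (\<lambda>k. a k t) (\<lambda>k. b' k t) k + nonlin (\<lambda>k. a' k t) (\<lambda>k. b k t) k) (at t within {0..s})"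
    proof (rule nonlin_vector_derivative[OF _ _ A A' B B'])
      show "(a k has_vector_derivative a' k r) (at r within {0..s})" if "r \<in> {0..s}" for k r
        by (rule has_vector_derivative_subinterval[OF s(1) that a'(1)[OF in_I[OF that]]])
      show "(b k has_vector_derivative b' k r) (at r within {0..s})" if "r \<in> {0..s}" for k r
        by (rule has_vector_derivative_subinterval[OF s(1) that b'(1)[OF in_I[OF that]]])
      show "t \<in> {0..s}" using t s(2) by (simp add: time_interval_def)
    qed
  qed
  moreover have "rapid_on T (\<lambda>k t. nonlin (\<lambda>k. a k t) (\<lambda>k. b k t) k)"
    by (rule rapid_on_nonlin[OF time_smooth_rapid[OF Suc.prems(1)] time_smooth_rapid[OF Suc.prems(2)]])
  ultimately show ?case by auto
qed

lemma mode_sol_vector_derivative: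
  assumes c: "\<And>b. b \<in> time_interval T \<Longrightarrow> mode_sol \<nu> b c" and t: "t \<in> time_interval T"
  shows "(c k has_vector_derivative (mode_rhs \<nu> (\<lambda>k. c k t) k)) (at t within time_interval T)"
proof (rule time_interval_vector_derivativeI[OF t])
  fix b assume b: "b \<in> time_interval T" "t < b"
  then have "t \<in> {0..b}" using t by (simp add: time_interval_def)
  then show "(c k has_vector_derivative (mode_rhs \<nu> (\<lambda>k. c k t) k)) (at t within {0..b})"
    using c[OF b(1)] unfolding mode_sol_def driven_def by blast
qed

text \<open>Bootstrap: the right-hand side of the mode equation is as smooth in time as the modes.\<close>

lemma mode_sol_time_smooth:
  assumes c: "\<And>b. b \<in> time_interval T \<Longrightarrow> mode_sol \<nu> b c"
  shows "time_smooth j T c"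
proof (induction j)
  have rap: "rapid_on T c" using c unfolding rapid_on_def mode_sol_def by blast
  {
    case 0
    have "continuous_on (time_interval T) (c k)" for k
      using mode_sol_vector_derivative[OF c] by (meson continuous_on_eq_continuous_within has_vector_derivative_continuous)
    then show ?case using rap by simp
  next
    case (Suc j)
    define c' where "c' k t = mode_rhs \<nu> (\<lambda>k. c k t) k" for k t
    have "time_smooth j T (\<lambda>k t. - (\<nu> * (norm (freq k))\<^sup>2) *\<^sub>R c k t)"
    proof (rule time_smooth_multiplier[where L="\<lambda>k v. - (\<nu> * (norm (freq k))\<^sup>2) *\<^sub>R v" and K="\<bar>\<nu>\<bar>" and q=2, OF _ _ Suc])
      show "norm (- (\<nu> * (norm (freq k))\<^sup>2) *\<^sub>R v) \<le> \<bar>\<nu>\<bar> * (bracket k)\<^sup>2 * norm v" for k and v :: "complex^'a"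
        by (auto simp: abs_mult intro!: mult_right_mono mult_left_mono power_mono freq_le_bracket)
    qed (rule bounded_linear_scaleR_right)
    then have "time_smooth j T c'" unfolding c'_def by (intro time_smooth_add time_smooth_nonlin Suc)
    moreover have "\<forall>k. \<forall>t\<in>time_interval T. (c k has_vector_derivative c' k t) (at t within time_interval T)"
      using mode_sol_vector_derivative[OF c] unfolding c'_def by blast
    ultimately show ?case using rap by auto
  }
qed

definition synth :: "(int^'n \<Rightarrow> real \<Rightarrow> complex^'n) \<Rightarrow> (real^'n) \<times> real \<Rightarrow> complex^'n" where
  "synth c z = (\<Sum>\<^sub>\<infinity>k. wave k (fst z) *s c k (snd z))"

lemma rapid_on_summable:
  fixes c :: "int^'n \<Rightarrow> real \<Rightarrow> complex^'n"
  assumes "rapid_on T c" "t \<in> time_interval T"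
  shows "(\<lambda>k. norm (c k t)) summable_on UNIV"
proof -
  obtain C where C: "\<And>k s. s \<in> {0..t} \<Longrightarrow> norm (c k s) * bracket k ^ (2 * CARD('n)) \<le> C" using rapid_onD[OF assms] by metis
  have "t \<in> {0..t}" using assms(2) by (simp add: time_interval_def)
  then show ?thesis using decay_summable(1)[where a="\<lambda>k. c k t", OF C] by blast
qed

lemma synth_continuous:
  fixes c :: "int^'n \<Rightarrow> real \<Rightarrow> complex^'n"
  assumes r: "rapid_on T c" and c: "\<And>k. continuous_on (time_interval T) (c k)"
  shows "continuous_on (UNIV \<times> time_interval T) (synth c)"
  unfolding continuous_on_eq_continuous_within
proof
  fix z assume "z \<in> (UNIV :: (real^'n) set) \<times> time_interval T"
  then obtain x t where z: "z = (x, t)" and t: "t \<in> time_interval T" by auto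
  obtain b where b: "b \<in> time_interval T" "t < b" using time_interval_later[OF t] by blast
  obtain C where C: "\<And>k s. s \<in> {0..b} \<Longrightarrow> norm (c k s) * bracket k ^ (2 * CARD('n)) \<le> C" using rapid_onD[OF r b(1)] by metis
  have cb: "continuous_on {0..b} (c k)" for k by (rule continuous_on_subset[OF c time_interval_subset[OF b(1)]])
  have "continuous_on (UNIV \<times> {0..b}) (synth c)"
    unfolding synth_def[abs_def]
  proof (rule continuous_on_infsum[where M="\<lambda>k. C * (1 / bracket k ^ (2 * CARD('n)))"])
    show "continuous_on (UNIV \<times> {0..b}) (\<lambda>z. wave k (fst z) *s c k (snd z))" for k
      by (intro continuous_intros continuous_on_compose2[OF continuous_on_wave[of UNIV]] continuous_on_compose2[OF cb]) auto
    show "norm (wave k (fst z) *s c k (snd z)) \<le> C * (1 / bracket k ^ (2 * CARD('n)))" if "z \<in> UNIV \<times> {0..b}" for k z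
      using C[of "snd z" k] that by (auto simp: norm_vector_smult pos_le_divide_eq)
  qed (intro summable_on_cmult_right summable_bracket)
  then have "continuous (at (x, t) within UNIV \<times> {0..b}) (synth c)"
    using b t unfolding continuous_on_eq_continuous_within by (auto simp: time_interval_def)
  then show "continuous (at z within UNIV \<times> time_interval T) (synth c)" unfolding z slab_at[OF t b] .
qed

text \<open>In a fixed direction the derivative is again the synthesis of a rapidly decaying family
  of modes, which makes an induction on the order of differentiability possible.\<close>

lemma synth_derivative:
  fixes c c' :: "int^'n \<Rightarrow> real \<Rightarrow> complex^'n"
  assumes r: "rapid_on T c" "rapid_on T c'"
    and c: "\<And>k t. t \<in> time_interval T \<Longrightarrow> (c k has_vector_derivative c' k t) (at t within time_interval T)"
    and t: "t \<in> time_interval T"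
  shows "(synth c has_derivative (\<lambda>h. synth (\<lambda>k t. (\<i> * of_real (freq k \<bullet> fst h)) *s c k t + snd h *\<^sub>R c' k t) (x, t)))
     (at (x, t) within UNIV \<times> time_interval T)"
proof -
  define P where "P = 2 * CARD('n)"
  obtain b where b: "b \<in> time_interval T" "t < b" using time_interval_later[OF t] by blast
  have in_I: "s \<in> time_interval T" if "s \<in> {0..b}" for s using time_interval_subset[OF b(1)] that by blast
  obtain C where C: "C \<ge> 0" "\<And>k s. s \<in> {0..b} \<Longrightarrow> norm (c k s) * bracket k ^ Suc P \<le> C" using rapid_onD[OF r(1) b(1)] by metis
  obtain C' where C': "C' \<ge> 0" "\<And>k s. s \<in> {0..b} \<Longrightarrow> norm (c' k s) * bracket k ^ P \<le> C'" using rapid_onD[OF r(2) b(1)] by metis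
  define f' where "f' k z h = wave k (fst z) *s (snd h *\<^sub>R c' k (snd z)) + ((\<i> * of_real (freq k \<bullet> fst h)) * wave k (fst z)) *s c k (snd z)"
    for k and z h :: "(real^'n) \<times> real"
  have "((\<lambda>z. \<Sum>\<^sub>\<infinity>k. wave k (fst z) *s c k (snd z)) has_derivative (\<lambda>h. \<Sum>\<^sub>\<infinity>k. f' k (x, t) h)) (at (x, t) within UNIV \<times> {0..b})"
  proof (rule has_derivative_infsum[where M="\<lambda>k. (C' + C) * (1 / bracket k ^ P)"])
    show "convex ((UNIV :: (real^'n) set) \<times> {0..b})" by (intro convex_Times) auto
    show "(x, t) \<in> UNIV \<times> {0..b}" using t b by (simp add: time_interval_def)
    show "0 \<le> (C' + C) * (1 / bracket k ^ P)" for k using C C' by simp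
    show "(\<lambda>k::int^'n. (C' + C) * (1 / bracket k ^ P)) summable_on UNIV"
      unfolding P_def by (intro summable_on_cmult_right summable_bracket)
    fix z :: "(real^'n) \<times> real" assume z: "z \<in> UNIV \<times> {0..b}"
    then have sz: "snd z \<in> {0..b}" by auto
    show "(\<lambda>k. wave k (fst z) *s c k (snd z)) summable_on UNIV"
      by (rule series_summable[OF rapid_on_summable[OF r(1) in_I[OF sz]]])
    fix k
    show "((\<lambda>z. wave k (fst z) *s c k (snd z)) has_derivative f' k z) (at z within UNIV \<times> {0..b})"
      unfolding f'_def
    proof (rule bounded_bilinear.FDERIV[OF bounded_bilinear_smult])
      show "((\<lambda>z. wave k (fst z)) has_derivative (\<lambda>h. \<i> * of_real (freq k \<bullet> fst h) * wave k (fst z))) (at z within UNIV \<times> {0..b})"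
        by (rule has_derivative_compose[OF has_derivative_fst[OF has_derivative_ident] has_derivative_wave])
      have "((\<lambda>z. c k (snd z)) has_derivative (\<lambda>h. (\<lambda>s. s *\<^sub>R c' k (snd z)) (snd h))) (at z within UNIV \<times> {0..b})"
      proof (rule has_derivative_in_compose[OF has_derivative_snd[OF has_derivative_ident]])
        have "snd ` ((UNIV :: (real^'n) set) \<times> {0..b}) = {0..b}" by (force simp: image_iff)
        then show "(c k has_derivative (\<lambda>s. s *\<^sub>R c' k (snd z))) (at (snd z) within snd ` ((UNIV :: (real^'n) set) \<times> {0..b}))"
          using has_vector_derivative_subinterval[OF b(1) sz c[OF in_I[OF sz]]] by (simp add: has_vector_derivative_def)
      qed
      then show "((\<lambda>z. c k (snd z)) has_derivative (\<lambda>h. snd h *\<^sub>R c' k (snd z))) (at z within UNIV \<times> {0..b})" .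
    qed
    fix h :: "(real^'n) \<times> real"
    have h: "\<bar>snd h\<bar> \<le> norm h" "norm (fst h) \<le> norm h" using norm_snd_le[of "snd h" "fst h"] norm_fst_le[of "fst h" "snd h"] by simp_all
    have "norm (f' k z h) \<le> norm (wave k (fst z) *s (snd h *\<^sub>R c' k (snd z))) + norm (((\<i> * of_real (freq k \<bullet> fst h)) * wave k (fst z)) *s c k (snd z))"
      unfolding f'_def by (rule norm_triangle_ineq)
    also have "\<dots> = \<bar>snd h\<bar> * norm (c' k (snd z)) + \<bar>freq k \<bullet> fst h\<bar> * norm (c k (snd z))"
      by (simp add: norm_vector_smult norm_mult)
    also have "\<dots> \<le> norm h * (C' * (1 / bracket k ^ P)) + norm h * (C * (1 / bracket k ^ P))"
    proof (rule add_mono)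
      show "\<bar>snd h\<bar> * norm (c' k (snd z)) \<le> norm h * (C' * (1 / bracket k ^ P))"
        by (rule mult_mono[OF h(1)]) (use C'(2)[OF sz, of k] in \<open>auto simp: pos_le_divide_eq\<close>)
      have "\<bar>freq k \<bullet> fst h\<bar> * norm (c k (snd z)) \<le> (bracket k * norm h) * norm (c k (snd z))"
        by (intro mult_right_mono order_trans[OF Cauchy_Schwarz_ineq2] mult_mono freq_le_bracket h) auto
      also have "\<dots> = norm h * (bracket k * norm (c k (snd z)))" by simp
      also have "\<dots> \<le> norm h * (C * (1 / bracket k ^ P))"
        by (rule mult_left_mono) (use C(2)[OF sz, of k] in \<open>auto simp: pos_le_divide_eq mult_ac\<close>)
      finally show "\<bar>freq k \<bullet> fst h\<bar> * norm (c k (snd z)) \<le> norm h * (C * (1 / bracket k ^ P))" .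
    qed
    also have "\<dots> = (C' + C) * (1 / bracket k ^ P) * norm h" by (simp add: distrib_right distrib_left add_divide_distrib mult_ac)
    finally show "norm (f' k z h) \<le> (C' + C) * (1 / bracket k ^ P) * norm h" .
  qed
  moreover have "f' k (x, t) h = wave k x *s ((\<i> * of_real (freq k \<bullet> fst h)) *s c k t + snd h *\<^sub>R c' k t)" for k h
    by (simp add: f'_def vec_eq_iff algebra_simps)
  ultimately show ?thesis unfolding slab_at[OF t b] synth_def[abs_def] by simp
qed

lemma synth_Ck:
  fixes c :: "int^'n \<Rightarrow> real \<Rightarrow> complex^'n"
  shows "time_smooth m T c \<Longrightarrow> Ck_on m (UNIV \<times> time_interval T) (synth c)"
proof (induction m arbitrary: c)
  case 0
  then show ?case using synth_continuous by auto
next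
  case (Suc m)
  obtain c' where c': "\<And>k t. t \<in> time_interval T \<Longrightarrow> (c k has_vector_derivative c' k t) (at t within time_interval T)"
    "time_smooth m T c'" using Suc.prems by auto
  define d where "d h k t = (\<i> * of_real (freq k \<bullet> fst h)) *s c k t + snd h *\<^sub>R c' k t" for h :: "(real^'n) \<times> real" and k t
  have "(synth c has_derivative (\<lambda>h. synth (d h) z)) (at z within UNIV \<times> time_interval T)" if "z \<in> UNIV \<times> time_interval T" for z
  proof -
    obtain x t where xt: "z = (x, t)" by (cases z)
    then have z: "z = (x, t)" "t \<in> time_interval T" using that by auto
    show ?thesis unfolding z(1) d_def[abs_def]
      by (rule synth_derivative[OF time_smooth_rapid[OF Suc.prems] time_smooth_rapid[OF c'(2)] c'(1) z(2)])
  qed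
  moreover have "Ck_on m (UNIV \<times> time_interval T) (synth (d h))" for h
  proof (rule Suc.IH)
    have "time_smooth m T (\<lambda>k t. (\<i> * of_real (freq k \<bullet> fst h)) *s c k t)"
    proof (rule time_smooth_multiplier[where L="\<lambda>k v. (\<i> * of_real (freq k \<bullet> fst h)) *s v" and K="norm (fst h)" and q=1, OF _ _ time_smooth_mono[OF Suc.prems]])
      show "norm ((\<i> * of_real (freq k \<bullet> fst h)) *s v) \<le> norm (fst h) * bracket k ^ 1 * norm v" for k and v :: "complex^'n"
      proof -
        have "\<bar>freq k \<bullet> fst h\<bar> \<le> bracket k * norm (fst h)"
          by (intro order_trans[OF Cauchy_Schwarz_ineq2] mult_right_mono freq_le_bracket) auto
        from mult_right_mono[OF this, of "norm v"] show ?thesis by (simp add: norm_vector_smult norm_mult mult_ac)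
      qed
    qed (rule bounded_linear_smult_right)
    moreover have "time_smooth m T (\<lambda>k t. snd h *\<^sub>R c' k t)"
      by (rule time_smooth_multiplier[where L="\<lambda>k v. snd h *\<^sub>R v" and K="\<bar>snd h\<bar>" and q=0, OF _ _ c'(2)])
         (auto intro: bounded_linear_scaleR_right)
    ultimately show "time_smooth m T (d h)" unfolding d_def by (rule time_smooth_add)
  qed
  ultimately show ?case by (auto intro!: exI[of _ "\<lambda>z h. synth (d h) z"])
qed

lemma Ck_on_bounded_linear:
  assumes L: "bounded_linear L"
  shows "Ck_on k S f \<Longrightarrow> Ck_on k S (\<lambda>x. L (f x))"
proof (induction k arbitrary: f)
  case 0 then show ?case by (auto intro: bounded_linear.continuous_on[OF L])
next
  case (Suc k)
  then obtain f' where f': "\<And>x. x \<in> S \<Longrightarrow> (f has_derivative f' x) (at x within S)" "\<And>v. Ck_on k S (\<lambda>x. f' x v)" by auto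
  then show ?case using Suc.IH[OF f'(2)] bounded_linear.has_derivative[OF L f'(1)]
    by (auto intro!: exI[of _ "\<lambda>x v. L (f' x v)"])
qed

definition real_part :: "complex^'n \<Rightarrow> real^'n" where
  "real_part v = (\<chi> j. Re (v $ j))"

lemma bounded_linear_real_part: "bounded_linear (real_part :: complex^'n \<Rightarrow> real^'n)"
  by (rule bounded_linear_intro[where K=1])
     (auto simp: real_part_def vec_eq_iff norm_vec_def intro!: L2_set_mono abs_Re_le_cmod)

lemma complex_vec_real_part: "vcnj v = v \<Longrightarrow> complex_vec (real_part v) = v"
proof -
  assume v: "vcnj v = v"
  have "cnj (v $ j) = v $ j" for j using arg_cong[OF v, of "\<lambda>v. v $ j"] by (simp add: vcnj_def)
  then show ?thesis by (simp add: complex_vec_def real_part_def vec_eq_iff complex_eq_iff)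
qed

lemma series_real:
  assumes r: "real_modes a" and s: "(\<lambda>k. norm (a k)) summable_on UNIV"
  shows "vcnj (\<Sum>\<^sub>\<infinity>k. wave k x *s a k) = (\<Sum>\<^sub>\<infinity>k. wave k x *s a k)"
proof -
  have "vcnj (\<Sum>\<^sub>\<infinity>k. wave k x *s a k) = (\<Sum>\<^sub>\<infinity>k. vcnj (wave k x *s a k))"
    by (rule infsum_bounded_linear_banach[OF bounded_linear_vcnj series_summable[OF s], symmetric])
  also have "\<dots> = (\<Sum>\<^sub>\<infinity>k. wave (- k) x *s a (- k))"
  proof (rule infsum_cong)
    fix k
    have "a (- k) = vcnj (a k)" using r unfolding real_modes_def by blast
    then show "vcnj (wave k x *s a k) = wave (- k) x *s a (- k)" by (simp add: vcnj_def vec_eq_iff wave_minus)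
  qed
  also have "\<dots> = (\<Sum>\<^sub>\<infinity>k. wave k x *s a k)"
    by (rule infsum_reindex_bij_betw[of uminus UNIV UNIV "\<lambda>k. wave k x *s a k"]) (simp add: bij_uminus)
  finally show ?thesis .
qed

section \<open>Solutions and their modes\<close>

text \<open>Both terms are the sums of their Fourier series, which combine to the right-hand side of
  the mode equation.\<close>

lemma projected_rhs:
  fixes f :: "real^'n \<Rightarrow> real^'n"
  assumes f: "smooth_torus f" and d: "\<forall>x. div_field f x = 0"
  shows "\<nu> *\<^sub>R complex_vec (laplacian f x) - leray (advection f) x =
    (\<Sum>\<^sub>\<infinity>k. wave k x *s (mode_rhs \<nu> (fourier_coeff f) k))"
proof -
  define a where "a = fourier_coeff f"
  have sl: "(\<lambda>k. norm (- ((norm (freq k))\<^sup>2) *\<^sub>R a k)) summable_on UNIV"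
  proof -
    obtain Q where Q: "\<And>k. norm (a k) * bracket k ^ (2 * CARD('n) + 2) \<le> Q" using fourier_coeff_rapid[OF f] unfolding a_def by blast
    show ?thesis
    proof (rule decay_summable(1))
      fix k
      have "norm (- ((norm (freq k))\<^sup>2) *\<^sub>R a k) * bracket k ^ (2 * CARD('n)) = (norm (freq k))\<^sup>2 * (norm (a k) * bracket k ^ (2 * CARD('n)))" by simp
      also have "\<dots> \<le> (bracket k)\<^sup>2 * (norm (a k) * bracket k ^ (2 * CARD('n)))"
        by (intro mult_right_mono power_mono freq_le_bracket) auto
      also have "\<dots> = norm (a k) * bracket k ^ (2 * CARD('n) + 2)" by (simp add: power_add power2_eq_square)
      also have "\<dots> \<le> Q" by (rule Q)
      finally show "norm (- ((norm (freq k))\<^sup>2) *\<^sub>R a k) * bracket k ^ (2 * CARD('n)) \<le> Q" .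
    qed
  qed
  have vl: "cfourier (\<lambda>x. complex_vec (laplacian f x)) = (\<lambda>k. - ((norm (freq k))\<^sup>2) *\<^sub>R a k)"
    using cfourier_laplacian(1)[OF f] unfolding a_def by blast
  have L: "complex_vec (laplacian f x) = (\<Sum>\<^sub>\<infinity>k. wave k x *s (- ((norm (freq k))\<^sup>2) *\<^sub>R a k))"
    using fourier_inversion[OF cfourier_laplacian(2,3)[OF f], of x] sl unfolding vl by blast
  have ss: "(\<lambda>k. wave k x *s (- ((norm (freq k))\<^sup>2) *\<^sub>R a k)) summable_on UNIV" by (rule series_summable[OF sl])
  have sn: "(\<lambda>k. norm (- nonlin a a k)) summable_on UNIV" using nonlin_fourier_rapid[OF f] unfolding a_def by simp
  have "\<nu> *\<^sub>R complex_vec (laplacian f x) - leray (advection f) x =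
      (\<Sum>\<^sub>\<infinity>k. \<nu> *\<^sub>R (wave k x *s (- ((norm (freq k))\<^sup>2) *\<^sub>R a k))) - (\<Sum>\<^sub>\<infinity>k. wave k x *s (- nonlin a a k))"
    unfolding L leray_advection[OF f d] a_def[symmetric] by (simp only: infsum_scaleR_right)
  also have "\<dots> = (\<Sum>\<^sub>\<infinity>k. \<nu> *\<^sub>R (wave k x *s (- ((norm (freq k))\<^sup>2) *\<^sub>R a k)) - wave k x *s (- nonlin a a k))"
    by (rule infsum_diff[symmetric]) (intro summable_on_scaleR_right ss series_summable[OF sn])+
  also have "\<dots> = (\<Sum>\<^sub>\<infinity>k. wave k x *s (- (\<nu> * (norm (freq k))\<^sup>2) *\<^sub>R a k + nonlin a a k))"
    by (rule infsum_cong) (simp add: vec_eq_iff algebra_simps)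
  finally show ?thesis unfolding a_def .
qed

text \<open>The time derivative of a coefficient is the coefficient of the right-hand side:
  smoothness on the slab permits differentiation under the integral, and it bounds the iterated
  partial derivatives uniformly on compact time intervals, which gives the decay.\<close>

lemma nse_solution_modes:
  fixes u :: "real^'n \<Rightarrow> real \<Rightarrow> real^'n"
  assumes u: "nse_solution \<nu> u\<^sub>0 T u" and b: "b \<in> time_interval T"
  shows "mode_sol \<nu> b (\<lambda>k t. fourier_coeff (\<lambda>x. u x t) k)"
proof -
  let ?I = "time_interval T"
  define F where "F = (\<lambda>(x, t). u x t)"
  define c where "c k t = fourier_coeff (\<lambda>x. u x t) k" for k t
  have F: "smooth_on (UNIV \<times> ?I) F" and per: "\<And>t. t \<in> ?I \<Longrightarrow> torus_periodic (\<lambda>x. F (x, t))"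
    using u unfolding nse_solution_def smooth_torus_time_def F_def by auto
  have eq: "((\<lambda>s. complex_vec (u x s)) has_vector_derivative
       (\<nu> *\<^sub>R complex_vec (laplacian (\<lambda>y. u y t) x) - leray (advection (\<lambda>y. u y t)) x)) (at t within ?I)" if "t \<in> ?I" for t x
    using u that unfolding nse_solution_def by blast
  have div: "\<forall>x. div_field (\<lambda>y. u y t) x = 0" if "t \<in> ?I" for t using u that unfolding nse_solution_def by blast
  have st: "smooth_torus (\<lambda>x. u x t)" if "t \<in> ?I" for t
    using smooth_on_slice[OF F that] per[OF that] unfolding smooth_torus_def F_def by simp
  have in_I: "s \<in> ?I" if "s \<in> {0..b}" for s using time_interval_subset[OF b] that by blast
  obtain F' :: "(real^'n) \<times> real \<Rightarrow> (real^'n) \<times> real \<Rightarrow> real^'n" where F': "\<And>v. smooth_on (UNIV \<times> ?I) (\<lambda>z. F' z v)"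
    "\<And>x t. t \<in> ?I \<Longrightarrow> ((\<lambda>x. F (x, t)) has_derivative (\<lambda>h. F' (x, t) (h, 0))) (at x)"
    "\<And>x t. t \<in> ?I \<Longrightarrow> ((\<lambda>s. F (x, s)) has_vector_derivative F' (x, t) (0, 1)) (at t within ?I)"
    using slab_derivative[OF F] by blast
  define v where "v z = F' z (0, 1)" for z
  have vc: "continuous_on (UNIV \<times> ?I) v" unfolding v_def by (rule smooth_on_continuous[OF F'(1)])
  have dv: "((\<lambda>s. complex_vec (u x s)) has_vector_derivative complex_vec (v (x, t))) (at t within ?I)" if "t \<in> ?I" for x t
    using bounded_linear.has_vector_derivative[OF bounded_linear_complex_vec F'(3)[OF that, of x]] by (simp add: F_def v_def)
  have v: "complex_vec (v (x, t)) = (\<Sum>\<^sub>\<infinity>k. wave k x *s (mode_rhs \<nu> (\<lambda>k. c k t) k))" if "t \<in> ?I" for x t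
    using vector_derivative_unique_within[OF time_interval_nontrivial[OF that] dv[OF that] eq[OF that]]
    unfolding projected_rhs[OF st[OF that] div[OF that]] c_def .
  have sm: "(\<lambda>k. norm (mode_rhs \<nu> (\<lambda>k. c k t) k)) summable_on UNIV" if t: "t \<in> ?I" for t
  proof -
    obtain Q where Q: "\<And>k. norm (c k t) * bracket k ^ (2 * CARD('n) + 2) \<le> Q" using fourier_coeff_rapid[OF st[OF t]] unfolding c_def by blast
    have "(\<lambda>k. \<bar>\<nu>\<bar> * (Q * (1 / bracket k ^ (2 * CARD('n)))) + norm (nonlin (\<lambda>k. c k t) (\<lambda>k. c k t) k)) summable_on UNIV"
      using nonlin_fourier_rapid[OF st[OF t]] unfolding c_def
      by (intro summable_on_add summable_on_cmult_right summable_bracket)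
    then show ?thesis
    proof (rule summable_on_norm_bound(2)[rotated])
      fix k
      have "norm (c k t) * (norm (freq k))\<^sup>2 * bracket k ^ (2 * CARD('n)) \<le> norm (c k t) * (bracket k)\<^sup>2 * bracket k ^ (2 * CARD('n))"
        by (intro mult_right_mono mult_left_mono power_mono freq_le_bracket) auto
      also have "\<dots> \<le> Q" using Q[of k] by (simp add: power_add power2_eq_square mult_ac)
      finally have "(norm (freq k))\<^sup>2 * norm (c k t) \<le> Q * (1 / bracket k ^ (2 * CARD('n)))" by (simp add: pos_le_divide_eq mult.commute)
      then have "\<bar>\<nu>\<bar> * ((norm (freq k))\<^sup>2 * norm (c k t)) \<le> \<bar>\<nu>\<bar> * (Q * (1 / bracket k ^ (2 * CARD('n))))" by (rule mult_left_mono) simp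
      then show "norm (mode_rhs \<nu> (\<lambda>k. c k t) k)
        \<le> \<bar>\<nu>\<bar> * (Q * (1 / bracket k ^ (2 * CARD('n)))) + norm (nonlin (\<lambda>k. c k t) (\<lambda>k. c k t) k)"
        by (intro order_trans[OF norm_triangle_ineq] add_right_mono) (simp add: abs_mult)
    qed
  qed
  have dc: "(c k has_vector_derivative (mode_rhs \<nu> (\<lambda>k. c k t) k)) (at t within ?I)" if t: "t \<in> ?I" for k t
  proof -
    have "((\<lambda>t. integral cube (\<lambda>x. wave (- k) x *s complex_vec (u x t))) has_vector_derivative
        integral cube (\<lambda>x. wave (- k) x *s complex_vec (v (x, t)))) (at t within ?I)"
    proof (rule leibniz_rule_vector_derivative[where fx="\<lambda>t x. wave (- k) x *s complex_vec (v (x, t))"])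
      show "((\<lambda>t. wave (- k) x *s complex_vec (u x t)) has_vector_derivative wave (- k) x *s complex_vec (v (x, s))) (at s within ?I)"
        if "s \<in> ?I" for s x
        by (rule bounded_linear.has_vector_derivative[OF bounded_linear_smult_right dv[OF that]])
      show "(\<lambda>x. wave (- k) x *s complex_vec (u x s)) integrable_on cube" if "s \<in> ?I" for s
        by (intro integrable_continuous continuous_intros smooth_torus_continuous st that)
      show "continuous_on (?I \<times> cube) (\<lambda>(t, x). wave (- k) x *s complex_vec (v (x, t)))"
        unfolding split_beta
        by (intro continuous_intros continuous_on_compose2[OF continuous_on_wave[of UNIV]] continuous_on_compose2[OF vc]) auto
    qed (rule t, rule convex_time_interval)
    from bounded_linear.has_vector_derivative[OF bounded_linear_scaleR_right[of "1 / (2 * pi) ^ CARD('n)"] this]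
    have "(c k has_vector_derivative cfourier (\<lambda>x. complex_vec (v (x, t))) k) (at t within ?I)"
      unfolding c_def[abs_def] fourier_coeff_def cfourier_def .
    also have "cfourier (\<lambda>x. complex_vec (v (x, t))) k = mode_rhs \<nu> (\<lambda>k. c k t) k"
      unfolding v[OF t] by (rule cfourier_series[OF sm[OF t]])
    finally show ?thesis .
  qed
  have "driven \<nu> b c c"
    unfolding driven_def using has_vector_derivative_subinterval[OF b _ dc[OF in_I]] by blast
  moreover have "\<exists>C. \<forall>k. \<forall>t\<in>{0..b}. norm (c k t) * bracket k ^ p \<le> C" for p
    using slab_fourier_rapid[OF F per b, of p] unfolding c_def F_def by simp
  moreover have "real_modes (\<lambda>k. c k t) \<and> solenoidal (\<lambda>k. c k t)" if "t \<in> {0..b}" for t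
    using real_modes_fourier[OF st[OF in_I[OF that]]] solenoidal_fourier[OF st[OF in_I[OF that]]] div[OF in_I[OF that]]
    unfolding c_def by simp
  ultimately show ?thesis unfolding mode_sol_def c_def[abs_def] by blast
qed

text \<open>Conjugation symmetry makes the sum of the series real, so nothing is lost by taking the
  real part. The equation is obtained by termwise differentiation in time.\<close>

lemma modes_nse_solution:
  fixes c :: "int^'n \<Rightarrow> real \<Rightarrow> complex^'n"
  assumes c: "\<And>b. b \<in> time_interval T \<Longrightarrow> mode_sol \<nu> b c" and T: "0 < T"
    and u0: "smooth_torus u\<^sub>0" "\<And>k. c k 0 = fourier_coeff u\<^sub>0 k"
  shows "nse_solution \<nu> u\<^sub>0 T (\<lambda>x t. real_part (synth c (x, t)))"
    and "t \<in> time_interval T \<Longrightarrow> fourier_coeff (\<lambda>x. real_part (synth c (x, t))) k = c k t"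
proof -
  let ?I = "time_interval T"
  define u where "u x t = real_part (synth c (x, t))" for x t
  have ts: "time_smooth j T c" for j by (rule mode_sol_time_smooth[OF c])
  have self: "t \<in> {0..t}" if "t \<in> ?I" for t using that by (simp add: time_interval_def)
  have sm: "(\<lambda>k. norm (c k t)) summable_on UNIV" if "t \<in> ?I" for t by (rule rapid_on_summable[OF time_smooth_rapid[OF ts[of 0]] that])
  have rm: "real_modes (\<lambda>k. c k t)" and sol: "solenoidal (\<lambda>k. c k t)" if "t \<in> ?I" for t
    using c[OF that] self[OF that] unfolding mode_sol_def by auto
  have cu: "complex_vec (u x t) = (\<Sum>\<^sub>\<infinity>k. wave k x *s c k t)" if "t \<in> ?I" for x t
    using complex_vec_real_part[OF series_real[OF rm[OF that] sm[OF that]]] by (simp add: u_def synth_def)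
  have "smooth_on (UNIV \<times> ?I) (\<lambda>z. real_part (synth c z))"
    unfolding smooth_on_def by (intro allI Ck_on_bounded_linear[OF bounded_linear_real_part] synth_Ck ts)
  moreover have "(\<lambda>(x, t). u x t) = (\<lambda>z. real_part (synth c z))" by (auto simp: u_def fun_eq_iff)
  ultimately have sF: "smooth_on (UNIV \<times> ?I) (\<lambda>(x, t). u x t)" by simp
  have per: "torus_periodic (\<lambda>x. u x t)" if "t \<in> ?I" for t
    using series_periodic[OF sm[OF that]] by (simp add: u_def synth_def torus_periodic_def)
  have st: "smooth_torus (\<lambda>x. u x t)" if "t \<in> ?I" for t
    unfolding smooth_torus_def using per[OF that] smooth_on_slice[OF sF that] by simp
  have fc: "fourier_coeff (\<lambda>x. u x t) k = c k t" if "t \<in> ?I" for k t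
    unfolding fourier_coeff_eq cu[OF that] by (rule cfourier_series[OF sm[OF that]])
  have fc': "fourier_coeff (\<lambda>x. u x t) = (\<lambda>k. c k t)" if "t \<in> ?I" for t using fc[OF that] by blast
  have div: "\<forall>x. div_field (\<lambda>x. u x t) x = 0" if "t \<in> ?I" for t
    using solenoidal_fourier[OF st[OF that]] sol[OF that] unfolding fc'[OF that] by blast
  define c' where "c' k t = mode_rhs \<nu> (\<lambda>k. c k t) k" for k t
  have c': "\<And>k t. t \<in> ?I \<Longrightarrow> (c k has_vector_derivative c' k t) (at t within ?I)"
    unfolding c'_def by (rule mode_sol_vector_derivative[OF c])
  have rap': "rapid_on T c'"
  proof -
    obtain d where d: "\<And>k t. t \<in> ?I \<Longrightarrow> (c k has_vector_derivative d k t) (at t within ?I)" "time_smooth 0 T d"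
      using ts[of "Suc 0"] by (simp only: time_smooth.simps(2)) blast
    have "d k t = c' k t" if "t \<in> ?I" for k t
      by (rule vector_derivative_unique_within[OF time_interval_nontrivial[OF that] d(1)[OF that] c'[OF that]])
    then have e: "b \<in> ?I \<Longrightarrow> t \<in> {0..b} \<Longrightarrow> c' k t = d k t" for b k t using time_interval_subset by fastforce
    show ?thesis using time_smooth_rapid[OF d(2)] unfolding rapid_on_def by (simp add: e)
  qed
  have ode: "((\<lambda>s. complex_vec (u x s)) has_vector_derivative
       (\<nu> *\<^sub>R complex_vec (laplacian (\<lambda>y. u y t) x) - leray (advection (\<lambda>y. u y t)) x)) (at t within ?I)" if t: "t \<in> ?I" for t x
  proof (rule time_interval_vector_derivativeI[OF t])
    fix b assume b: "b \<in> ?I" "t < b"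
    have tb: "t \<in> {0..b}" using t b by (simp add: time_interval_def)
    have in_I: "s \<in> ?I" if "s \<in> {0..b}" for s using time_interval_subset[OF b(1)] that by blast
    obtain C where C: "\<And>k s. s \<in> {0..b} \<Longrightarrow> norm (c' k s) * bracket k ^ (2 * CARD('n)) \<le> C" using rapid_onD[OF rap' b(1)] by metis
    have "((\<lambda>s. \<Sum>\<^sub>\<infinity>k. wave k x *s c k s) has_vector_derivative (\<Sum>\<^sub>\<infinity>k. wave k x *s c' k t)) (at t within {0..b})"
    proof (rule has_vector_derivative_infsum[OF _ tb, where M="\<lambda>k. C * (1 / bracket k ^ (2 * CARD('n)))"])
      show "convex {0..b}" by simp
      fix k s assume s: "s \<in> {0..b}"
      show "((\<lambda>s. wave k x *s c k s) has_vector_derivative wave k x *s c' k s) (at s within {0..b})"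
        by (rule bounded_linear.has_vector_derivative[OF bounded_linear_smult_right has_vector_derivative_subinterval[OF b(1) s c'[OF in_I[OF s]]]])
      show "norm (wave k x *s c' k s) \<le> C * (1 / bracket k ^ (2 * CARD('n)))"
        using C[OF s, of k] by (simp add: norm_vector_smult pos_le_divide_eq)
    next
      show "(\<lambda>k::int^'n. C * (1 / bracket k ^ (2 * CARD('n)))) summable_on UNIV" by (intro summable_on_cmult_right summable_bracket)
      show "(\<lambda>k. wave k x *s c k s) summable_on UNIV" if "s \<in> {0..b}" for s by (rule series_summable[OF sm[OF in_I[OF that]]])
    qed
    then have "((\<lambda>s. complex_vec (u x s)) has_vector_derivative (\<Sum>\<^sub>\<infinity>k. wave k x *s c' k t)) (at t within {0..b})"
      by (rule has_vector_derivative_transform[OF tb cu[OF in_I], rotated])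
    then show "((\<lambda>s. complex_vec (u x s)) has_vector_derivative
       (\<nu> *\<^sub>R complex_vec (laplacian (\<lambda>y. u y t) x) - leray (advection (\<lambda>y. u y t)) x)) (at t within {0..b})"
      unfolding projected_rhs[OF st[OF t] div[OF t]] fc'[OF t] c'_def .
  qed
  have 0: "0 \<in> ?I" using T by (simp add: time_interval_def zero_ereal_def[symmetric])
  have "u x 0 = u\<^sub>0 x" for x
    by (rule smooth_torus_eqI[OF st[OF 0] u0(1)]) (simp add: fc[OF 0] u0(2))
  then show "nse_solution \<nu> u\<^sub>0 T (\<lambda>x t. real_part (synth c (x, t)))"
    unfolding nse_solution_def smooth_torus_time_def u_def[symmetric] using per sF ode div by blast
  show "t \<in> ?I \<Longrightarrow> fourier_coeff (\<lambda>x. real_part (synth c (x, t))) k = c k t"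
    using fc unfolding u_def .
qed

section \<open>The maximal solution\<close>

lemma sum_modes_eq:
  fixes a :: "int^'n \<Rightarrow> complex^'n"
  assumes "(\<lambda>k. norm (a k)) summable_on UNIV"
  shows "(\<Sum>\<^sub>\<infinity>k. norm (a k)) = norm (a 0) + (\<Sum>\<^sub>\<infinity>k\<in>UNIV - {0}. norm (a k))"
proof -
  have "(\<lambda>k. norm (a k)) summable_on (UNIV - {0})" by (rule summable_on_subset_banach[OF assms]) simp
  from infsum_insert[OF this, of 0] show ?thesis by (simp add: insert_Diff_single)
qed

text \<open>The bound on the amplitude, together with the constant mean, bounds the
  \<open>\<ell>\<^sup>1\<close> norm and hence the weighted norm of order \<open>2 n\<close> up to
  time \<open>s\<close>. The local existence time for data of this size is a fixed positive number,
  so a restart close enough to \<open>s\<close> passes \<open>s\<close>.\<close>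

lemma mode_sol_restart:
  fixes c :: "int^'n \<Rightarrow> real \<Rightarrow> complex^'n"
  assumes \<nu>: "\<nu> > 0" and s: "s > 0"
    and c: "\<And>b. 0 \<le> b \<Longrightarrow> b < s \<Longrightarrow> mode_sol \<nu> b c"
    and C: "\<And>t. 0 \<le> t \<Longrightarrow> t < s \<Longrightarrow> amplitude c t \<le> C"
  shows "\<exists>b d. b > s \<and> mode_sol \<nu> b d \<and> (\<forall>k. d k 0 = c k 0)"
proof -
  define P where "P = 2 * CARD('n)"
  define \<alpha> where "\<alpha> = max 1 (norm (c 0 0) + C)"
  have dec: "\<exists>Q. \<forall>k. norm (c k t) * bracket k ^ p \<le> Q" if "0 \<le> t" "t < s" for p t
    using c[OF that] that unfolding mode_sol_def by (meson atLeastAtMost_iff order_refl)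
  obtain Q where Q: "\<And>k. norm (c k 0) * bracket k ^ P \<le> Q" using dec[of 0 P] s by auto
  have Q0: "0 \<le> Q" using order_trans[OF _ Q[of 0]] by simp
  define \<gamma> where "\<gamma> = (2 ^ (P + 1) * \<alpha>)\<^sup>2 / \<nu>"
  have \<gamma>: "0 \<le> \<gamma>" using \<nu> by (simp add: \<gamma>_def)
  define R where "R = max 1 (2 * Q * exp (\<gamma> * s))"
  have bound: "norm (c k t) * bracket k ^ P \<le> R" if t: "0 \<le> t" "t < s" for k t
  proof -
    have "norm (c k t) * bracket k ^ P \<le> 2 * Q * exp ((2 ^ (P + 1) * \<alpha>)\<^sup>2 / \<nu> * t)"
    proof (rule mode_sol_persistence[OF \<nu> c[OF t] _ _ Q])
      show "\<alpha> > 0" by (simp add: \<alpha>_def)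
      show "t \<in> {0..t}" using t by simp
      fix r assume r: "r \<in> {0..t}"
      have "(\<Sum>\<^sub>\<infinity>k. norm (c k r)) = norm (c 0 r) + amplitude c r"
        unfolding amplitude_def by (rule sum_modes_eq[OF mode_sol_summable[OF c[OF t] r]])
      also have "c 0 r = c 0 0" by (rule mean_constant[OF c[OF t] r])
      finally show "(\<Sum>\<^sub>\<infinity>k. norm (c k r)) \<le> \<alpha>" using C[of r] r t by (simp add: \<alpha>_def)
    qed
    also have "\<dots> \<le> 2 * Q * exp (\<gamma> * s)"
      unfolding \<gamma>_def[symmetric] using t \<gamma> Q0 by (intro mult_left_mono) (auto intro: mult_left_mono)
    finally show ?thesis by (simp add: R_def)
  qed
  have R: "R > 0" by (simp add: R_def)
  obtain \<tau> where \<tau>: "\<tau> > 0" "\<forall>a :: int^'n \<Rightarrow> complex^'n. real_modes a \<longrightarrow> solenoidal a \<longrightarrow>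
      (\<forall>p. \<exists>Q. \<forall>k. norm (a k) * bracket k ^ p \<le> Q) \<longrightarrow>
      (\<forall>k. norm (a k) * bracket k ^ (2 * CARD('n)) \<le> R) \<longrightarrow> (\<exists>c. mode_sol \<nu> \<tau> c \<and> (\<forall>k. c k 0 = a k))"
    using local_existence[OF \<nu> R] by auto
  \<comment> \<open>Less than \<open>\<tau>\<close> before \<open>s\<close>, and not negative.\<close>
  define t where "t = max (s / 2) (s - \<tau> / 2)"
  have t: "0 \<le> t" "t < s" "s < t + \<tau>" using s \<tau>(1) by (auto simp: t_def max_def)
  have "t \<in> {0..t}" using t by simp
  then have ct: "real_modes (\<lambda>k. c k t)" "solenoidal (\<lambda>k. c k t)" using c[OF t(1,2)] unfolding mode_sol_def by blast+
  obtain d where d: "mode_sol \<nu> \<tau> d" "\<And>k. d k 0 = c k t"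
    using \<tau>(2)[rule_format, OF ct dec[OF t(1,2)] bound[OF t(1,2), unfolded P_def]] by blast
  have "mode_sol \<nu> (t + \<tau>) (\<lambda>k r. if r \<in> {0..t} then c k r else d k (r - t))"
    by (rule mode_sol_glue[OF c[OF t(1,2)] d t(1)]) (use \<tau> in simp)
  moreover have "(if 0 \<in> {0..t} then c k 0 else d k (0 - t)) = c k 0" for k using t by simp
  ultimately show ?thesis using t(3) by (intro exI[of _ "t + \<tau>"] exI[of _ "\<lambda>k r. if r \<in> {0..t} then c k r else d k (r - t)"]) blast
qed

text \<open>The time is the supremum of the existence times. By uniqueness the solutions on shorter
  intervals agree where they overlap and can be patched together.\<close>

lemma maximal_modes:
  fixes a :: "int^'n \<Rightarrow> complex^'n"
  assumes \<nu>: "\<nu> > 0" and a: "real_modes a" "solenoidal a" "\<And>p. \<exists>Q. \<forall>k. norm (a k) * bracket k ^ p \<le> Q"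
  shows "\<exists>(T :: ereal) c. 0 < T \<and> (\<forall>b\<in>time_interval T. mode_sol \<nu> b c) \<and> (\<forall>k. c k 0 = a k) \<and>
    (\<forall>b d. 0 < b \<longrightarrow> mode_sol \<nu> b d \<longrightarrow> (\<forall>k. d k 0 = a k) \<longrightarrow> ereal b \<le> T) \<and>
    (\<forall>s C. 0 \<le> s \<longrightarrow> (\<forall>t\<in>{0..s} \<inter> time_interval T. amplitude c t \<le> C) \<longrightarrow> ereal s < T)"
proof -
  define E where "E = {b. 0 < b \<and> (\<exists>d. mode_sol \<nu> b d \<and> (\<forall>k. d k 0 = a k))}"
  define T where "T = (SUP b\<in>E. ereal b)"
  obtain Q where Q: "\<And>k. norm (a k) * bracket k ^ (2 * CARD('n)) \<le> Q" using a(3) by blast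
  have "\<exists>\<tau>. \<tau> \<in> E"
  proof -
    have Q1: "norm (a k) * bracket k ^ (2 * CARD('n)) \<le> max 1 Q" for k using Q[of k] by (rule max.coboundedI2)
    have "max 1 Q > 0" by simp
    from local_existence[OF \<nu> this] obtain \<tau> where \<tau>: "\<tau> > 0" "\<forall>a :: int^'n \<Rightarrow> complex^'n. real_modes a \<longrightarrow> solenoidal a \<longrightarrow>
      (\<forall>p. \<exists>Q. \<forall>k. norm (a k) * bracket k ^ p \<le> Q) \<longrightarrow>
      (\<forall>k. norm (a k) * bracket k ^ (2 * CARD('n)) \<le> max 1 Q) \<longrightarrow> (\<exists>c. mode_sol \<nu> \<tau> c \<and> (\<forall>k. c k 0 = a k))" by auto
    then show ?thesis using \<tau>(2)[rule_format, OF a Q1] by (auto simp: E_def)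
  qed
  then obtain \<tau> where \<tau>: "\<tau> \<in> E" by blast
  have upper: "ereal b \<le> T" if "b \<in> E" for b unfolding T_def by (rule SUP_upper[OF that])
  have T0: "0 < T" using upper[OF \<tau>] \<tau> by (auto simp: E_def intro: less_le_trans[of 0 "ereal \<tau>"])
  have "\<exists>b d. t < b \<and> mode_sol \<nu> b d \<and> (\<forall>k. d k 0 = a k)" if "t \<in> time_interval T" for t
  proof -
    have "ereal t < T" using that by (simp add: time_interval_def)
    then obtain b where "b \<in> E" "ereal t < ereal b" unfolding T_def less_SUP_iff by blast
    then show ?thesis by (auto simp: E_def)
  qed
  then obtain \<beta> d where d: "\<And>t. t \<in> time_interval T \<Longrightarrow> t < \<beta> t" "\<And>t. t \<in> time_interval T \<Longrightarrow> mode_sol \<nu> (\<beta> t) (d t)"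
    "\<And>t k. t \<in> time_interval T \<Longrightarrow> d t k 0 = a k" by metis
  define c where "c k t = d t k t" for k t
  have c: "mode_sol \<nu> b c" if b: "b \<in> time_interval T" for b
  proof (rule mode_sol_cong)
    show "mode_sol \<nu> b (d b)" by (rule mode_sol_subinterval[OF d(2)[OF b]]) (use d(1)[OF b] in simp)
    fix k t assume t: "t \<in> {0..b}"
    then have tI: "t \<in> time_interval T" using time_interval_subset[OF b] by blast
    show "c k t = d b k t"
      unfolding c_def
    proof (rule mode_sol_unique[where c="d t" and d="d b" and T=t, OF \<nu>])
      show "mode_sol \<nu> t (d t)" by (rule mode_sol_subinterval[OF d(2)[OF tI]]) (use d(1)[OF tI] in simp)
      show "mode_sol \<nu> t (d b)" by (rule mode_sol_subinterval[OF d(2)[OF b]]) (use d(1)[OF b] t in simp)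
    qed (use d(3)[OF tI] d(3)[OF b] t in auto)
  qed
  have "0 \<in> time_interval T" using T0 by (simp add: time_interval_def zero_ereal_def[symmetric])
  then have c0: "c k 0 = a k" for k unfolding c_def by (rule d(3))
  have blowup: "ereal s < T" if s: "0 \<le> s" and C: "\<And>t. t \<in> {0..s} \<inter> time_interval T \<Longrightarrow> amplitude c t \<le> C" for s C
  proof (rule ccontr)
    assume "\<not> ereal s < T"
    then have le: "T \<le> ereal s" by simp
    then obtain r where r: "T = ereal r" using T0 by (cases T) auto
    have r0: "0 < r" "r \<le> s" using T0 le by (auto simp: r)
    have I: "t \<in> time_interval T" if "0 \<le> t" "t < r" for t using that by (simp add: time_interval_def r)
    have "\<exists>b d. b > r \<and> mode_sol \<nu> b d \<and> (\<forall>k. d k 0 = c k 0)"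
      by (rule mode_sol_restart[OF \<nu> r0(1), where C=C]) (use c I C r0 in auto)
    then obtain b d where b: "b > r" "mode_sol \<nu> b d" "\<forall>k. d k 0 = c k 0" by blast
    then have "b \<in> E" using r0 c0 by (auto simp: E_def)
    from upper[OF this] show False using b(1) by (simp add: r)
  qed
  have "\<forall>b d. 0 < b \<longrightarrow> mode_sol \<nu> b d \<longrightarrow> (\<forall>k. d k 0 = a k) \<longrightarrow> ereal b \<le> T"
    using upper unfolding E_def by blast
  moreover have "\<forall>s C. 0 \<le> s \<longrightarrow> (\<forall>t\<in>{0..s} \<inter> time_interval T. amplitude c t \<le> C) \<longrightarrow> ereal s < T"
    using blowup by (intro allI impI) (rule blowup, auto)
  ultimately show ?thesis using T0 c c0 by (intro exI[of _ T] exI[of _ c] conjI) auto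
qed

text \<open>A finite lifespan below the bound would leave the amplitude bounded up to the end, in
  contradiction to the continuation criterion.\<close>

lemma lifespan_lower_bound:
  fixes c :: "int^'n \<Rightarrow> real \<Rightarrow> complex^'n"
  assumes \<nu>: "\<nu> > 0" and T0: "0 < T" and c: "\<And>b. b \<in> time_interval T \<Longrightarrow> mode_sol \<nu> b c"
    and blowup: "\<And>s C. 0 \<le> s \<Longrightarrow> (\<And>t. t \<in> {0..s} \<inter> time_interval T \<Longrightarrow> amplitude c t \<le> C) \<Longrightarrow> ereal s < T"
  shows "(if amplitude c 0 \<le> \<nu> then \<infinity> else ereal (2 * \<nu> / (amplitude c 0)\<^sup>2)) \<le> T"
proof -
  define A where "A = amplitude c 0"
  have self: "t \<in> {0..t}" if "t \<in> time_interval T" for t using that by (simp add: time_interval_def)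
  have False if r: "T = ereal r" and small: "A \<le> \<nu> \<or> r < 2 * \<nu> / A\<^sup>2" for r
  proof -
    have r0: "0 < r" using T0 by (simp add: r)
    have "\<exists>C. \<forall>t\<in>time_interval T. amplitude c t \<le> C"
    proof (cases "A \<le> \<nu>")
      case True
      then show ?thesis using amplitude_le_viscosity[OF \<nu> c _ self] by (auto simp: A_def)
    next
      case False
      then have A: "A > 0" and rA: "r < 2 * \<nu> / A\<^sup>2" using small \<nu> by auto
      have pos: "1 / A\<^sup>2 - r / (2 * \<nu>) > 0" using rA A \<nu> by (simp add: field_simps)
      have "amplitude c t \<le> sqrt (1 / (1 / A\<^sup>2 - r / (2 * \<nu>)))" if t: "t \<in> time_interval T" for t
      proof (rule real_le_rsqrt)
        have "t / (2 * \<nu>) \<le> r / (2 * \<nu>)" using t \<nu> by (intro divide_right_mono) (auto simp: time_interval_def r)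
        then have le: "1 / A\<^sup>2 - r / (2 * \<nu>) \<le> 1 / A\<^sup>2 - t / (2 * \<nu>)" by simp
        have "(amplitude c t)\<^sup>2 \<le> 1 / (1 / A\<^sup>2 - t / (2 * \<nu>))"
          using amplitude_bernoulli[OF \<nu> c[OF t] _ self[OF t]] A pos le by (simp add: A_def)
        also have "\<dots> \<le> 1 / (1 / A\<^sup>2 - r / (2 * \<nu>))" using pos le by (intro divide_left_mono mult_pos_pos) auto
        finally show "(amplitude c t)\<^sup>2 \<le> 1 / (1 / A\<^sup>2 - r / (2 * \<nu>))" .
      qed
      then show ?thesis by blast
    qed
    then obtain C where "\<And>t. t \<in> time_interval T \<Longrightarrow> amplitude c t \<le> C" by blast
    then have "ereal r < T" using blowup[of r C] r0 by simp
    then show False by (simp add: r)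
  qed
  note contra = this
  show ?thesis
  proof (cases T)
    case (real r)
    then have "\<not> (A \<le> \<nu> \<or> r < 2 * \<nu> / A\<^sup>2)" using contra by blast
    then have "\<not> A \<le> \<nu>" "2 * \<nu> / A\<^sup>2 \<le> r" by linarith+
    then show ?thesis by (simp add: real A_def)
  qed (use T0 in auto)
qed

lemma nse_solution_slice:
  assumes "nse_solution \<nu> u\<^sub>0 T u" "t \<in> time_interval T"
  shows "smooth_torus (\<lambda>x. u x t)"
proof -
  have "smooth_on (UNIV \<times> time_interval T) (\<lambda>(x, t). u x t)" "torus_periodic (\<lambda>x. u x t)"
    using assms unfolding nse_solution_def smooth_torus_time_def by auto
  then show ?thesis using smooth_on_slice[of "time_interval T" "\<lambda>(x, t). u x t" t] assms(2) unfolding smooth_torus_def by simp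
qed

theorem theorem3p2:
  fixes \<nu> :: real and u\<^sub>0 :: "real^'n \<Rightarrow> real^'n"
  assumes "CARD('n) \<ge> 2"
    and "\<nu> > 0"
    and "smooth_torus u\<^sub>0"
    and "\<forall>x. div_field u\<^sub>0 x = 0"
  shows "\<exists>Tstar::ereal. 0 < Tstar \<and>
    Tstar \<ge> (if A0_norm u\<^sub>0 \<le> \<nu> then \<infinity> else ereal (2 * \<nu> / (A0_norm u\<^sub>0)\<^sup>2)) \<and>
    (\<exists>u. nse_solution \<nu> u\<^sub>0 Tstar u \<and>
         (\<forall>v. nse_solution \<nu> u\<^sub>0 Tstar v \<longrightarrow> (\<forall>t\<in>time_interval Tstar. \<forall>x. v x t = u x t)) \<and>
         (\<forall>S v. nse_solution \<nu> u\<^sub>0 S v \<longrightarrow> S \<le> Tstar) \<and>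
         (\<forall>T::real. 0 \<le> T \<longrightarrow>
            (\<exists>C::real. \<forall>t\<in>{0..T} \<inter> time_interval Tstar. A0_norm (\<lambda>x. u x t) \<le> C) \<longrightarrow>
            ereal T < Tstar))"
proof -
  note \<nu> = assms(2) and u0 = assms(3)
  define a where "a = fourier_coeff u\<^sub>0"
  have a: "real_modes a" "solenoidal a" "\<And>p. \<exists>Q. \<forall>k. norm (a k) * bracket k ^ p \<le> Q"
    unfolding a_def using real_modes_fourier[OF u0] solenoidal_fourier[OF u0] assms(4) fourier_coeff_rapid[OF u0] by auto
  obtain T :: ereal and c where T0: "0 < T" and c: "\<And>b. b \<in> time_interval T \<Longrightarrow> mode_sol \<nu> b c" and c0: "\<And>k. c k 0 = a k"
    and max: "\<forall>b d. 0 < b \<longrightarrow> mode_sol \<nu> b d \<longrightarrow> (\<forall>k. d k 0 = a k) \<longrightarrow> ereal b \<le> T"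
    and blowup: "\<forall>s C. 0 \<le> s \<longrightarrow> (\<forall>t\<in>{0..s} \<inter> time_interval T. amplitude c t \<le> C) \<longrightarrow> ereal s < T"
    using maximal_modes[OF \<nu> a] by (elim exE conjE) blast
  define u where "u x t = real_part (synth c (x, t))" for x t
  have u: "nse_solution \<nu> u\<^sub>0 T u" and fc: "\<And>t k. t \<in> time_interval T \<Longrightarrow> fourier_coeff (\<lambda>x. u x t) k = c k t"
    unfolding u_def using modes_nse_solution[OF c T0 u0 c0[unfolded a_def]] by auto
  have amp: "A0_norm (\<lambda>x. u x t) = amplitude c t" if "t \<in> time_interval T" for t
    by (simp add: A0_norm_def amplitude_def fc[OF that])
  have amp0: "A0_norm u\<^sub>0 = amplitude c 0" by (simp add: A0_norm_def amplitude_def c0 a_def)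
  have init: "fourier_coeff (\<lambda>x. v x 0) k = a k" if "nse_solution \<nu> u\<^sub>0 S v" for S v k
  proof -
    have "(\<lambda>x. v x 0) = u\<^sub>0" using that unfolding nse_solution_def by auto
    then show ?thesis by (simp add: a_def)
  qed
  have unique: "v x t = u x t" if v: "nse_solution \<nu> u\<^sub>0 T v" and t: "t \<in> time_interval T" for v t x
  proof (rule smooth_torus_eqI[OF nse_solution_slice[OF v t] nse_solution_slice[OF u t]])
    fix k
    have "t \<in> {0..t}" using t by (simp add: time_interval_def)
    then have "fourier_coeff (\<lambda>x. v x t) k = c k t"
      by (rule mode_sol_unique[OF \<nu> nse_solution_modes[OF v t] c[OF t], rotated]) (simp add: init[OF v] c0)
    then show "fourier_coeff (\<lambda>x. v x t) k = fourier_coeff (\<lambda>x. u x t) k" by (simp add: fc[OF t])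
  qed
  have maximal: "S \<le> T" if v: "nse_solution \<nu> u\<^sub>0 S v" for S v
  proof (rule ccontr)
    assume "\<not> S \<le> T"
    then obtain b where b: "T < b" "b < S" using dense[of T S] by (auto simp: not_le)
    then obtain r where r: "b = ereal r" using T0 by (cases b) auto
    have "0 < ereal r" using T0 b(1) unfolding r by (rule less_trans)
    then have r0: "0 < r" by simp
    have "mode_sol \<nu> r (\<lambda>k t. fourier_coeff (\<lambda>x. v x t) k)"
      by (rule nse_solution_modes[OF v]) (use r0 b in \<open>simp add: time_interval_def r\<close>)
    then have "ereal r \<le> T" using max[rule_format, OF r0] init[OF v] by blast
    then show False using b(1) by (simp add: r)
  qed
  have continuation: "ereal s < T" if "0 \<le> s" "\<forall>t\<in>{0..s} \<inter> time_interval T. A0_norm (\<lambda>x. u x t) \<le> C" for s C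
    by (rule blowup[rule_format, OF that(1), of C]) (use that(2) amp in auto)
  have lifespan: "(if A0_norm u\<^sub>0 \<le> \<nu> then \<infinity> else ereal (2 * \<nu> / (A0_norm u\<^sub>0)\<^sup>2)) \<le> T"
    unfolding amp0 by (rule lifespan_lower_bound[OF \<nu> T0 c blowup[rule_format]]) auto
  show ?thesis
  proof (rule exI[of _ T], rule conjI[OF T0], rule conjI[OF lifespan], rule exI[of _ u], rule conjI[OF u], intro conjI allI impI ballI)
    show "v x t = u x t" if "nse_solution \<nu> u\<^sub>0 T v" "t \<in> time_interval T" for v t x by (rule unique[OF that])
    show "S \<le> T" if "nse_solution \<nu> u\<^sub>0 S v" for S v by (rule maximal[OF that])
    fix s :: real
    assume s: "0 \<le> s" "\<exists>C. \<forall>t\<in>{0..s} \<inter> time_interval T. A0_norm (\<lambda>x. u x t) \<le> C"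
    obtain C where "\<forall>t\<in>{0..s} \<inter> time_interval T. A0_norm (\<lambda>x. u x t) \<le> C" using s(2) by (rule exE)
    then show "ereal s < T" by (rule continuation[OF s(1)])
  qed
qed

end
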